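(* Let $A\subseteq\mathbb{R}\setminus\{0\}$ be finite. Then there are subsets $X,Y,Z\subseteq A$ with $X\cup Y\cup Z=A$, $|X|,|Y|\ge|A|/4$ and $|Z|\ge|A|/2$, such that \[ E^+(X)^{182}\,E^\times(Y)^{26}\,E^\times(Z)^{63}\lesssim |A|^{736}. \]
   Context: $E^+(X)=\#\{(x_1,x_2,x_3,x_4)\in X^4:x_1-x_2=x_3-x_4\}$; $E^\times(Y)=\#\{(y_1,y_2,y_3,y_4)\in Y^4:y_1y_2=y_3y_4\}$. Notation: $P\lesssim Q$ means $P\le C\,Q(\log(2+|A|))^{c}$ for absolute constants $C,c>0$. *)

theory Defs
  imports Complex_Main
begin

definition add_energy :: "real set \<Rightarrow> nat" where
  "add_energy X = card {(x1, x2, x3, x4). x1 \<in> X \<and> x2 \<in> X \<and> x3 \<in> X \<and> x4 \<in> X \<and> x1 - x2 = x3 - x4}"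

definition mult_energy :: "real set \<Rightarrow> nat" where
  "mult_energy Y = card {(y1, y2, y3, y4). y1 \<in> Y \<and> y2 \<in> Y \<and> y3 \<in> Y \<and> y4 \<in> Y \<and> y1 * y2 = y3 * y4}"

end

theory Submission
  imports Defs "HOL-Analysis.Convex" "HOL-Analysis.L2_Norm" "HOL-Library.Z2" "HOL-Library.Product_Plus"
begin

text \<open>
  Write \<open>N = |A|\<close> and ignore logarithms. Say that \<open>S\<close> is controlled by \<open>K\<close> if the third moment
  of \<open>b \<mapsto> #{s - b = x}\<close> is at most \<open>K |B|\<^sup>2\<close> for every finite \<open>B\<close>. The energy of a controlled set
  satisfies \<open>E\<^sup>2\<^sup>6 \<le> K\<^sup>2 |S|\<^sup>2\<^sup>6 E\<^sub>3\<^sup>1\<^sup>2\<close>, where \<open>E\<^sub>3\<close> is the third moment for \<open>B = S\<close>: count triples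
  of \<open>S\<close> whose consecutive differences are popular, weighted by the positive definite kernel given by the
  number of representations of the outer difference. This holds in every abelian group, so it
  applies to sums and to products.

  If many elements of a set are richly represented as sums \<open>b + d\<close>, then Szemeredi-Trotter on
  Cartesian products bounds their multiplicative structure. Removing such pieces greedily, one
  splits \<open>A = A\<^sub>1 \<union> Z\<close> with \<open>E\<^sup>\<times>(Z)\<^sup>3 E\<^sub>3\<^sup>+(A\<^sub>1)\<^sup>4 \<le> N\<^sup>2\<^sup>2\<close>, and then \<open>A\<^sub>1 = X \<union> Y\<close> such that the additive control
  of \<open>X\<close> times the multiplicative control of \<open>Y\<close> is at most \<open>N\<^sup>3\<close>. The exponents of the theorem are those
  for which all unknown quantities cancel when these bounds are multiplied.
\<close>

section \<open>Inequalities for finite sums\<close>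

text \<open>The third moment of \<open>X\<close> is never estimated on its own: it is kept in the
  energy bound for \<open>X\<close> and paid for by \<open>Z\<close>, whereas control already bounds
  that of \<open>Y\<close> by \<open>K' N^2\<close>. This dictates the weights. The bound for
  \<open>E(X)^26\<close> is raised to the power 7 and that for \<open>E(Z)^3\<close> to the power
  21, so that \<open>7 * 12 = 4 * 21\<close> powers of the third moment cancel, and \<open>Y\<close>
  contributes \<open>K'^14\<close> against \<open>K^14\<close>. Hence \<open>182 = 7 * 26\<close>,
  \<open>63 = 3 * 21\<close> and \<open>7 * 26 + 50 + 14 * 3 + 21 * 22 = 736\<close>. Fourth roots
  of energies and cube roots of control constants obey the triangle inequality for unions. A bound
  proportional to the size of each removed piece therefore adds up without any loss in the number of
  pieces. The piece that crosses the half-way mark is kept on both sides, so the parts overlap; one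
  halving gives \<open>Z\<close> its \<open>1/2\<close>, two give \<open>X\<close> and
  \<open>Y\<close> their \<open>1/4\<close>.\<close>

lemma sum_sq2_le_cubes:
  fixes f g :: "'a \<Rightarrow> real"
  assumes f: "\<And>i. i \<in> I \<Longrightarrow> f i \<ge> 0" and g: "\<And>i. i \<in> I \<Longrightarrow> g i \<ge> 0"
  shows "(\<Sum>i\<in>I. (f i)^2 * g i)^3 \<le> (\<Sum>i\<in>I. (f i)^3)^2 * (\<Sum>i\<in>I. (g i)^3)"
proof -
  define u where "u = (\<Sum>i\<in>I. (f i)^2 * g i)"
  define v where "v = (\<Sum>i\<in>I. f i * (g i)^2)"
  define F where "F = (\<Sum>i\<in>I. (f i)^3)"
  define G where "G = (\<Sum>i\<in>I. (g i)^3)"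
  have key: "(\<Sum>i\<in>I. (p i)^2 * q i)^2 \<le> (\<Sum>i\<in>I. (p i)^3) * (\<Sum>i\<in>I. p i * (q i)^2)"
    if p: "\<And>i. i \<in> I \<Longrightarrow> p i \<ge> 0" for p q :: "'a \<Rightarrow> real"
  proof -
    have "(\<Sum>i\<in>I. (p i)^2 * q i) = (\<Sum>i\<in>I. (p i * sqrt (p i)) * (sqrt (p i) * q i))"
      by (intro sum.cong refl) (simp add: p power2_eq_square mult.assoc)
    also have "\<dots>^2 \<le> (\<Sum>i\<in>I. (p i * sqrt (p i))^2) * (\<Sum>i\<in>I. (sqrt (p i) * q i)^2)"
      by (rule Cauchy_Schwarz_ineq_sum)
    also have "(\<Sum>i\<in>I. (p i * sqrt (p i))^2) = (\<Sum>i\<in>I. (p i)^3)"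
      by (intro sum.cong refl) (simp add: p power_mult_distrib power2_eq_square power3_eq_cube)
    also have "(\<Sum>i\<in>I. (sqrt (p i) * q i)^2) = (\<Sum>i\<in>I. p i * (q i)^2)"
      by (intro sum.cong refl) (simp add: p power_mult_distrib)
    finally show ?thesis .
  qed
  have u0: "u \<ge> 0" and v0: "v \<ge> 0" and F0: "F \<ge> 0" and G0: "G \<ge> 0"
    unfolding u_def v_def F_def G_def using f g by (auto intro!: sum_nonneg)
  \<comment> \<open>Two Cauchy-Schwarz bounds replace Hoelder: eliminating \<open>v\<close> gives
    \<open>u^4 <= F^2 G u\<close>, and one factor \<open>u\<close> cancels.\<close>
  have 1: "u^2 \<le> F * v" using key[of f g] f by (simp add: u_def v_def F_def)
  have 2: "v^2 \<le> G * u" using key[of g f] g by (simp add: u_def v_def G_def mult.commute)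
  have "u^3 * u = (u^2)^2" by (simp add: power_numeral_reduce)
  also have "\<dots> \<le> (F * v)^2" using 1 u0 by (intro power_mono) auto
  also have "\<dots> = F^2 * v^2" by (simp add: power_mult_distrib)
  also have "\<dots> \<le> F^2 * (G * u)" using 2 by (intro mult_left_mono) auto
  finally have "u^3 * u \<le> (F^2 * G) * u" by (simp add: mult.assoc)
  then have "u^3 \<le> F^2 * G"
  proof (cases "u = 0")
    case True then show ?thesis using F0 G0 by simp
  next
    case False then show ?thesis using u0 \<open>u^3 * u \<le> (F^2 * G) * u\<close> by (simp add: mult_le_cancel_right)
  qed
  then show ?thesis by (simp add: u_def F_def G_def)
qed

text \<open>Cauchy-Schwarz for \<open>f^(1/2) * f^(3/2)\<close>. First moments are known exactly or
  trivially, so this turns bounds on third moments into bounds on second moments.\<close>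

lemma sum_sq_le_first_third:
  fixes f :: "'a \<Rightarrow> real"
  assumes f: "\<And>i. i \<in> I \<Longrightarrow> f i \<ge> 0"
  shows "(\<Sum>i\<in>I. (f i)^2)^2 \<le> (\<Sum>i\<in>I. f i) * (\<Sum>i\<in>I. (f i)^3)"
proof -
  have "(\<Sum>i\<in>I. (f i)^2) = (\<Sum>i\<in>I. sqrt (f i) * (f i * sqrt (f i)))"
    by (intro sum.cong refl) (simp add: f power2_eq_square)
  also have "\<dots>^2 \<le> (\<Sum>i\<in>I. (sqrt (f i))^2) * (\<Sum>i\<in>I. (f i * sqrt (f i))^2)"
    by (rule Cauchy_Schwarz_ineq_sum)
  also have "(\<Sum>i\<in>I. (f i * sqrt (f i))^2) = (\<Sum>i\<in>I. (f i)^3)"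
    by (intro sum.cong refl) (simp add: f power_mult_distrib power2_eq_square power3_eq_cube)
  also have "(\<Sum>i\<in>I. (sqrt (f i))^2) = (\<Sum>i\<in>I. f i)"
    by (intro sum.cong refl) (simp add: f)
  finally show ?thesis .
qed

text \<open>Cauchy-Schwarz with weight \<open>f\<close>, then the Hoelder bound above for
  \<open>g^2 f\<close>. Of \<open>g\<close> only the third moment enters. It later correlates the
  incidence counts of two different grids.\<close>

lemma sum_mult_le_asymmetric:
  fixes f g :: "'a \<Rightarrow> real"
  assumes f: "\<And>i. i \<in> I \<Longrightarrow> f i \<ge> 0" and g: "\<And>i. i \<in> I \<Longrightarrow> g i \<ge> 0"
  shows "(\<Sum>i\<in>I. f i * g i)^6 \<le> (\<Sum>i\<in>I. (g i)^3)^2 * (\<Sum>i\<in>I. (f i)^3) * (\<Sum>i\<in>I. f i)^3"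
proof -
  have "(\<Sum>i\<in>I. f i * g i) = (\<Sum>i\<in>I. sqrt (f i) * (sqrt (f i) * g i))"
    by (intro sum.cong refl) (simp add: f flip: mult.assoc)
  also have "\<dots>^2 \<le> (\<Sum>i\<in>I. (sqrt (f i))^2) * (\<Sum>i\<in>I. (sqrt (f i) * g i)^2)"
    by (rule Cauchy_Schwarz_ineq_sum)
  also have "(\<Sum>i\<in>I. (sqrt (f i))^2) = (\<Sum>i\<in>I. f i)"
    by (intro sum.cong refl) (simp add: f)
  also have "(\<Sum>i\<in>I. (sqrt (f i) * g i)^2) = (\<Sum>i\<in>I. (g i)^2 * f i)"
    by (intro sum.cong refl) (simp add: f power_mult_distrib)
  finally have 1: "(\<Sum>i\<in>I. f i * g i)^2 \<le> (\<Sum>i\<in>I. f i) * (\<Sum>i\<in>I. (g i)^2 * f i)" .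
  have "(\<Sum>i\<in>I. f i * g i)^6 = ((\<Sum>i\<in>I. f i * g i)^2)^3" by simp
  also have "\<dots> \<le> ((\<Sum>i\<in>I. f i) * (\<Sum>i\<in>I. (g i)^2 * f i))^3"
    using 1 by (intro power_mono) auto
  also have "\<dots> = (\<Sum>i\<in>I. f i)^3 * (\<Sum>i\<in>I. (g i)^2 * f i)^3" by (simp add: power_mult_distrib)
  also have "\<dots> \<le> (\<Sum>i\<in>I. f i)^3 * ((\<Sum>i\<in>I. (g i)^3)^2 * (\<Sum>i\<in>I. (f i)^3))"
    using sum_sq2_le_cubes[of I g f] f g by (intro mult_left_mono) (auto intro!: sum_nonneg)
  finally show ?thesis by (simp add: mult_ac)
qed

text \<open>The summand 1 makes this at least 1 for \<open>n >= 1\<close>, so its powers may be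
  increased freely, and lets it dominate the harmonic sum. At 0 the value is 1, because
  \<open>ln 0 = 0\<close>.\<close>

definition lg :: "nat \<Rightarrow> real" where "lg n = 1 + ln (real n)"

lemma lg_ge_1: "n \<ge> 1 \<Longrightarrow> lg n \<ge> 1"
  by (simp add: lg_def)

lemma lg_nonneg: "lg n \<ge> 0"
  by (cases n) (auto simp: lg_def)

lemma lg_mono: "m \<le> n \<Longrightarrow> lg m \<le> lg n"
  by (cases m; cases n) (auto simp: lg_def)

lemma lg_le_2: "m \<le> n^2 \<Longrightarrow> lg m \<le> 2 * lg n"
proof (cases m)
  case 0 then show ?thesis using lg_nonneg[of n] by (cases n) (auto simp: lg_def)
next
  case (Suc k)
  assume a: "m \<le> n^2"
  with Suc have n: "n \<ge> 1" by (cases n) auto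
  have "real m \<le> real n ^ 2" using a by (metis of_nat_le_iff of_nat_power)
  then have "ln (real m) \<le> ln (real n ^ 2)" using Suc n by (subst ln_le_cancel_iff) auto
  also have "\<dots> = 2 * ln (real n)" using n by (simp add: ln_realpow)
  finally show ?thesis by (simp add: lg_def)
qed

lemma sum_inverse_le_lg: "n \<ge> 1 \<Longrightarrow> (\<Sum>t=1..n. 1 / real t) \<le> lg n"
proof (induction n rule: nat_induct_at_least)
  case base then show ?case by (simp add: lg_def)
next
  case (Suc n)
  have "ln (real n / real (Suc n)) \<le> real n / real (Suc n) - 1"
    using Suc by (intro ln_le_minus_one) auto
  moreover have "real n / real (Suc n) - 1 = - (1 / real (Suc n))" by (simp add: field_simps)
  moreover have "ln (real n / real (Suc n)) = ln (real n) - ln (real (Suc n))"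
    using Suc by (simp add: ln_div)
  ultimately have "1 / real (Suc n) \<le> ln (real (Suc n)) - ln (real n)" by linarith
  with Suc show ?case by (simp add: lg_def)
qed

section \<open>Pigeonhole principles\<close>

text \<open>Discrete form of the integral of \<open>(k + 1) x^k\<close>: each increment of
  \<open>x^(k + 1)\<close> is compared with the right end point. It feeds the layer-cake formula
  below.\<close>

lemma power_le_sum_powers: "real f ^ Suc k \<le> Suc k * (\<Sum>t=1..f. real t ^ k)"
proof (induction f)
  case (Suc f)
  have "real (Suc f) ^ Suc k - real f ^ Suc k \<le> Suc k * real (Suc f) ^ k"
  proof -
    have "real (Suc f) ^ Suc k - real f ^ Suc k
        = (real (Suc f) - real f) * (\<Sum>p<Suc k. real (Suc f) ^ p * real f ^ (k - p))"
      using diff_power_eq_sum[of "real (Suc f)" k "real f"] by simp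
    also have "\<dots> = (\<Sum>p<Suc k. real (Suc f) ^ p * real f ^ (k - p))" by simp
    also have "\<dots> \<le> (\<Sum>p<Suc k. real (Suc f) ^ k)"
    proof (intro sum_mono)
      fix p assume p: "p \<in> {..<Suc k}"
      have "real (Suc f) ^ p * real f ^ (k - p) \<le> real (Suc f) ^ p * real (Suc f) ^ (k - p)"
        by (intro mult_left_mono power_mono) auto
      also have "\<dots> = real (Suc f) ^ k" using p by (simp flip: power_add)
      finally show "real (Suc f) ^ p * real f ^ (k - p) \<le> real (Suc f) ^ k" .
    qed
    finally show ?thesis by simp
  qed
  with Suc show ?case by (simp add: algebra_simps)
qed simp

text \<open>Layer-cake summation: a weak-type bound \<open>M / t^k\<close> for the weight of each
  superlevel set contributes \<open>M / t\<close> at level \<open>t\<close>, and the harmonic sum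
  costs one logarithm.\<close>

lemma sum_power_le_levels:
  fixes f :: "'a \<Rightarrow> nat" and g :: "'a \<Rightarrow> real"
  assumes fin: "finite X" and k: "k \<ge> 1" and N: "N \<ge> 1"
    and fN: "\<And>x. x \<in> X \<Longrightarrow> f x \<le> N" and g: "\<And>x. x \<in> X \<Longrightarrow> g x \<ge> 0"
    and M: "\<And>t. t \<in> {1..N} \<Longrightarrow> real t ^ k * sum g {x\<in>X. f x \<ge> t} \<le> M"
  shows "(\<Sum>x\<in>X. g x * real (f x) ^ k) \<le> k * lg N * M"
proof -
  obtain j where j: "k = Suc j" using k by (cases k) auto
  have "(\<Sum>x\<in>X. g x * real (f x) ^ k) \<le> (\<Sum>x\<in>X. g x * (k * (\<Sum>t=1..f x. real t ^ j)))"
    unfolding j using power_le_sum_powers g by (intro sum_mono mult_left_mono) auto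
  also have "\<dots> = (\<Sum>x\<in>X. \<Sum>t=1..N. if t \<le> f x then k * (g x * real t ^ j) else 0)"
  proof (intro sum.cong refl)
    fix x assume x: "x \<in> X"
    have "{t\<in>{1..N}. t \<le> f x} = {1..f x}" using fN[OF x] by auto
    then have "(\<Sum>t=1..N. if t \<le> f x then k * (g x * real t ^ j) else 0) = (\<Sum>t=1..f x. k * (g x * real t ^ j))"
      by (simp flip: sum.inter_filter)
    then show "g x * (k * (\<Sum>t=1..f x. real t ^ j)) = (\<Sum>t=1..N. if t \<le> f x then k * (g x * real t ^ j) else 0)"
      by (simp add: sum_distrib_left mult_ac)
  qed
  also have "\<dots> = (\<Sum>t=1..N. \<Sum>x\<in>X. if t \<le> f x then k * (g x * real t ^ j) else 0)"
    by (rule sum.swap)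
  also have "\<dots> = (\<Sum>t=1..N. k * real t ^ j * sum g {x\<in>X. f x \<ge> t})"
    using fin by (intro sum.cong refl) (simp add: sum.inter_filter sum_distrib_left mult_ac flip: sum.inter_filter)
  also have "\<dots> \<le> (\<Sum>t=1..N. k * M * (1 / real t))"
  proof (intro sum_mono)
    fix t assume t: "t \<in> {1..N}"
    have "real t ^ j * sum g {x\<in>X. f x \<ge> t} \<le> M / real t"
      using M[OF t] t by (simp add: j field_simps)
    then have "k * (real t ^ j * sum g {x\<in>X. f x \<ge> t}) \<le> k * (M / real t)"
      by (intro mult_left_mono) auto
    then show "k * real t ^ j * sum g {x\<in>X. f x \<ge> t} \<le> k * M * (1 / real t)" by (simp add: mult.assoc)
  qed
  also have "\<dots> = k * M * (\<Sum>t=1..N. 1 / real t)" by (simp add: sum_distrib_left)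
  also have "\<dots> \<le> k * M * lg N"
  proof -
    \<comment> \<open>Level 1 shows \<open>M >= 0\<close>, which is needed to multiply the harmonic
      bound by \<open>M\<close>.\<close>
    have "0 \<le> real 1 ^ k * sum g {x\<in>X. f x \<ge> 1}" using g by (auto intro!: sum_nonneg)
    also have "\<dots> \<le> M" using M[of 1] N by simp
    finally show ?thesis using sum_inverse_le_lg[OF N] by (intro mult_left_mono) auto
  qed
  finally show ?thesis by (simp add: mult_ac)
qed

text \<open>The same bound read backwards: with \<open>M\<close> the largest level quantity, one
  superlevel set carries the whole moment up to a logarithm.\<close>

lemma sum_power_pigeonhole:
  fixes f :: "'a \<Rightarrow> nat" and g :: "'a \<Rightarrow> real"
  assumes fin: "finite X" and k: "k \<ge> 1" and N: "N \<ge> 1"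
    and fN: "\<And>x. x \<in> X \<Longrightarrow> f x \<le> N" and g: "\<And>x. x \<in> X \<Longrightarrow> g x \<ge> 0"
  obtains t where "t \<in> {1..N}" 
    "(\<Sum>x\<in>X. g x * real (f x) ^ k) \<le> k * lg N * (real t ^ k * sum g {x\<in>X. f x \<ge> t})"
proof -
  let ?h = "\<lambda>t. real t ^ k * sum g {x\<in>X. f x \<ge> t}"
  have "Max (?h ` {1..N}) \<in> ?h ` {1..N}" using N by (intro Max_in) auto
  then obtain t where t: "t \<in> {1..N}" "?h t = Max (?h ` {1..N})" by force
  have "?h s \<le> ?h t" if "s \<in> {1..N}" for s using that unfolding t(2) by (intro Max_ge) auto
  then have "(\<Sum>x\<in>X. g x * real (f x) ^ k) \<le> k * lg N * ?h t"
    by (intro sum_power_le_levels[OF fin k N fN g]) auto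
  with t(1) show ?thesis by (rule that)
qed

lemma sum_power_pigeonhole_card:
  fixes f :: "'a \<Rightarrow> nat"
  assumes "finite X" "k \<ge> 1" "N \<ge> 1" "\<And>x. x \<in> X \<Longrightarrow> f x \<le> N"
  obtains t where "t \<in> {1..N}" 
    "(\<Sum>x\<in>X. real (f x) ^ k) \<le> k * lg N * (real t ^ k * card {x\<in>X. f x \<ge> t})"
proof -
  obtain t where "t \<in> {1..N}"
    "(\<Sum>x\<in>X. 1 * real (f x) ^ k) \<le> k * lg N * (real t ^ k * sum (\<lambda>_. 1) {x\<in>X. f x \<ge> t})"
    by (rule sum_power_pigeonhole[of X k N f "\<lambda>_. 1"]) (use assms in auto)
  then show ?thesis by (intro that) auto
qed

text \<open>In decreasing order the \<open>j\<close>-th weight is at most \<open>M / j\<close>,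
  since at least \<open>j\<close> weights are as large. The induction peels off the smallest weight,
  whose superlevel set is all of \<open>X\<close>.\<close>

lemma sum_le_lg_card:
  fixes w :: "'a \<Rightarrow> nat"
  assumes "finite X" "X \<noteq> {}" "\<And>x. x \<in> X \<Longrightarrow> w x * card {y\<in>X. w y \<ge> w x} \<le> M"
  shows "real (sum w X) \<le> (\<Sum>t=1..card X. 1 / real t) * real M"
  using assms
proof (induction "card X" arbitrary: X)
  case 0 then show ?case by simp
next
  case (Suc n)
  obtain x where x: "x \<in> X" "\<And>y. y \<in> X \<Longrightarrow> w x \<le> w y"
    using arg_min_if_finite(1)[OF Suc.prems(1,2), of w] arg_min_least[OF Suc.prems(1,2), of _ w] by metis
  have "{y\<in>X. w y \<ge> w x} = X" using x by auto
  with Suc.prems(3)[OF x(1)] have "w x * card X \<le> M" by simp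
  then have "real (w x) * real (card X) \<le> real M" by (metis of_nat_le_iff of_nat_mult)
  then have wx: "real (w x) \<le> 1 / real (Suc n) * real M" using Suc.hyps(2) by (simp add: field_simps)
  have n: "n = card (X - {x})" using Suc x by simp
  have "real (sum w (X - {x})) \<le> (\<Sum>t=1..n. 1 / real t) * real M"
  proof (cases "X - {x} = {}")
    case True then show ?thesis by (simp only: True) (auto intro!: sum_nonneg mult_nonneg_nonneg)
  next
    case False
    show ?thesis unfolding n
    proof (rule Suc.hyps(1)[OF n])
      fix z assume z: "z \<in> X - {x}"
      have "w z * card {y\<in>X - {x}. w y \<ge> w z} \<le> w z * card {y\<in>X. w y \<ge> w z}"
        using Suc.prems(1) by (intro mult_left_mono card_mono) auto
      also have "\<dots> \<le> M" using Suc.prems(3) z by blast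
      finally show "w z * card {y\<in>X - {x}. w y \<ge> w z} \<le> M" .
    qed (use Suc.prems False in auto)
  qed
  moreover have "real (sum w X) = real (w x) + real (sum w (X - {x}))"
    using x Suc.prems(1) by (simp add: sum.remove)
  ultimately show ?case using wx by (simp flip: Suc.hyps(2) add: algebra_simps)
qed

text \<open>The logarithmic loss depends on the number of summands only, not on the size of the weights.\<close>

lemma sum_pigeonhole_card:
  fixes w :: "'a \<Rightarrow> nat"
  assumes "finite X" "X \<noteq> {}"
  obtains x where "x \<in> X" "real (sum w X) \<le> lg (card X) * (w x * card {y\<in>X. w y \<ge> w x})"
proof -
  let ?h = "\<lambda>x. w x * card {y\<in>X. w y \<ge> w x}"
  have "Max (?h ` X) \<in> ?h ` X" using assms by (intro Max_in) auto
  then obtain x where x: "x \<in> X" "?h x = Max (?h ` X)" by force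
  have "real (sum w X) \<le> (\<Sum>t=1..card X. 1 / real t) * real (?h x)"
    using assms unfolding x(2) by (intro sum_le_lg_card Max_ge) auto
  also have "\<dots> \<le> lg (card X) * real (?h x)"
    using assms by (intro mult_right_mono sum_inverse_le_lg) (auto simp: Suc_le_eq card_gt_0_iff)
  finally show ?thesis using that[OF x(1)] by simp
qed

section \<open>Incidences between lines and a Cartesian product\<close>

text \<open>Cutting by ranks instead of lengths makes every block of \<open>g\<close> consecutive
  ranks hold at most \<open>g\<close> points, however unevenly \<open>P\<close> is spaced.\<close>

definition rank_in :: "real set \<Rightarrow> real \<Rightarrow> nat" where "rank_in P x = card {a\<in>P. a < x}"

lemma rank_in_mono: "finite P \<Longrightarrow> x \<le> y \<Longrightarrow> rank_in P x \<le> rank_in P y"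
  unfolding rank_in_def by (intro card_mono) auto

lemma rank_in_strict: "finite P \<Longrightarrow> x \<in> P \<Longrightarrow> x < y \<Longrightarrow> rank_in P x < rank_in P y"
  unfolding rank_in_def by (intro psubset_card_mono) auto

lemma rank_in_inj: "finite P \<Longrightarrow> inj_on (rank_in P) P"
  by (intro inj_onI) (metis linorder_neq_iff rank_in_strict)

lemma rank_in_le: "finite P \<Longrightarrow> rank_in P x \<le> card P"
  unfolding rank_in_def by (intro card_mono) auto

lemma card_rank_in_block:
  assumes "finite P" "g \<ge> 1"
  shows "card {x\<in>P. rank_in P x div g = j} \<le> g"
proof -
  have "card {x\<in>P. rank_in P x div g = j} = card (rank_in P ` {x\<in>P. rank_in P x div g = j})"
    using rank_in_inj[OF assms(1)] by (intro card_image[symmetric]) (auto intro: inj_on_subset)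
  also have "\<dots> \<le> card {j * g..<j * g + g}"
  proof (intro card_mono)
    show "rank_in P ` {x\<in>P. rank_in P x div g = j} \<subseteq> {j * g..<j * g + g}"
    proof
      fix r assume "r \<in> rank_in P ` {x\<in>P. rank_in P x div g = j}"
      then have "r div g = j" by auto
      moreover have "r = r div g * g + r mod g" by simp
      moreover have "r mod g < g" using assms by simp
      ultimately show "r \<in> {j * g..<j * g + g}" by simp
    qed
  qed auto
  finally show ?thesis by simp
qed

text \<open>A point that is not the chosen representative of its fibre collides with it, and
  different points give different pairs.\<close>

lemma card_le_image_plus_collisions:
  assumes "finite S"
  shows "card S \<le> card (f ` S) + card {(x, y) \<in> S \<times> S. x \<noteq> y \<and> f x = f y}"
proof -
  define r where "r v = (SOME x. x \<in> S \<and> f x = v)" for v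
  have r: "r (f x) \<in> S \<and> f (r (f x)) = f x" if "x \<in> S" for x
    unfolding r_def using someI[of "\<lambda>z. z \<in> S \<and> f z = f x" x] that by simp
  let ?T = "{x\<in>S. x \<noteq> r (f x)}"
  have "S \<subseteq> r ` (f ` S) \<union> ?T" by auto
  then have "card S \<le> card (r ` (f ` S) \<union> ?T)" using assms by (intro card_mono) auto
  also have "\<dots> \<le> card (r ` (f ` S)) + card ?T" by (rule card_Un_le)
  also have "card (r ` (f ` S)) \<le> card (f ` S)" using assms by (intro card_image_le) auto
  also have "card ?T = card ((\<lambda>x. (x, r (f x))) ` ?T)" by (intro card_image[symmetric] inj_onI) auto
  also have "\<dots> \<le> card {(x, y) \<in> S \<times> S. x \<noteq> y \<and> f x = f y}"
  proof (intro card_mono)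
    show "finite {(x, y) \<in> S \<times> S. x \<noteq> y \<and> f x = f y}"
      by (rule finite_subset[of _ "S \<times> S"]) (use assms in auto)
    show "(\<lambda>x. (x, r (f x))) ` ?T \<subseteq> {(x, y) \<in> S \<times> S. x \<noteq> y \<and> f x = f y}"
      using r by auto
  qed
  finally show ?thesis by simp
qed

definition hits :: "real set \<Rightarrow> real set \<Rightarrow> real \<times> real \<Rightarrow> real set" where
  "hits P Q l = {x\<in>P. fst l * x + snd l \<in> Q}"

lemma finite_hits [simp]: "finite P \<Longrightarrow> finite (hits P Q l)"
  by (simp add: hits_def)

text \<open>Cut the grid into cells of \<open>g \<times> h\<close> points. A line is monotone, so it meets at most
  \<open>card P div g + card Q div h + 1\<close> cells; and two points in a cell determine the line.\<close>

lemma grid_incidences_cells: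
  fixes P Q :: "real set" and L :: "(real \<times> real) set"
  assumes fin: "finite P" "finite Q" "finite L" and L: "\<And>l. l \<in> L \<Longrightarrow> fst l \<noteq> 0"
    and g: "g \<ge> 1" and h: "h \<ge> 1"
  shows "(\<Sum>l\<in>L. card (hits P Q l)) \<le> card L * (card P div g + card Q div h + 1) + card P * card Q * (g * h)"
proof -
  define bP where "bP x = rank_in P x div g" for x
  define bQ where "bQ y = rank_in Q y div h" for y
  have bP_mono: "bP x \<le> bP y" if "x \<le> y" for x y
    unfolding bP_def using rank_in_mono[OF fin(1) that] by (rule div_le_mono)
  have bQ_mono: "bQ x \<le> bQ y" if "x \<le> y" for x y
    unfolding bQ_def using rank_in_mono[OF fin(2) that] by (rule div_le_mono)
  have bP_le: "bP x \<le> card P div g" for x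
    unfolding bP_def using rank_in_le[OF fin(1)] by (rule div_le_mono)
  have bQ_le: "bQ x \<le> card Q div h" for x
    unfolding bQ_def using rank_in_le[OF fin(2)] by (rule div_le_mono)
  define val where "val l x = fst l * x + snd l" for l :: "real \<times> real" and x
  \<comment> \<open>Along an increasing line both block indices are monotone; along a decreasing one
    the row index is reversed, so that it increases too. Equal sums of two increasing indices force
    both to be equal, so \<open>idx\<close> numbers the cells met by the line.\<close>
  define idx where "idx l x = bP x + (if fst l > 0 then bQ (val l x) else card Q div h - bQ (val l x))"
    for l x
  define coll where "coll l = {(x, y) \<in> hits P Q l \<times> hits P Q l. x \<noteq> y \<and> idx l x = idx l y}" for l
  have fin_coll: "finite (coll l)" for l
    unfolding coll_def by (rule finite_subset[of _ "hits P Q l \<times> hits P Q l"]) (use fin in auto)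
  \<comment> \<open>The reversed index uses truncated subtraction, which is injective only up to
    \<open>m\<close>.\<close>
  have trunc: "a = b \<and> c = d" if "d \<le> c" "a + (m - c) = b + (m - d)" "a \<le> b" "c \<le> m" for a b c d m :: nat
    using that by arith
  have same': "bP x = bP y \<and> bQ (val l x) = bQ (val l y)" if "idx l x = idx l y" "x \<le> y" for l x y
  proof (cases "fst l > 0")
    case True
    then have "val l x \<le> val l y" using that by (simp add: val_def)
    then show ?thesis using True that bP_mono[OF that(2)] bQ_mono[of "val l x" "val l y"] by (simp add: idx_def)
  next
    case False
    then have "val l y \<le> val l x" using that by (simp add: val_def mult_left_mono_neg)
    then have 1: "bQ (val l y) \<le> bQ (val l x)" by (rule bQ_mono)
    have 2: "bP x + (card Q div h - bQ (val l x)) = bP y + (card Q div h - bQ (val l y))"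
      using that(1) False by (simp only: idx_def if_False)
    show ?thesis by (rule trunc[OF 1 2 bP_mono[OF that(2)] bQ_le])
  qed
  have same: "bP x = bP y \<and> bQ (val l x) = bQ (val l y)" if "idx l x = idx l y" for l x y
    using same'[of l x y] same'[of l y x] that by (metis linorder_le_cases)
  have line: "card (hits P Q l) \<le> (card P div g + card Q div h + 1) + card (coll l)" for l
  proof -
    have "card (idx l ` hits P Q l) \<le> card {..card P div g + card Q div h}"
    proof (intro card_mono)
      show "idx l ` hits P Q l \<subseteq> {..card P div g + card Q div h}"
        using bP_le bQ_le by (auto simp: idx_def intro!: add_mono)
    qed auto
    then show ?thesis
      using card_le_image_plus_collisions[of "hits P Q l" "idx l"] fin unfolding coll_def by simp
  qed
  \<comment> \<open>Pairs of grid points in a common cell. Two distinct points recover slope and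
    intercept, so the collisions on all lines together inject into these pairs.\<close>
  define cellmates where
    "cellmates = (SIGMA p:P \<times> Q. {x\<in>P. rank_in P x div g = bP (fst p)} \<times> {y\<in>Q. rank_in Q y div h = bQ (snd p)})"
  have "card cellmates = (\<Sum>p\<in>P \<times> Q. card ({x\<in>P. rank_in P x div g = bP (fst p)} \<times> {y\<in>Q. rank_in Q y div h = bQ (snd p)}))"
    unfolding cellmates_def using fin by (intro card_SigmaI) auto
  also have "\<dots> \<le> (\<Sum>p\<in>P \<times> Q. g * h)"
    unfolding card_cartesian_product using card_rank_in_block fin g h by (intro sum_mono mult_mono) auto
  finally have cm: "card cellmates \<le> card P * card Q * (g * h)" by (simp add: card_cartesian_product)
  have "(\<Sum>l\<in>L. card (coll l)) = card (SIGMA l:L. coll l)"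
    using fin fin_coll by (intro card_SigmaI[symmetric]) auto
  also have "\<dots> \<le> card cellmates"
  proof (rule card_inj_on_le)
    let ?F = "\<lambda>(l, (x, y)). ((x, val l x), (y, val l y))"
    show "inj_on ?F (SIGMA l:L. coll l)"
    proof (rule inj_onI)
      fix u v assume u: "u \<in> (SIGMA l:L. coll l)" and v: "v \<in> (SIGMA l:L. coll l)" and eq: "?F u = ?F v"
      obtain l x y l' x' y' where uv: "u = (l, x, y)" "v = (l', x', y')" by (cases u; cases v) auto
      have xy: "x = x'" "y = y'" "val l x = val l' x" "val l y = val l' y" using eq by (auto simp: uv)
      have "x \<noteq> y" using u by (auto simp: uv coll_def)
      have "fst l * (x - y) = fst l' * (x - y)" using xy(3,4) by (simp add: val_def algebra_simps)
      then have "fst l = fst l'" using \<open>x \<noteq> y\<close> by simp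
      moreover then have "snd l = snd l'" using xy(3) by (simp add: val_def)
      ultimately show "u = v" using xy by (simp add: uv prod_eq_iff)
    qed
    show "?F ` (SIGMA l:L. coll l) \<subseteq> cellmates"
    proof (rule image_subsetI)
      fix u assume "u \<in> (SIGMA l:L. coll l)"
      then obtain l x y where u: "u = (l, x, y)" "(x, y) \<in> coll l" by (cases u) auto
      then have "x \<in> P" "y \<in> P" "val l x \<in> Q" "val l y \<in> Q" "idx l x = idx l y"
        by (auto simp: coll_def hits_def val_def)
      then show "?F u \<in> cellmates" using same[of l x y] by (simp add: u(1) cellmates_def bP_def bQ_def)
    qed
    show "finite cellmates" unfolding cellmates_def using fin by auto
  qed
  finally have "(\<Sum>l\<in>L. card (coll l)) \<le> card P * card Q * (g * h)" using cm by simp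
  moreover define m where "m = card P div g + card Q div h + 1"
  moreover have "(\<Sum>l\<in>L. card (hits P Q l)) \<le> (\<Sum>l\<in>L. m + card (coll l))"
    unfolding m_def by (intro sum_mono line)
  ultimately show ?thesis unfolding m_def[symmetric] by (simp add: sum.distrib)
qed

text \<open>Szemeredi-Trotter for Cartesian products. With \<open>k\<close> the mean number of
  points per line, the cells are chosen so that a line meets at most \<open>3 k / 4\<close> of them;
  then at least a quarter of all incidences is paid for by collisions inside cells. The second
  alternative is the trivial regime of few points per line.\<close>

lemma grid_incidences:
  fixes P Q :: "real set" and L :: "(real \<times> real) set"
  assumes fin: "finite P" "finite Q" "finite L" and L: "\<And>l. l \<in> L \<Longrightarrow> fst l \<noteq> 0"
  defines "I \<equiv> real (\<Sum>l\<in>L. card (hits P Q l))"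
  shows "I^3 \<le> 100 * real (card P)^2 * real (card Q)^2 * real (card L)^2 \<or> I < 4 * real (card L)"
proof (cases "I < 4 * real (card L)")
  case False
  show ?thesis
  proof (cases "L = {}")
    case True then show ?thesis by (simp add: I_def)
  next
    case ne: False
    define n where "n = real (card L)"
    have n: "n > 0" using ne fin by (simp add: n_def card_gt_0_iff)
    define k where "k = I / n"
    have I: "I = k * n" using n by (simp add: k_def)
    have k4: "k \<ge> 4" using False n by (simp add: I n_def)
    define p where "p = real (card P)"
    define q where "q = real (card Q)"
    have "card (hits P Q l) \<le> card P" for l
      unfolding hits_def using fin by (intro card_mono) auto
    then have "(\<Sum>l\<in>L. card (hits P Q l)) \<le> (\<Sum>l\<in>L. card P)" by (intro sum_mono)
    then have "I \<le> n * p" unfolding I_def n_def p_def by (simp flip: of_nat_mult del: of_nat_sum)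
    then have kp: "k \<le> p" using n by (simp add: I mult.commute)
    have "card (hits P Q l) \<le> card Q" if "l \<in> L" for l
    proof (rule card_inj_on_le[where f = "\<lambda>x. fst l * x + snd l"])
      show "inj_on (\<lambda>x. fst l * x + snd l) (hits P Q l)" using L[OF that] by (auto intro: inj_onI)
      show "(\<lambda>x. fst l * x + snd l) ` hits P Q l \<subseteq> Q" by (auto simp: hits_def)
    qed (use fin in auto)
    then have "(\<Sum>l\<in>L. card (hits P Q l)) \<le> (\<Sum>l\<in>L. card Q)" by (intro sum_mono)
    then have "I \<le> n * q" unfolding I_def n_def q_def by (simp flip: of_nat_mult del: of_nat_sum)
    then have kq: "k \<le> q" using n by (simp add: I mult.commute)
    \<comment> \<open>The factor 4 makes the number of blocks at most \<open>k / 4\<close> in each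
      direction, and \<open>k >= 4\<close> absorbs the extra 1. As \<open>k <= p\<close> and
      \<open>k <= q\<close>, rounding up raises the factor 4 to at most 5.\<close>
    define g where "g = nat \<lceil>4 * p / k\<rceil>"
    define h where "h = nat \<lceil>4 * q / k\<rceil>"
    have pk: "4 * p / k \<ge> 4" "4 * q / k \<ge> 4" using kp kq k4 by (auto simp: field_simps)
    have g1: "g \<ge> 1" and h1: "h \<ge> 1" using pk unfolding g_def h_def by linarith+
    have gp: "real g \<ge> 4 * p / k" "real h \<ge> 4 * q / k" unfolding g_def h_def by linarith+
    have "real g \<le> 4 * p / k + 1" "real h \<le> 4 * q / k + 1" using pk unfolding g_def h_def by linarith+
    moreover have "1 \<le> p / k" "1 \<le> q / k" using kp kq k4 by auto
    ultimately have gu: "real g \<le> 5 * p / k" "real h \<le> 5 * q / k" by auto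
    have dp: "real (card P div g) \<le> k / 4"
    proof -
      have "real (card P div g) \<le> p / real g" by (simp add: p_def of_nat_div_le_of_nat)
      also have "\<dots> \<le> p / (4 * p / k)" using gp pk kp k4 by (intro divide_left_mono) auto
      also have "\<dots> = k / 4" using kp k4 by (simp add: field_simps)
      finally show ?thesis .
    qed
    have dq: "real (card Q div h) \<le> k / 4"
    proof -
      have "real (card Q div h) \<le> q / real h" by (simp add: q_def of_nat_div_le_of_nat)
      also have "\<dots> \<le> q / (4 * q / k)" using gp pk kq k4 by (intro divide_left_mono) auto
      also have "\<dots> = k / 4" using kq k4 by (simp add: field_simps)
      finally show ?thesis .
    qed
    have "I \<le> real (card L * (card P div g + card Q div h + 1) + card P * card Q * (g * h))"
      unfolding I_def using grid_incidences_cells[OF fin L g1 h1] by (simp only: of_nat_le_iff)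
    also have "\<dots> = n * (real (card P div g) + real (card Q div h) + 1) + p * q * (real g * real h)"
      unfolding n_def p_def q_def by (simp only: of_nat_add of_nat_mult of_nat_1)
    also have "\<dots> \<le> n * (k / 4 + k / 4 + k / 4) + p * q * ((5 * p / k) * (5 * q / k))"
      using dp dq gu n k4 kp kq by (intro add_mono mult_left_mono mult_mono) (auto simp: p_def q_def)
    finally have "k * n / 4 \<le> 25 * p^2 * q^2 / k^2"
      by (simp add: I power2_eq_square field_simps)
    then have "k * n * k^2 \<le> 100 * p^2 * q^2" using k4 by (simp add: field_simps)
    then have "k * n * k^2 * n^2 \<le> 100 * p^2 * q^2 * n^2" by (intro mult_right_mono) auto
    then show ?thesis by (simp add: I p_def q_def n_def power_mult_distrib power3_eq_cube power2_eq_square mult_ac)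
  qed
qed simp

section \<open>Representation functions and energies\<close>

definition rep :: "'a::ab_group_add set \<Rightarrow> 'a set \<Rightarrow> 'a \<Rightarrow> nat" where
  "rep A B x = card {(a, b). a \<in> A \<and> b \<in> B \<and> a - b = x}"

definition dset :: "'a::ab_group_add set \<Rightarrow> 'a set \<Rightarrow> 'a set" where
  "dset A B = (\<lambda>(a, b). a - b) ` (A \<times> B)"

text \<open>The \<open>k\<close>-th moment of the representation function: for \<open>k = 1\<close>
  the number of pairs, for \<open>k = 2\<close> and \<open>A = B\<close> the usual additive
  energy.\<close>

definition energy :: "nat \<Rightarrow> 'a::ab_group_add set \<Rightarrow> 'a set \<Rightarrow> real" where
  "energy k A B = (\<Sum>x\<in>dset A B. real (rep A B x) ^ k)"

lemma finite_dset [simp]: "finite A \<Longrightarrow> finite B \<Longrightarrow> finite (dset A B)"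
  by (simp add: dset_def)

lemma energy_nonneg: "energy k A B \<ge> 0"
  by (auto simp: energy_def intro!: sum_nonneg)

lemma finite_rep_pairs:
  "finite A \<Longrightarrow> finite B \<Longrightarrow> finite {(a, b). a \<in> A \<and> b \<in> B \<and> R a b}"
  by (rule finite_subset[of _ "A \<times> B"]) auto

lemma real_rep_eq:
  assumes "finite A" "finite B"
  shows "real (rep A B x) = (\<Sum>a\<in>A. \<Sum>b\<in>B. of_bool (a - b = x))"
proof -
  have "real (rep A B x) = (\<Sum>p\<in>{(a, b). a \<in> A \<and> b \<in> B \<and> a - b = x}. 1)" by (simp add: rep_def)
  also have "\<dots> = (\<Sum>p\<in>A \<times> B. of_bool (fst p - snd p = x))"
    using assms by (intro sum.mono_neutral_cong_left) auto
  finally show ?thesis by (simp add: sum.cartesian_product case_prod_beta)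
qed

lemma real_rep_eq1:
  assumes "finite A" "finite B"
  shows "real (rep A B x) = (\<Sum>a\<in>A. of_bool (a - x \<in> B))"
  unfolding real_rep_eq[OF assms]
proof (intro sum.cong refl)
  fix a
  have "(\<Sum>b\<in>B. of_bool (a - b = x)) = (\<Sum>b\<in>B. if b = a - x then 1 else (0::real))"
    by (intro sum.cong) (auto simp: algebra_simps)
  then show "(\<Sum>b\<in>B. of_bool (a - b = x)) = (of_bool (a - x \<in> B) :: real)"
    using assms by (simp add: sum.delta')
qed

lemma real_rep_eq2:
  assumes "finite A" "finite B"
  shows "real (rep A B x) = (\<Sum>b\<in>B. of_bool (b + x \<in> A))"
  unfolding real_rep_eq[OF assms] sum.swap[of _ B A]
proof (intro sum.cong refl)
  fix b
  have "(\<Sum>a\<in>A. of_bool (a - b = x)) = (\<Sum>a\<in>A. if a = b + x then 1 else (0::real))"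
    by (intro sum.cong) (auto simp: algebra_simps)
  then show "(\<Sum>a\<in>A. of_bool (a - b = x)) = (of_bool (b + x \<in> A) :: real)"
    using assms by (simp add: sum.delta')
qed

lemma rep_eq_0: "x \<notin> dset A B \<Longrightarrow> rep A B x = 0"
proof -
  assume "x \<notin> dset A B"
  then have "{(a, b). a \<in> A \<and> b \<in> B \<and> a - b = x} = {}" by (force simp: dset_def)
  then show ?thesis unfolding rep_def by (simp only: card.empty)
qed

lemma rep_pos:
  assumes "finite A" "finite B" "x \<in> dset A B" shows "rep A B x \<ge> 1"
proof -
  obtain a b where "a \<in> A" "b \<in> B" "x = a - b" using assms(3) by (auto simp: dset_def)
  then have "{(a, b). a \<in> A \<and> b \<in> B \<and> a - b = x} \<noteq> {}" by auto
  then show ?thesis using finite_rep_pairs[OF assms(1,2)] by (simp add: rep_def Suc_le_eq card_gt_0_iff)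
qed

lemma rep_le1: assumes "finite A" "finite B" shows "rep A B x \<le> card A"
proof -
  have "real (rep A B x) \<le> (\<Sum>a\<in>A. 1)"
    unfolding real_rep_eq1[OF assms] by (intro sum_mono) auto
  then show ?thesis by simp
qed

lemma rep_le2: assumes "finite A" "finite B" shows "rep A B x \<le> card B"
proof -
  have "real (rep A B x) \<le> (\<Sum>a\<in>B. 1)"
    unfolding real_rep_eq2[OF assms] by (intro sum_mono) auto
  then show ?thesis by simp
qed

lemma rep_mono: "finite A' \<Longrightarrow> finite B' \<Longrightarrow> A \<subseteq> A' \<Longrightarrow> B \<subseteq> B' \<Longrightarrow> rep A B x \<le> rep A' B' x"
  unfolding rep_def by (intro card_mono finite_rep_pairs) auto

lemma sum_differences:
  fixes f :: "'a::ab_group_add \<Rightarrow> real"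
  assumes "finite A" "finite B"
  shows "(\<Sum>a\<in>A. \<Sum>b\<in>B. f (a - b)) = (\<Sum>x\<in>dset A B. real (rep A B x) * f x)"
proof -
  have "(\<Sum>x\<in>dset A B. real (rep A B x) * f x)
      = (\<Sum>x\<in>dset A B. \<Sum>a\<in>A. \<Sum>b\<in>B. of_bool (a - b = x) * f x)"
    by (simp add: real_rep_eq assms sum_distrib_right)
  also have "\<dots> = (\<Sum>a\<in>A. \<Sum>b\<in>B. \<Sum>x\<in>dset A B. of_bool (a - b = x) * f x)"
    by (subst sum.swap) (intro sum.cong refl sum.swap)
  also have "\<dots> = (\<Sum>a\<in>A. \<Sum>b\<in>B. f (a - b))"
  proof (intro sum.cong refl)
    fix a b assume "a \<in> A" "b \<in> B"
    then have "a - b \<in> dset A B" by (auto simp: dset_def)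
    moreover have "(\<Sum>x\<in>dset A B. of_bool (a - b = x) * f x) = (\<Sum>x\<in>dset A B. if x = a - b then f x else 0)"
      by (intro sum.cong) auto
    ultimately show "(\<Sum>x\<in>dset A B. of_bool (a - b = x) * f x) = f (a - b)"
      using assms by (simp add: sum.delta')
  qed
  finally show ?thesis by simp
qed

lemma energy_1: "finite A \<Longrightarrow> finite B \<Longrightarrow> energy 1 A B = real (card A) * real (card B)"
  using sum_differences[of A B "\<lambda>_. 1"] by (simp add: energy_def)

lemma sum_rep_power_le:
  assumes "finite A" "finite B" "finite U" "k \<ge> 1"
  shows "(\<Sum>x\<in>U. real (rep A B x) ^ k) \<le> energy k A B"
proof -
  \<comment> \<open>Outside \<open>dset A B\<close> the summand is \<open>0 ^ k\<close>, which
    vanishes only because \<open>k >= 1\<close>.\<close>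
  have "(\<Sum>x\<in>U. real (rep A B x) ^ k) = (\<Sum>x\<in>U \<inter> dset A B. real (rep A B x) ^ k)"
    using assms rep_eq_0[of _ A B] by (intro sum.mono_neutral_right) (auto simp: power_0_left)
  also have "\<dots> \<le> energy k A B"
    unfolding energy_def using assms by (intro sum_mono2) auto
  finally show ?thesis .
qed

lemma energy_mono:
  assumes "finite A'" "finite B'" "A \<subseteq> A'" "B \<subseteq> B'" "k \<ge> 1"
  shows "energy k A B \<le> energy k A' B'"
proof -
  have fin: "finite A" "finite B" using assms finite_subset by auto
  have "energy k A B \<le> (\<Sum>x\<in>dset A B. real (rep A' B' x) ^ k)"
    unfolding energy_def using rep_mono[OF assms(1-4)] by (intro sum_mono power_mono) auto
  also have "\<dots> \<le> energy k A' B'" using assms fin by (intro sum_rep_power_le) auto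
  finally show ?thesis .
qed

lemma card_superlevel:
  assumes "finite A" "finite B"
  shows "real t ^ k * card {x\<in>dset A B. rep A B x \<ge> t} \<le> energy k A B"
proof -
  have "real t ^ k * card {x\<in>dset A B. rep A B x \<ge> t} = (\<Sum>x\<in>{x\<in>dset A B. rep A B x \<ge> t}. real t ^ k)" by simp
  also have "\<dots> \<le> (\<Sum>x\<in>{x\<in>dset A B. rep A B x \<ge> t}. real (rep A B x) ^ k)"
    by (intro sum_mono power_mono) auto
  also have "\<dots> \<le> energy k A B" unfolding energy_def using assms by (intro sum_mono2) auto
  finally show ?thesis .
qed

text \<open>Both sides count the solutions of \<open>a - a' = z - d\<close>, rewritten as
  \<open>a - z = a' - d\<close>.\<close>

lemma sum_rep_differences:
  assumes "finite A" "finite Z" "finite D"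
  shows "(\<Sum>z\<in>Z. \<Sum>d\<in>D. real (rep A A (z - d))) = (\<Sum>w\<in>dset A Z. real (rep A Z w) * real (rep A D w))"
proof -
  have "(\<Sum>z\<in>Z. \<Sum>d\<in>D. real (rep A A (z - d)))
      = (\<Sum>z\<in>Z. \<Sum>d\<in>D. \<Sum>a\<in>A. \<Sum>a'\<in>A. of_bool (a - z = a' - d))"
    unfolding real_rep_eq[OF assms(1) assms(1)]
    by (intro sum.cong refl) (simp add: algebra_simps)
  also have "\<dots> = (\<Sum>a\<in>A. \<Sum>z\<in>Z. \<Sum>d\<in>D. \<Sum>a'\<in>A. of_bool (a - z = a' - d))"
    by (subst sum.swap[of _ Z A]) (intro sum.cong refl sum.swap)
  also have "\<dots> = (\<Sum>a\<in>A. \<Sum>z\<in>Z. real (rep A D (a - z)))"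
    unfolding real_rep_eq[OF assms(1,3)]
    by (subst sum.swap[of _ A D]) (intro sum.cong refl, auto)
  also have "\<dots> = (\<Sum>w\<in>dset A Z. real (rep A Z w) * real (rep A D w))"
    using assms by (intro sum_differences)
  finally show ?thesis .
qed

lemma sum_rep_differences_sq_le:
  assumes "finite A" "finite Z" "finite D"
  shows "(\<Sum>z\<in>Z. \<Sum>d\<in>D. real (rep A A (z - d)))^2 \<le> energy 2 A Z * energy 2 A D"
proof -
  have "(\<Sum>z\<in>Z. \<Sum>d\<in>D. real (rep A A (z - d)))^2
      \<le> (\<Sum>w\<in>dset A Z. real (rep A Z w)^2) * (\<Sum>w\<in>dset A Z. real (rep A D w)^2)"
    unfolding sum_rep_differences[OF assms] by (rule Cauchy_Schwarz_ineq_sum)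
  also have "\<dots> \<le> energy 2 A Z * energy 2 A D"
    unfolding energy_def[of 2 A Z] using assms
    by (intro mult_left_mono sum_rep_power_le) (auto intro!: sum_nonneg)
  finally show ?thesis .
qed

definition controlled :: "'a::ab_group_add set \<Rightarrow> real \<Rightarrow> bool" where
  "controlled A K \<longleftrightarrow> (\<forall>B. finite B \<longrightarrow> energy 3 A B \<le> K * real (card B)^2)"

lemma controlled_nonneg: "controlled (A :: 'a::ab_group_add set) K \<Longrightarrow> K \<ge> 0"
proof -
  assume "controlled A K"
  then have "energy 3 A {0} \<le> K * real (card {0::'a})^2"
    unfolding controlled_def by blast
  then show "K \<ge> 0" using energy_nonneg[of 3 A "{0}"] by simp
qed

lemma energy_2_sq_le:
  assumes "finite A" "finite B" "controlled A K"
  shows "(energy 2 A B)^2 \<le> K * real (card A) * real (card B)^3"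
proof -
  have "(energy 2 A B)^2 \<le> energy 1 A B * energy 3 A B"
    unfolding energy_def using sum_sq_le_first_third[of "dset A B" "\<lambda>x. real (rep A B x)"] by simp
  also have "\<dots> \<le> (real (card A) * real (card B)) * (K * real (card B)^2)"
    unfolding energy_1[OF assms(1,2)] using assms by (intro mult_left_mono) (auto simp: controlled_def)
  finally show ?thesis by (simp add: power2_eq_square power3_eq_cube mult_ac)
qed

section \<open>Bounding the energy of a controlled set\<close>

text \<open>For a weighted graph with degrees \<open>d\<close> the right-hand sum counts walks of
  length three. Vertices of degree below \<open>\<theta>\<close>, a quarter of the mean, carry at
  most a quarter of the weight at either end. So half of the weight joins vertices of degree at
  least \<open>\<theta>\<close>, and \<open>\<theta>^2 * Q / 2 = Q^3 / (32 * n^2)\<close>.\<close>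

lemma three_paths_ge:
  fixes M :: "'a \<Rightarrow> 'a \<Rightarrow> real" and d :: "'a \<Rightarrow> real"
  assumes "finite A" and M: "\<And>a c. M a c \<ge> 0" "\<And>a c. M a c = M c a"
    and d: "\<And>a. a \<in> A \<Longrightarrow> d a = (\<Sum>c\<in>A. M a c)"
  shows "(\<Sum>a\<in>A. d a)^3 \<le> 32 * real (card A)^2 * (\<Sum>a\<in>A. \<Sum>c\<in>A. M a c * (d a * d c))"
proof (cases "A = {}")
  case False
  define n where "n = real (card A)"
  have n: "n > 0" using False assms(1) by (simp add: n_def card_gt_0_iff)
  define Q where "Q = (\<Sum>a\<in>A. d a)"
  have d0: "d a \<ge> 0" if "a \<in> A" for a using that M by (auto simp: d intro!: sum_nonneg)
  have Q0: "Q \<ge> 0" using d0 by (auto simp: Q_def intro!: sum_nonneg)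
  define \<theta> where "\<theta> = Q / (4 * n)"
  have t0: "\<theta> \<ge> 0" using Q0 n by (simp add: \<theta>_def)
  define low where "low a = (if d a < \<theta> then 1 else 0 :: real)" for a
  have "(\<Sum>a\<in>A. low a * d a) \<le> (\<Sum>a\<in>A. \<theta>)"
    using d0 t0 by (intro sum_mono) (auto simp: low_def)
  then have lowsum: "(\<Sum>a\<in>A. low a * d a) \<le> n * \<theta>" by (simp add: n_def)
  have s1: "(\<Sum>a\<in>A. \<Sum>c\<in>A. M a c) = Q" by (simp add: Q_def d)
  have s2: "(\<Sum>a\<in>A. \<Sum>c\<in>A. M a c * low a) = (\<Sum>a\<in>A. low a * d a)"
    by (intro sum.cong refl) (simp add: d sum_distrib_left mult.commute)
  have s3: "(\<Sum>a\<in>A. \<Sum>c\<in>A. M a c * low c) = (\<Sum>a\<in>A. low a * d a)"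
    using M(2) by (subst sum.swap) (simp flip: s2)
  \<comment> \<open>If one end is low the left side is at most 0, so discarding low vertices is a
    pointwise inequality and the sum need not be split.\<close>
  have pt: "\<theta>^2 * (1 - low a - low c) \<le> d a * d c" if "a \<in> A" "c \<in> A" for a c
  proof (cases "d a < \<theta> \<or> d c < \<theta>")
    case True
    then have "1 - low a - low c \<le> 0" by (auto simp: low_def)
    then have "\<theta>^2 * (1 - low a - low c) \<le> 0" by (simp add: mult_nonneg_nonpos)
    also have "0 \<le> d a * d c" using that d0 by simp
    finally show ?thesis .
  next
    case False
    then show ?thesis using t0 by (auto simp: low_def power2_eq_square intro!: mult_mono)
  qed
  have "\<theta>^2 * (Q / 2) = \<theta>^2 * (Q - 2 * (n * \<theta>))" using n by (simp add: \<theta>_def field_simps)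
  also have "\<dots> \<le> \<theta>^2 * (Q - 2 * (\<Sum>a\<in>A. low a * d a))" using lowsum by (intro mult_left_mono) auto
  also have "\<dots> = \<theta>^2 * ((\<Sum>a\<in>A. \<Sum>c\<in>A. M a c) - (\<Sum>a\<in>A. \<Sum>c\<in>A. M a c * low a) - (\<Sum>a\<in>A. \<Sum>c\<in>A. M a c * low c))"
    unfolding s1 s2 s3 by simp
  also have "\<dots> = (\<Sum>a\<in>A. \<Sum>c\<in>A. M a c * (\<theta>^2 * (1 - low a - low c)))"
    unfolding sum_subtractf[symmetric] sum_distrib_left by (intro sum.cong refl) (simp add: algebra_simps)
  also have "\<dots> \<le> (\<Sum>a\<in>A. \<Sum>c\<in>A. M a c * (d a * d c))"
    using pt M by (intro sum_mono mult_left_mono) auto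
  finally have "Q^3 / (32 * n^2) \<le> (\<Sum>a\<in>A. \<Sum>c\<in>A. M a c * (d a * d c))"
    using n by (simp add: \<theta>_def power2_eq_square power3_eq_cube)
  then show ?thesis using n by (simp add: Q_def n_def field_simps)
qed simp

text \<open>The pairs in \<open>A\<close> with difference \<open>a - c\<close> are the common
  translates of \<open>(a, c)\<close>. The kernel is thus the inner product of the indicators of
  \<open>A - a\<close> and \<open>A - c\<close>, hence positive definite.\<close>

lemma rep_self_shift:
  fixes A :: "'a::ab_group_add set"
  assumes "finite A" "a \<in> A" "c \<in> A"
  shows "real (rep A A (a - c)) = (\<Sum>u\<in>dset A A. of_bool (a + u \<in> A) * of_bool (c + u \<in> A))"
proof -
  have "(\<Sum>u\<in>dset A A. of_bool (a + u \<in> A) * of_bool (c + u \<in> A))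
      = (\<Sum>u\<in>dset A A. if a + u \<in> A \<and> c + u \<in> A then 1 else (0::real))"
    by (intro sum.cong) auto
  also have "\<dots> = real (card {u\<in>dset A A. a + u \<in> A \<and> c + u \<in> A})"
    using assms by (simp flip: sum.inter_filter)
  also have "card {u\<in>dset A A. a + u \<in> A \<and> c + u \<in> A} = rep A A (a - c)"
    unfolding rep_def
  proof (rule bij_betw_same_card[of "\<lambda>u. (a + u, c + u)"], rule bij_betw_imageI)
    show "inj_on (\<lambda>u. (a + u, c + u)) {u\<in>dset A A. a + u \<in> A \<and> c + u \<in> A}" by (auto intro: inj_onI)
    show "(\<lambda>u. (a + u, c + u)) ` {u\<in>dset A A. a + u \<in> A \<and> c + u \<in> A}
        = {(p, q). p \<in> A \<and> q \<in> A \<and> p - q = a - c}"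
    proof (intro equalityI subsetI)
      fix z assume "z \<in> {(p, q). p \<in> A \<and> q \<in> A \<and> p - q = a - c}"
      then obtain p q where z: "z = (p, q)" "p \<in> A" "q \<in> A" "p - q = a - c" by auto
      have "p - a \<in> dset A A" using z assms by (auto simp: dset_def)
      moreover have "a + (p - a) = p" "c + (p - a) = q" using z(4) by (auto simp: algebra_simps)
      ultimately show "z \<in> (\<lambda>u. (a + u, c + u)) ` {u\<in>dset A A. a + u \<in> A \<and> c + u \<in> A}"
        using z by (intro image_eqI[of _ _ "p - a"]) auto
    qed auto
  qed
  finally show ?thesis by simp
qed

lemma rep_self_uminus: "rep A A (- x) = rep A A x"
proof -
  have "bij_betw prod.swap {(a, b). a \<in> A \<and> b \<in> A \<and> a - b = - x} {(a, b). a \<in> A \<and> b \<in> A \<and> a - b = x}"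
    by (rule bij_betw_byWitness[where f' = prod.swap]) (auto simp: algebra_simps)
  then show ?thesis unfolding rep_def by (rule bij_betw_same_card)
qed

lemma sum_shift_inside:
  fixes F :: "'a::ab_group_add \<Rightarrow> real"
  assumes "finite A"
  shows "(\<Sum>b\<in>A. of_bool (b + x \<in> A) * F (b + x)) = (\<Sum>a\<in>A. of_bool (a - x \<in> A) * F a)"
proof -
  have "(\<Sum>b\<in>A. of_bool (b + x \<in> A) * F (b + x)) = (\<Sum>b\<in>{b\<in>A. b + x \<in> A}. F (b + x))"
    using assms by (intro sum.mono_neutral_cong_right) auto
  also have "\<dots> = (\<Sum>a\<in>{a\<in>A. a - x \<in> A}. F a)"
    by (rule sum.reindex_bij_witness[of _ "\<lambda>a. a - x" "\<lambda>b. b + x"]) auto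
  also have "\<dots> = (\<Sum>a\<in>A. of_bool (a - x \<in> A) * F a)"
    using assms by (intro sum.mono_neutral_cong_left) auto
  finally show ?thesis .
qed

lemma sum_square_of_sum:
  fixes F :: "'a \<Rightarrow> 'b \<Rightarrow> real"
  shows "(\<Sum>b\<in>B. (\<Sum>x\<in>X. F b x)^2) = (\<Sum>x\<in>X. \<Sum>y\<in>X. \<Sum>b\<in>B. F b x * F b y)"
proof -
  have "(\<Sum>b\<in>B. (\<Sum>x\<in>X. F b x)^2) = (\<Sum>b\<in>B. \<Sum>x\<in>X. \<Sum>y\<in>X. F b x * F b y)"
    by (simp add: power2_eq_square sum_product)
  also have "\<dots> = (\<Sum>x\<in>X. \<Sum>b\<in>B. \<Sum>y\<in>X. F b x * F b y)" by (rule sum.swap)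
  also have "\<dots> = (\<Sum>x\<in>X. \<Sum>y\<in>X. \<Sum>b\<in>B. F b x * F b y)" by (intro sum.cong refl sum.swap)
  finally show ?thesis .
qed

text \<open>The kernel \<open>rep A A (x - y)\<close> is positive definite, so by Jensen's inequality the count
  of pairs of edges at a common vertex, weighted by it, is at least what the degree vector gives.\<close>

lemma popular_triples_ge:
  fixes A :: "'a::ab_group_add set" and \<Delta> :: nat
  assumes fin: "finite A"
  defines "D \<equiv> {x\<in>dset A A. rep A A x \<ge> \<Delta>}"
  shows "real \<Delta> * (\<Sum>x\<in>D. real (rep A A x))^3 \<le> 32 * real (card A)^3 *
    (\<Sum>b\<in>A. \<Sum>x\<in>D. \<Sum>y\<in>D. of_bool (b + x \<in> A) * of_bool (b + y \<in> A) * real (rep A A (x - y)))"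
    (is "_ \<le> _ * ?V")
proof -
  define U where "U = dset A A"
  have finD: "finite D" "finite U" using fin by (auto simp: D_def U_def)
  \<comment> \<open>In the graph of popular differences, \<open>n b u\<close> counts the neighbours
    of \<open>b\<close> that stay in \<open>A\<close> when shifted by \<open>u\<close>,
    \<open>d\<close> is the degree and \<open>M\<close> the adjacency matrix.\<close>
  define n where "n b u = (\<Sum>x\<in>D. of_bool (b + x \<in> A) * of_bool (b + x + u \<in> A) :: real)" for b u
  define d where "d a = (\<Sum>x\<in>D. of_bool (a - x \<in> A) :: real)" for a
  define M where "M a c = (of_bool (a - c \<in> D) :: real)" for a c
  have Dsym: "- x \<in> D \<longleftrightarrow> x \<in> D" for x
  proof -
    have "- x \<in> dset A A \<longleftrightarrow> x \<in> dset A A" for x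
      by (metis (no_types) rep_eq_0 rep_pos fin rep_self_uminus not_one_le_zero)
    then show ?thesis by (simp add: D_def rep_self_uminus)
  qed
  have V: "?V = (\<Sum>u\<in>U. \<Sum>b\<in>A. (n b u)^2)"
  proof -
    have "?V = (\<Sum>b\<in>A. \<Sum>x\<in>D. \<Sum>y\<in>D. \<Sum>u\<in>U. (of_bool (b + x \<in> A) * of_bool (b + x + u \<in> A))
        * (of_bool (b + y \<in> A) * of_bool (b + y + u \<in> A)))"
    proof (intro sum.cong refl)
      fix b x y
      show "of_bool (b + x \<in> A) * of_bool (b + y \<in> A) * real (rep A A (x - y)) 
        = (\<Sum>u\<in>U. (of_bool (b + x \<in> A) * of_bool (b + x + u \<in> A)) * (of_bool (b + y \<in> A) * of_bool (b + y + u \<in> A)))"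
      proof (cases "b + x \<in> A \<and> b + y \<in> A")
        case True
        then show ?thesis using rep_self_shift[OF fin, of "b + x" "b + y"] by (simp add: U_def)
      qed auto
    qed
    also have "\<dots> = (\<Sum>b\<in>A. \<Sum>u\<in>U. (n b u)^2)"
      unfolding n_def sum_square_of_sum by simp
    also have "\<dots> = (\<Sum>u\<in>U. \<Sum>b\<in>A. (n b u)^2)" by (rule sum.swap)
    finally show ?thesis .
  qed
  \<comment> \<open>The same edges counted from their other end \<open>a = b + x\<close>.\<close>
  have m: "(\<Sum>b\<in>A. n b u) = (\<Sum>a\<in>A. of_bool (a + u \<in> A) * d a)" for u
  proof -
    have "(\<Sum>b\<in>A. n b u) = (\<Sum>x\<in>D. \<Sum>b\<in>A. of_bool (b + x \<in> A) * of_bool (b + x + u \<in> A))"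
      unfolding n_def by (rule sum.swap)
    also have "\<dots> = (\<Sum>x\<in>D. \<Sum>a\<in>A. of_bool (a - x \<in> A) * of_bool (a + u \<in> A))"
      using sum_shift_inside[OF fin, of _ "\<lambda>a. of_bool (a + u \<in> A)"] by simp
    also have "\<dots> = (\<Sum>a\<in>A. \<Sum>x\<in>D. of_bool (a - x \<in> A) * of_bool (a + u \<in> A))" by (rule sum.swap)
    finally show ?thesis by (simp add: d_def sum_distrib_left mult.commute)
  qed
  have dM: "d a = (\<Sum>c\<in>A. M a c)" if "a \<in> A" for a
  proof -
    have "d a = real (card {x\<in>D. a - x \<in> A})" 
      unfolding d_def using finD by (simp add: of_bool_def flip: sum.inter_filter)
    also have "card {x\<in>D. a - x \<in> A} = card {c\<in>A. a - c \<in> D}"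
      by (rule bij_betw_same_card[of "\<lambda>x. a - x"], rule bij_betw_byWitness[where f' = "\<lambda>x. a - x"]) auto
    also have "real \<dots> = (\<Sum>c\<in>A. M a c)"
      unfolding M_def using fin by (simp add: of_bool_def flip: sum.inter_filter)
    finally show ?thesis .
  qed
  have d_sum: "(\<Sum>a\<in>A. d a) = (\<Sum>x\<in>D. real (rep A A x))"
    unfolding d_def by (subst sum.swap) (simp add: real_rep_eq1[OF fin fin])
  have M2: "M a c = M c a" for a c using Dsym[of "a - c"] by (simp add: M_def)
  have "real \<Delta> * (\<Sum>x\<in>D. real (rep A A x))^3 
      \<le> real \<Delta> * (32 * real (card A)^2 * (\<Sum>a\<in>A. \<Sum>c\<in>A. M a c * (d a * d c)))"
    unfolding d_sum[symmetric] using three_paths_ge[of A M d] fin M2 dM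
    by (intro mult_left_mono) (auto simp: M_def)
  also have "\<dots> = 32 * real (card A)^2 * (\<Sum>a\<in>A. \<Sum>c\<in>A. (real \<Delta> * M a c) * (d a * d c))"
    by (simp add: sum_distrib_left mult_ac)
  \<comment> \<open>Adjacent vertices differ by a popular difference, so the kernel is at least
    \<open>\<Delta>\<close> there; this turns walks of length three into the kernel form of the
    degree vector.\<close>
  also have "\<dots> \<le> 32 * real (card A)^2 * (\<Sum>a\<in>A. \<Sum>c\<in>A. real (rep A A (a - c)) * (d a * d c))"
  proof (intro mult_left_mono sum_mono mult_right_mono)
    fix a c show "real \<Delta> * M a c \<le> real (rep A A (a - c))" by (auto simp: M_def D_def)
  qed (auto simp: d_def intro!: mult_nonneg_nonneg sum_nonneg)
  also have "(\<Sum>a\<in>A. \<Sum>c\<in>A. real (rep A A (a - c)) * (d a * d c)) = (\<Sum>u\<in>U. (\<Sum>b\<in>A. n b u)^2)"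
    unfolding m sum_square_of_sum
    by (intro sum.cong refl) (simp add: rep_self_shift[OF fin] U_def sum_distrib_left mult_ac)
  \<comment> \<open>Cauchy-Schwarz over the base point \<open>b\<close>, for each shift
    \<open>u\<close>; it supplies the third factor \<open>card A\<close>.\<close>
  also have "32 * real (card A)^2 * \<dots> \<le> 32 * real (card A)^2 * (\<Sum>u\<in>U. real (card A) * (\<Sum>b\<in>A. (n b u)^2))"
    using sum_squared_le_sum_of_squares[of "\<lambda>b. n b _" A] by (intro mult_left_mono sum_mono) (auto simp: mult.commute)
  also have "\<dots> = 32 * real (card A)^3 * ?V"
    unfolding V by (simp add: sum_distrib_left power2_eq_square power3_eq_cube mult_ac)
  finally show ?thesis .
qed

text \<open>Cauchy-Schwarz over pairs \<open>(x, y)\<close> separates the number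
  \<open>c x y\<close> of base points from the kernel. In the second moment of \<open>c\<close>, the
  sum over \<open>(x, y)\<close> for fixed base points \<open>b\<close> and \<open>b'\<close> is a
  perfect square of size at most \<open>rep A A (b - b')^2\<close>. Summed over \<open>b\<close> and
  \<open>b'\<close> this is the third moment.\<close>

lemma popular_triples_sq_le:
  fixes A :: "'a::ab_group_add set"
  assumes fin: "finite A" and D: "D \<subseteq> dset A A"
  shows "(\<Sum>b\<in>A. \<Sum>x\<in>D. \<Sum>y\<in>D. of_bool (b + x \<in> A) * of_bool (b + y \<in> A) * real (rep A A (x - y)))^2
    \<le> energy 3 A A * (\<Sum>x\<in>D. \<Sum>y\<in>D. real (rep A A (x - y))^2)"
proof -
  have finD: "finite D" using D fin by (meson finite_dset finite_subset)
  define c where "c x y = (\<Sum>b\<in>A. of_bool (b + x \<in> A) * of_bool (b + y \<in> A) :: real)" for x y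
  have "(\<Sum>b\<in>A. \<Sum>x\<in>D. \<Sum>y\<in>D. of_bool (b + x \<in> A) * of_bool (b + y \<in> A) * real (rep A A (x - y)))
      = (\<Sum>x\<in>D. \<Sum>y\<in>D. \<Sum>b\<in>A. of_bool (b + x \<in> A) * of_bool (b + y \<in> A) * real (rep A A (x - y)))"
    by (subst sum.swap) (intro sum.cong refl sum.swap)
  also have "\<dots> = (\<Sum>x\<in>D. \<Sum>y\<in>D. c x y * real (rep A A (x - y)))"
    by (simp add: c_def sum_distrib_right)
  also have "\<dots> = (\<Sum>p\<in>D \<times> D. c (fst p) (snd p) * real (rep A A (fst p - snd p)))"
    by (simp add: sum.cartesian_product case_prod_beta)
  also have "\<dots>^2 \<le> (\<Sum>p\<in>D \<times> D. (c (fst p) (snd p))^2) * (\<Sum>p\<in>D \<times> D. real (rep A A (fst p - snd p))^2)"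
    by (rule Cauchy_Schwarz_ineq_sum)
  also have "(\<Sum>p\<in>D \<times> D. real (rep A A (fst p - snd p))^2) = (\<Sum>x\<in>D. \<Sum>y\<in>D. real (rep A A (x - y))^2)"
    by (simp add: sum.cartesian_product case_prod_beta)
  also have "(\<Sum>p\<in>D \<times> D. (c (fst p) (snd p))^2) \<le> energy 3 A A"
  proof -
    have "(\<Sum>p\<in>D \<times> D. (c (fst p) (snd p))^2)
        = (\<Sum>b\<in>A. \<Sum>b'\<in>A. \<Sum>p\<in>D \<times> D. (of_bool (b + fst p \<in> A) * of_bool (b + snd p \<in> A))
            * (of_bool (b' + fst p \<in> A) * of_bool (b' + snd p \<in> A)))"
      unfolding c_def by (rule sum_square_of_sum)
    also have "\<dots> = (\<Sum>b\<in>A. \<Sum>b'\<in>A. (\<Sum>x\<in>D. of_bool (b + x \<in> A) * of_bool (b' + x \<in> A))^2)"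
      unfolding power2_eq_square sum_product sum.cartesian_product case_prod_beta
      by (intro sum.cong refl) (simp add: mult_ac)
    also have "\<dots> \<le> (\<Sum>b\<in>A. \<Sum>b'\<in>A. real (rep A A (b - b'))^2)"
    proof (intro sum_mono power_mono)
      fix b b' assume b: "b \<in> A" "b' \<in> A"
      show "(\<Sum>x\<in>D. of_bool (b + x \<in> A) * of_bool (b' + x \<in> A)) \<le> real (rep A A (b - b'))"
        unfolding rep_self_shift[OF fin b] using D fin by (intro sum_mono2) auto
    qed (auto intro!: sum_nonneg)
    also have "\<dots> = energy 3 A A"
      using sum_differences[OF fin fin, of "\<lambda>z. real (rep A A z)^2"]
      by (simp add: energy_def power2_eq_square power3_eq_cube mult.assoc)
    finally show ?thesis .
  qed
  finally show ?thesis by (auto simp: mult_right_mono sum_nonneg)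
qed

text \<open>Fix a popular level \<open>t\<close> of \<open>rep A A\<close> on \<open>D - D\<close>
  and let \<open>R\<close> count the pairs of \<open>D\<close> whose difference reaches it. A pair
  with \<open>x - y = z\<close> is charged either to \<open>rep A A z >= t\<close>, summed over
  \<open>D\<close> and \<open>D\<close>, or to \<open>rep A A (z - x) >= \<Delta>\<close>, summed
  over \<open>D\<close> and the level set \<open>Dt\<close>. The choice depends on whether
  \<open>t <= \<Delta>\<close>.\<close>

lemma popular_difference_moment:
  fixes A :: "'a::ab_group_add set"
  assumes fin: "finite A" and ne: "A \<noteq> {}" and K: "controlled A K" and Dl: "\<Delta> \<ge> 1"
  defines "D \<equiv> {x\<in>dset A A. rep A A x \<ge> \<Delta>}"
  shows "real \<Delta>^5 * (\<Sum>x\<in>D. \<Sum>y\<in>D. real (rep A A (x - y))^2)^4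
    \<le> (2 * lg (card A))^4 * K^2 * real (card A)^2 * real (card D)^3 * (energy 3 A A)^3"
proof -
  let ?r = "rep A A"
  let ?n = "card A"
  define E3 where "E3 = energy 3 A A"
  have n1: "?n \<ge> 1" using fin ne by (simp add: Suc_le_eq card_gt_0_iff)
  have finD: "finite D" using fin by (simp add: D_def)
  have K0: "K \<ge> 0" using K by (rule controlled_nonneg)
  have E30: "E3 \<ge> 0" by (simp add: E3_def energy_nonneg)
  have D3: "real \<Delta>^3 * card D \<le> E3" unfolding D_def E3_def by (rule card_superlevel[OF fin fin])
  define S where "S = (\<Sum>x\<in>D. \<Sum>y\<in>D. real (?r (x - y))^2)"
  have "S = (\<Sum>z\<in>dset D D. real (rep D D z) * real (?r z)^2)"
    unfolding S_def using sum_differences[OF finD finD, of "\<lambda>z. real (?r z)^2"] by simp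
  moreover obtain t where t: "t \<in> {1..?n}" and 
    "(\<Sum>z\<in>dset D D. real (rep D D z) * real (?r z)^2)
      \<le> real 2 * lg ?n * (real t^2 * (\<Sum>z\<in>{z\<in>dset D D. ?r z \<ge> t}. real (rep D D z)))"
    using sum_power_pigeonhole[of "dset D D" 2 ?n ?r "\<lambda>z. real (rep D D z)"] finD n1 rep_le1[OF fin fin]
    by auto
  moreover define R where "R = (\<Sum>z\<in>{z\<in>dset D D. ?r z \<ge> t}. real (rep D D z))"
  ultimately have SR: "S \<le> 2 * lg ?n * (real t^2 * R)" by simp
  have R0: "R \<ge> 0" by (auto simp: R_def intro!: sum_nonneg)
  have S0: "S \<ge> 0" by (auto simp: S_def intro!: sum_nonneg)
  have main: "real \<Delta>^5 * (real t^2 * R)^4 \<le> K^2 * real ?n^2 * real (card D)^3 * E3^3"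
  proof (cases "t \<le> \<Delta>")
    case True
    have "real t * R \<le> (\<Sum>z\<in>{z\<in>dset D D. ?r z \<ge> t}. real (rep D D z) * real (?r z))"
      unfolding R_def sum_distrib_left by (intro sum_mono) (auto simp: mult.commute mult_right_mono)
    also have "\<dots> \<le> (\<Sum>z\<in>dset D D. real (rep D D z) * real (?r z))"
      using finD by (intro sum_mono2) auto
    also have "\<dots> = (\<Sum>x\<in>D. \<Sum>y\<in>D. real (?r (x - y)))"
      using sum_differences[OF finD finD, of "\<lambda>z. real (?r z)"] by simp
    finally have "(real t * R)^2 \<le> (\<Sum>x\<in>D. \<Sum>y\<in>D. real (?r (x - y)))^2"
      using R0 by (intro power_mono) auto
    also have "\<dots> \<le> (energy 2 A D)^2"
      using sum_rep_differences_sq_le[OF fin finD finD] by (simp add: power2_eq_square)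
    also have "\<dots> \<le> K * real ?n * real (card D)^3" by (rule energy_2_sq_le[OF fin finD K])
    finally have *: "(real t * R)^2 \<le> K * real ?n * real (card D)^3" .
    have "real \<Delta>^5 * (real t^2 * R)^4 = real \<Delta>^5 * (real t^4 * ((real t * R)^2)^2)"
      by (simp add: power_mult_distrib power_mult flip: power_mult power_add)
    also have "\<dots> \<le> real \<Delta>^5 * (real \<Delta>^4 * (K * real ?n * real (card D)^3)^2)"
      using * True by (intro mult_left_mono mult_mono power_mono) auto
    \<comment> \<open>The nine powers of \<open>\<Delta>\<close> are spent on three copies of
      \<open>\<Delta>^3 * card D <= E3\<close>.\<close>
    also have "\<dots> = K^2 * real ?n^2 * real (card D)^3 * (real \<Delta>^3 * card D)^3"
      by (simp add: power_mult_distrib flip: power_mult power_add)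
    also have "\<dots> \<le> K^2 * real ?n^2 * real (card D)^3 * E3^3"
      using D3 by (intro mult_left_mono power_mono) auto
    finally show ?thesis .
  next
    case False
    then have tD: "real t > 0" "real \<Delta> \<le> real t" using Dl by auto
    define Dt where "Dt = {x\<in>dset A A. ?r x \<ge> t}"
    have finDt: "finite Dt" using fin by (simp add: Dt_def)
    have Dt3: "real t^3 * card Dt \<le> E3" unfolding Dt_def E3_def by (rule card_superlevel[OF fin fin])
    have sub: "{z\<in>dset D D. ?r z \<ge> t} \<subseteq> Dt"
    proof
      fix z assume z: "z \<in> {z\<in>dset D D. ?r z \<ge> t}"
      then have "?r z \<noteq> 0" using t by auto
      then show "z \<in> Dt" using z rep_eq_0[of z A A] by (auto simp: Dt_def)
    qed
    have "real \<Delta> * R \<le> (\<Sum>z\<in>Dt. real \<Delta> * real (rep D D z))"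
      unfolding R_def sum_distrib_left using finDt sub by (intro sum_mono2) auto
    also have "\<dots> \<le> (\<Sum>z\<in>Dt. \<Sum>d\<in>D. real (?r (z - d)))"
    proof (intro sum_mono)
      fix z
      have "real \<Delta> * real (rep D D z) = (\<Sum>d\<in>D. real \<Delta> * of_bool (d - z \<in> D))"
        by (simp add: real_rep_eq1[OF finD finD] sum_distrib_left)
      also have "\<dots> \<le> (\<Sum>d\<in>D. real (?r (z - d)))"
      proof (intro sum_mono)
        fix d
        have "?r (z - d) = ?r (d - z)" using rep_self_uminus[of A "d - z"] by simp
        then show "real \<Delta> * of_bool (d - z \<in> D) \<le> real (?r (z - d))" by (auto simp: D_def)
      qed
      finally show "real \<Delta> * real (rep D D z) \<le> (\<Sum>d\<in>D. real (?r (z - d)))" .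
    qed
    finally have "(real \<Delta> * R)^2 \<le> (\<Sum>z\<in>Dt. \<Sum>d\<in>D. real (?r (z - d)))^2"
      using R0 by (intro power_mono) auto
    also have "\<dots> \<le> energy 2 A Dt * energy 2 A D" by (rule sum_rep_differences_sq_le[OF fin finDt finD])
    finally have "((real \<Delta> * R)^2)^2 \<le> (energy 2 A Dt * energy 2 A D)^2" by (intro power_mono) auto
    also have "\<dots> = (energy 2 A Dt)^2 * (energy 2 A D)^2" by (simp add: power_mult_distrib)
    also have "\<dots> \<le> (K * real ?n * real (card Dt)^3) * (K * real ?n * real (card D)^3)"
      using energy_2_sq_le[OF fin finDt K] energy_2_sq_le[OF fin finD K] K0 by (intro mult_mono) auto
    finally have *: "(real \<Delta> * R)^4 \<le> K^2 * real ?n^2 * real (card Dt)^3 * real (card D)^3"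
      by (simp add: power2_eq_square mult_ac power_numeral_reduce)
    have "real \<Delta>^5 * (real t^2 * R)^4 = real \<Delta> * real t^8 * (real \<Delta> * R)^4"
      by (simp add: power_mult_distrib power_numeral_reduce)
    \<comment> \<open>The surplus \<open>\<Delta>\<close> is raised to \<open>t\<close>, so that
      \<open>t^9 * card Dt^3 <= E3^3\<close> applies.\<close>
    also have "\<dots> \<le> real t * real t^8 * (K^2 * real ?n^2 * real (card Dt)^3 * real (card D)^3)"
      using * tD by (intro mult_mono) auto
    also have "\<dots> = K^2 * real ?n^2 * real (card D)^3 * (real t^3 * card Dt)^3"
      by (simp add: power_mult_distrib power_numeral_reduce)
    also have "\<dots> \<le> K^2 * real ?n^2 * real (card D)^3 * E3^3"
      using Dt3 by (intro mult_left_mono power_mono) auto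
    finally show ?thesis .
  qed
  have "real \<Delta>^5 * S^4 \<le> real \<Delta>^5 * (2 * lg ?n * (real t^2 * R))^4"
    using SR S0 by (intro mult_left_mono power_mono) auto
  also have "\<dots> = (2 * lg ?n)^4 * (real \<Delta>^5 * (real t^2 * R)^4)" by (simp add: power_mult_distrib mult_ac)
  also have "\<dots> \<le> (2 * lg ?n)^4 * (K^2 * real ?n^2 * real (card D)^3 * E3^3)"
    using main by (intro mult_left_mono) auto
  finally show ?thesis unfolding S_def E3_def by (simp add: mult_ac)
qed

text \<open>For a popular level \<open>t\<close> with \<open>d\<close> differences, \<open>E\<close>
  is about \<open>t^2 d\<close>. Up to logarithms the preceding bounds say
  \<open>t^4 d^3 <= n^3 V\<close>, \<open>V^2 <= E3 S\<close> and
  \<open>t^5 S^4 <= K^2 n^2 d^3 E3^3\<close>. Eliminating \<open>V\<close> and \<open>S\<close>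
  leaves \<open>t^37 d^21 <= K^2 n^26 E3^7\<close>.\<close>

lemma energy_le_control:
  fixes A :: "'a::ab_group_add set"
  assumes fin: "finite A" and ne: "A \<noteq> {}" and K: "controlled A K"
  shows "(energy 2 A A)^26 \<le> 2^70 * lg (card A)^30 * K^2 * real (card A)^26 * (energy 3 A A)^12"
proof -
  define n where "n = real (card A)"
  define L where "L = lg (card A)"
  define E3 where "E3 = energy 3 A A"
  define E where "E = energy 2 A A"
  have c1: "card A \<ge> 1" using fin ne by (simp add: Suc_le_eq card_gt_0_iff)
  have n0: "n > 0" using c1 by (simp add: n_def)
  have L0: "L \<ge> 0" by (simp add: L_def lg_nonneg)
  have E30: "E3 \<ge> 0" and E0: "E \<ge> 0" by (auto simp: E3_def E_def energy_nonneg)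
  obtain \<Delta> where \<Delta>: "\<Delta> \<in> {1..card A}" and
    "(\<Sum>x\<in>dset A A. real (rep A A x)^2) \<le> real 2 * lg (card A) * (real \<Delta>^2 * card {x\<in>dset A A. rep A A x \<ge> \<Delta>})"
    using sum_power_pigeonhole_card[of "dset A A" 2 "card A" "rep A A"] fin c1 rep_le1[OF fin fin] by auto
  moreover define D where "D = {x\<in>dset A A. rep A A x \<ge> \<Delta>}"
  moreover define d where "d = real (card D)"
  moreover define t where "t = real \<Delta>"
  ultimately have Ed: "E \<le> 2 * L * (t^2 * d)" by (simp add: E_def L_def energy_def)
  have t1: "t > 0" and d0: "d \<ge> 0" using \<Delta> by (auto simp: t_def d_def)
  have D3: "t^3 * d \<le> E3" unfolding D_def E3_def t_def d_def by (rule card_superlevel[OF fin fin])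
  define Q where "Q = (\<Sum>x\<in>D. real (rep A A x))"
  have "(\<Sum>x\<in>D. t) \<le> Q" unfolding Q_def t_def by (intro sum_mono) (auto simp: D_def)
  then have Q: "d * t \<le> Q" by (simp add: d_def)
  define V where "V = (\<Sum>b\<in>A. \<Sum>x\<in>D. \<Sum>y\<in>D. of_bool (b + x \<in> A) * of_bool (b + y \<in> A) * real (rep A A (x - y)))"
  define S where "S = (\<Sum>x\<in>D. \<Sum>y\<in>D. real (rep A A (x - y))^2)"
  have S0: "S \<ge> 0" by (auto simp: S_def intro!: sum_nonneg)
  have 1: "t * Q^3 \<le> 32 * n^3 * V"
    using popular_triples_ge[OF fin, of \<Delta>] by (simp add: t_def Q_def n_def V_def D_def)
  have 2: "V^2 \<le> E3 * S"
    unfolding V_def E3_def S_def by (rule popular_triples_sq_le[OF fin]) (auto simp: D_def)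
  have 3: "t^5 * S^4 \<le> (2 * L)^4 * K^2 * n^2 * d^3 * E3^3"
    using popular_difference_moment[OF fin ne K, of \<Delta>] \<Delta> by (simp add: t_def S_def L_def n_def d_def D_def E3_def)
  have 4: "t^4 * d^3 \<le> 32 * n^3 * V"
  proof -
    have "t^4 * d^3 = t * (d * t)^3" by (simp add: power_mult_distrib power_numeral_reduce)
    also have "\<dots> \<le> t * Q^3" using Q t1 d0 by (intro mult_left_mono power_mono) auto
    finally show ?thesis using 1 by simp
  qed
  \<comment> \<open>The eighth power turns \<open>V\<close> into \<open>(V^2)^4\<close>, hence into
    the \<open>S^4\<close> of the third bound.\<close>
  have "t^37 * d^24 = t^5 * (t^4 * d^3)^8" by (simp add: power_mult_distrib flip: power_mult power_add)
  also have "\<dots> \<le> t^5 * (32 * n^3 * V)^8" using 4 t1 d0 by (intro mult_left_mono power_mono) auto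
  also have "\<dots> = 32^8 * n^24 * (t^5 * (V^2)^4)" by (simp add: power_mult_distrib flip: power_mult)
  also have "\<dots> \<le> 32^8 * n^24 * (t^5 * (E3 * S)^4)"
    using 2 n0 t1 by (intro mult_left_mono power_mono) auto
  also have "\<dots> = 32^8 * n^24 * E3^4 * (t^5 * S^4)" by (simp add: power_mult_distrib)
  also have "\<dots> \<le> 32^8 * n^24 * E3^4 * ((2 * L)^4 * K^2 * n^2 * d^3 * E3^3)"
    using 3 n0 E30 by (intro mult_left_mono) auto
  also have "\<dots> = (2^44 * L^4 * K^2 * n^26 * E3^7) * d^3"
    by (simp add: power_mult_distrib) (simp add: power_numeral_reduce)
  finally have 5: "t^37 * d^21 * d^3 \<le> (2^44 * L^4 * K^2 * n^26 * E3^7) * d^3"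
    by (simp add: mult.assoc flip: power_add)
  have 6: "t^37 * d^21 \<le> 2^44 * L^4 * K^2 * n^26 * E3^7"
  proof (cases "d = 0")
    case True then show ?thesis using L0 n0 E30 by simp
  next
    case False
    then have "d^3 > 0" using d0 by simp
    then show ?thesis using 5 by (simp only: mult_le_cancel_right_pos)
  qed
  have "E^26 \<le> (2 * L * (t^2 * d))^26" using Ed E0 by (intro power_mono) auto
  \<comment> \<open>The origin of 26: multiplying \<open>t^37 d^21\<close> by
    \<open>(t^3 d)^j\<close> gives a power of \<open>t^2 d\<close> exactly for
    \<open>j = 5\<close>.\<close>
  also have "\<dots> = (2 * L)^26 * ((t^37 * d^21) * (t^3 * d)^5)"
  proof -
    have "t^52 = t^37 * t^15" "d^26 = d^21 * d^5" by (simp_all flip: power_add)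
    then show ?thesis by (simp add: power_mult_distrib mult_ac flip: power_mult)
  qed
  also have "\<dots> \<le> (2 * L)^26 * ((2^44 * L^4 * K^2 * n^26 * E3^7) * E3^5)"
    by (rule mult_left_mono[OF mult_mono[OF 6 power_mono[OF D3]]]) (use t1 d0 L0 n0 E30 in auto)
  also have "\<dots> = 2^70 * L^30 * K^2 * n^26 * E3^12"
    by (simp add: power_mult_distrib mult_ac flip: power_add)
  finally show ?thesis by (simp add: E_def L_def n_def E3_def)
qed

section \<open>The multiplicative group of the reals\<close>

text \<open>The sign of a real number is recorded in \<open>bit\<close>, so that the image is an additive group.\<close>

definition logsgn :: "real \<Rightarrow> real \<times> bit" where
  "logsgn x = (ln \<bar>x\<bar>, of_bool (x < 0))"

lemma logsgn_mult:
  assumes "x \<noteq> 0" "y \<noteq> 0" shows "logsgn (x * y) = logsgn x + logsgn y"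
proof -
  have "ln \<bar>x * y\<bar> = ln \<bar>x\<bar> + ln \<bar>y\<bar>" using assms by (simp add: abs_mult ln_mult_pos)
  moreover have "(of_bool (x * y < 0) :: bit) = of_bool (x < 0) + of_bool (y < 0)"
    using assms by (cases "x < 0"; cases "y < 0") (auto simp: mult_less_0_iff)
  ultimately show ?thesis by (simp add: logsgn_def plus_prod_def)
qed

lemma logsgn_inject: "x \<noteq> 0 \<Longrightarrow> y \<noteq> 0 \<Longrightarrow> logsgn x = logsgn y \<longleftrightarrow> x = y"
  by (auto simp: logsgn_def abs_if split: if_splits)

lemma inj_on_logsgn: "0 \<notin> A \<Longrightarrow> inj_on logsgn A"
  by (intro inj_onI) (metis logsgn_inject)

lemma logsgn_surj: "\<exists>x. x \<noteq> 0 \<and> logsgn x = z"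
proof -
  obtain u b where z: "z = (u, b)" by (cases z)
  show ?thesis
  proof (cases "b = 0")
    case True then show ?thesis by (intro exI[of _ "exp u"]) (simp add: z logsgn_def)
  next
    case False then show ?thesis by (intro exI[of _ "- exp u"]) (simp add: z logsgn_def)
  qed
qed

lemma card_logsgn: "0 \<notin> A \<Longrightarrow> card (logsgn ` A) = card A"
  by (intro card_image inj_on_logsgn)

lemma rep_logsgn:
  assumes "finite S" "finite C" "0 \<notin> S" "0 \<notin> C" "x \<noteq> 0"
  shows "rep (logsgn ` S) (logsgn ` C) (logsgn x) = card {c\<in>C. x * c \<in> S}"
proof -
  have mem: "logsgn c + logsgn x \<in> logsgn ` S \<longleftrightarrow> x * c \<in> S" if "c \<in> C" for c
  proof -
    have c: "c \<noteq> 0" using that assms by auto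
    have "logsgn c + logsgn x = logsgn (x * c)" using c assms by (simp add: logsgn_mult add.commute)
    moreover have "x * c \<noteq> 0" using c assms by simp
    ultimately show ?thesis using assms(3) by (metis (mono_tags, lifting) image_iff logsgn_inject)
  qed
  have "real (rep (logsgn ` S) (logsgn ` C) (logsgn x)) = (\<Sum>b\<in>logsgn ` C. of_bool (b + logsgn x \<in> logsgn ` S))"
    using assms by (intro real_rep_eq2) auto
  also have "\<dots> = (\<Sum>c\<in>C. of_bool (logsgn c + logsgn x \<in> logsgn ` S))"
    using assms by (subst sum.reindex) (auto intro: inj_on_logsgn)
  also have "\<dots> = (\<Sum>c\<in>C. of_bool (x * c \<in> S))" by (intro sum.cong refl) (simp add: mem)
  also have "\<dots> = real (card {c\<in>C. x * c \<in> S})"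
    using assms by (simp add: of_bool_def flip: sum.inter_filter)
  finally show ?thesis by simp
qed

section \<open>Energies as counts of quadruples\<close>

lemma energy_2_card:
  assumes "finite A"
  shows "energy 2 A A = real (card {(a, b, c, d). a \<in> A \<and> b \<in> A \<and> c \<in> A \<and> d \<in> A \<and> a - b = c - d})"
proof -
  have "energy 2 A A = (\<Sum>a\<in>A. \<Sum>b\<in>A. real (rep A A (a - b)))"
    using sum_differences[OF assms assms, of "\<lambda>x. real (rep A A x)"] by (simp add: energy_def power2_eq_square)
  also have "\<dots> = (\<Sum>a\<in>A. \<Sum>b\<in>A. real (card {(c, d). c \<in> A \<and> d \<in> A \<and> c - d = a - b}))"
    by (simp add: rep_def)
  also have "\<dots> = real (\<Sum>a\<in>A. card (SIGMA b:A. {(c, d). c \<in> A \<and> d \<in> A \<and> c - d = a - b}))"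
    using assms finite_rep_pairs[OF assms assms] by (subst card_SigmaI) auto
  also have "\<dots> = real (card (SIGMA a:A. SIGMA b:A. {(c, d). c \<in> A \<and> d \<in> A \<and> c - d = a - b}))"
    using assms finite_rep_pairs[OF assms assms] by (subst card_SigmaI[of A]) auto
  also have "(SIGMA a:A. SIGMA b:A. {(c, d). c \<in> A \<and> d \<in> A \<and> c - d = a - b})
      = {(a, b, c, d). a \<in> A \<and> b \<in> A \<and> c \<in> A \<and> d \<in> A \<and> a - b = c - d}" by auto
  finally show ?thesis .
qed

lemma add_energy_eq: "finite X \<Longrightarrow> real (add_energy X) = energy 2 X X"
  by (simp add: add_energy_def energy_2_card)

lemma mult_energy_eq:
  assumes "finite Y" "0 \<notin> Y"
  shows "real (mult_energy Y) = energy 2 (logsgn ` Y) (logsgn ` Y)"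
proof -
  \<comment> \<open>\<open>y1 y2 = y3 y4\<close> becomes a difference equation in the form
    \<open>y1 / y3 = y4 / y2\<close>, hence the permuted coordinates.\<close>
  let ?F = "\<lambda>(y1, y2, y3, y4). (logsgn y1, logsgn y3, logsgn y4, logsgn y2)"
  let ?M = "{(y1, y2, y3, y4). y1 \<in> Y \<and> y2 \<in> Y \<and> y3 \<in> Y \<and> y4 \<in> Y \<and> y1 * y2 = y3 * y4}"
  let ?Y = "logsgn ` Y"
  have eq: "logsgn a - logsgn c = logsgn d - logsgn b \<longleftrightarrow> a * b = c * d"
    if "a \<in> Y" "b \<in> Y" "c \<in> Y" "d \<in> Y" for a b c d
  proof -
    have nz: "a \<noteq> 0" "b \<noteq> 0" "c \<noteq> 0" "d \<noteq> 0" using that assms by auto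
    have "logsgn a - logsgn c = logsgn d - logsgn b \<longleftrightarrow> logsgn a + logsgn b = logsgn c + logsgn d"
      by (auto simp: algebra_simps)
    also have "\<dots> \<longleftrightarrow> logsgn (a * b) = logsgn (c * d)" using nz by (simp add: logsgn_mult)
    also have "\<dots> \<longleftrightarrow> a * b = c * d" using nz by (simp add: logsgn_inject)
    finally show ?thesis .
  qed
  have "inj_on ?F ?M"
    using inj_on_logsgn[OF assms(2)] by (auto simp: inj_on_def)
  moreover have "?F ` ?M = {(a, b, c, d). a \<in> ?Y \<and> b \<in> ?Y \<and> c \<in> ?Y \<and> d \<in> ?Y \<and> a - b = c - d}"
  proof (intro equalityI subsetI)
    fix z assume "z \<in> {(a, b, c, d). a \<in> ?Y \<and> b \<in> ?Y \<and> c \<in> ?Y \<and> d \<in> ?Y \<and> a - b = c - d}"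
    then obtain a b c d where z: "z = (logsgn a, logsgn c, logsgn d, logsgn b)" "a \<in> Y" "b \<in> Y" "c \<in> Y" "d \<in> Y"
      "logsgn a - logsgn c = logsgn d - logsgn b" by auto
    then have "(a, b, c, d) \<in> ?M" using eq by auto
    then show "z \<in> ?F ` ?M" using z by (intro image_eqI[of _ _ "(a, b, c, d)"]) auto
  next
    fix z assume "z \<in> ?F ` ?M"
    then obtain a b c d where z: "z = (logsgn a, logsgn c, logsgn d, logsgn b)" and
      abcd: "a \<in> Y" "b \<in> Y" "c \<in> Y" "d \<in> Y" "a * b = c * d" by auto
    from eq[OF abcd(1-4)] abcd(5) have "logsgn a - logsgn c = logsgn d - logsgn b" by simp
    with abcd show "z \<in> {(a, b, c, d). a \<in> ?Y \<and> b \<in> ?Y \<and> c \<in> ?Y \<and> d \<in> ?Y \<and> a - b = c - d}"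
      by (simp add: z)
  qed
  ultimately have "card ?M = card {(a, b, c, d). a \<in> ?Y \<and> b \<in> ?Y \<and> c \<in> ?Y \<and> d \<in> ?Y \<and> a - b = c - d}"
    by (metis (no_types, lifting) card_image)
  then show ?thesis using assms by (simp add: mult_energy_def energy_2_card)
qed

section \<open>Additive structure forces multiplicative control\<close>

text \<open>The equation \<open>x c = b + p\<close> has at least \<open>|X| \<tau> T\<close>
  solutions. Each is an incidence of a point of \<open>C \<times> P\<close> with one of the
  \<open>|X| |B|\<close> lines of slope \<open>x\<close> and intercept \<open>- b\<close>. In
  Szemeredi-Trotter a factor \<open>|X|^2\<close> then cancels.\<close>

lemma card_popular_ratios:
  fixes S B P C X :: "real set"
  assumes fin: "finite S" "finite B" "finite P" "finite C" "finite X" and X0: "0 \<notin> X"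
    and T: "T \<ge> 1" "\<And>s. s \<in> S \<Longrightarrow> T \<le> card {b\<in>B. s - b \<in> P}"
    and X: "\<And>x. x \<in> X \<Longrightarrow> \<tau> \<le> card {c\<in>C. x * c \<in> S}" and C0: "0 \<notin> C"
  shows "real (card X) * real \<tau>^3 * real T^3 \<le> 100 * real (card B)^2 * real (card P)^2 * real (card C)^2"
proof (cases "X = {} \<or> \<tau> = 0")
  case False
  define L where "L = (\<lambda>(x, b). (x, - b)) ` (X \<times> B)"
  have inj: "inj_on (\<lambda>(x, b). (x, - b)) (X \<times> B)" by (auto intro: inj_onI)
  have cL: "card L = card X * card B" unfolding L_def using inj by (simp add: card_image card_cartesian_product)
  have T_pairs: "card S * T \<le> card B * card P"
  proof -
    have "card S * T = (\<Sum>s\<in>S. T)" by simp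
    also have "\<dots> \<le> (\<Sum>s\<in>S. card {b\<in>B. s - b \<in> P})" by (intro sum_mono T)
    also have "\<dots> = card (SIGMA s:S. {b\<in>B. s - b \<in> P})" using fin by (intro card_SigmaI[symmetric]) auto
    also have "\<dots> \<le> card (B \<times> P)"
      by (rule card_inj_on_le[of "\<lambda>(s, b). (b, s - b)"]) (use fin in \<open>auto intro!: inj_onI\<close>)
    finally show ?thesis by (simp add: card_cartesian_product)
  qed
  obtain x0 where x0: "x0 \<in> X" using False by auto
  have "card {c\<in>C. x0 * c \<in> S} \<noteq> 0" using X[OF x0] False by linarith
  then have "{c\<in>C. x0 * c \<in> S} \<noteq> {}" by (intro notI) (simp only: card.empty)
  then obtain s0 where s0: "s0 \<in> S" by auto
  have TP: "T \<le> card P"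
  proof -
    have "T \<le> card {b\<in>B. s0 - b \<in> P}" by (rule T(2)[OF s0])
    also have "\<dots> \<le> card P"
      by (rule card_inj_on_le[of "\<lambda>b. s0 - b"]) (use fin in \<open>auto intro!: inj_onI\<close>)
    finally show ?thesis .
  qed
  have tC: "\<tau> \<le> card C"
    using X[OF x0] card_mono[of C "{c\<in>C. x0 * c \<in> S}"] fin by auto
  have Xt: "card X * \<tau> \<le> card S * card C"
  proof -
    have "card X * \<tau> = (\<Sum>x\<in>X. \<tau>)" by simp
    also have "\<dots> \<le> (\<Sum>x\<in>X. card {c\<in>C. x * c \<in> S})" by (intro sum_mono X)
    also have "\<dots> = card (SIGMA x:X. {c\<in>C. x * c \<in> S})" using fin by (intro card_SigmaI[symmetric]) auto
    also have "\<dots> \<le> card (S \<times> C)"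
    proof (rule card_inj_on_le[of "\<lambda>(x, c). (x * c, c)"])
      show "inj_on (\<lambda>(x, c). (x * c, c)) (SIGMA x:X. {c\<in>C. x * c \<in> S})"
        using C0 by (auto intro!: inj_onI)
    qed (use fin in auto)
    finally show ?thesis by (simp add: card_cartesian_product)
  qed
  have "(\<Sum>l\<in>L. card (hits C P l)) = (\<Sum>(x, b)\<in>X \<times> B. card {c\<in>C. x * c - b \<in> P})"
    unfolding L_def using inj by (subst sum.reindex) (auto simp: hits_def case_prod_beta intro!: sum.cong)
  also have "\<dots> = (\<Sum>x\<in>X. \<Sum>b\<in>B. card {c\<in>C. x * c - b \<in> P})" by (simp add: sum.cartesian_product)
  finally have I: "(\<Sum>l\<in>L. card (hits C P l)) = (\<Sum>x\<in>X. \<Sum>b\<in>B. card {c\<in>C. x * c - b \<in> P})" .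
  have ge: "\<tau> * T \<le> (\<Sum>b\<in>B. card {c\<in>C. x * c - b \<in> P})" if x: "x \<in> X" for x
  proof -
    have "\<tau> * T \<le> card {c\<in>C. x * c \<in> S} * T" using X[OF x] by simp
    also have "\<dots> = (\<Sum>c\<in>{c\<in>C. x * c \<in> S}. T)" by simp
    also have "\<dots> \<le> (\<Sum>c\<in>{c\<in>C. x * c \<in> S}. card {b\<in>B. x * c - b \<in> P})" using T by (intro sum_mono) auto
    also have "\<dots> \<le> (\<Sum>c\<in>C. card {b\<in>B. x * c - b \<in> P})" using fin by (intro sum_mono2) auto
    also have "\<dots> = (\<Sum>b\<in>B. card {c\<in>C. x * c - b \<in> P})"
      using fin(2,4) by (simp only: card_eq_sum sum.inter_filter) (rule sum.swap)
    finally show ?thesis .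
  qed
  define I where "I = real (\<Sum>l\<in>L. card (hits C P l))"
  have "card X * (\<tau> * T) = (\<Sum>x\<in>X. \<tau> * T)" by simp
  also have "\<dots> \<le> (\<Sum>l\<in>L. card (hits C P l))" unfolding I by (intro sum_mono ge)
  finally have Ige: "real (card X) * (real \<tau> * real T) \<le> I" unfolding I_def by (metis of_nat_le_iff of_nat_mult)
  define x where "x = real (card X)"
  define b where "b = real (card B)"
  define p where "p = real (card P)"
  define c where "c = real (card C)"
  define t where "t = real \<tau>"
  define u where "u = real T"
  note defs = x_def b_def p_def c_def t_def u_def
  have nonneg: "x \<ge> 0" "b \<ge> 0" "p \<ge> 0" "c \<ge> 0" "t > 0" "u > 0" using False T by (auto simp: defs)
  have xpos: "x > 0" using False fin by (auto simp: x_def card_gt_0_iff)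
  have "I^3 \<le> 100 * c^2 * p^2 * (x * b)^2 \<or> I < 4 * (x * b)"
  proof -
    have "finite L" "\<And>l. l \<in> L \<Longrightarrow> fst l \<noteq> 0" using fin X0 by (auto simp: L_def)
    from grid_incidences[OF fin(4,3) this] show ?thesis unfolding I_def cL by (simp add: defs)
  qed
  then have "x * t^3 * u^3 \<le> 100 * b^2 * p^2 * c^2"
  proof
    assume a: "I^3 \<le> 100 * c^2 * p^2 * (x * b)^2"
    have "(x * t^3 * u^3) * x^2 = (x * (t * u))^3" by (simp add: power_mult_distrib power_numeral_reduce)
    also have "\<dots> \<le> I^3" using Ige nonneg by (intro power_mono) (auto simp: defs)
    also have "\<dots> \<le> (100 * b^2 * p^2 * c^2) * x^2" using a by (simp add: power_mult_distrib mult_ac)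
    finally show ?thesis using xpos by (simp add: mult_le_cancel_right)
  next
    \<comment> \<open>With fewer than four points per line, \<open>\<tau> T <= 4 |B|\<close>, and
      double counting alone gives the claim.\<close>
    assume "I < 4 * (x * b)"
    then have "x * (t * u) < x * (4 * b)" using Ige by (simp add: defs mult_ac)
    then have tu: "t * u \<le> 4 * b" using xpos by simp
    have 1: "x * t \<le> real (card S) * c" using Xt by (simp add: defs flip: of_nat_mult)
    have 2: "real (card S) * u \<le> b * p" using T_pairs by (simp add: defs flip: of_nat_mult)
    have 3: "t \<le> c" "u \<le> p" using tC TP by (auto simp: defs)
    have "x * t^3 * u^3 = (x * t) * t * (t * u) * u * u" by (simp add: power3_eq_cube mult_ac)
    also have "\<dots> \<le> (real (card S) * c) * c * (4 * b) * u * p"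
      by (rule mult_mono[OF mult_mono[OF mult_mono[OF mult_mono[OF 1 3(1)] tu] order_refl] 3(2)]) (use nonneg in auto)
    also have "\<dots> = (real (card S) * u) * (4 * b * c^2 * p)" by (simp add: power2_eq_square mult_ac)
    also have "\<dots> \<le> (b * p) * (4 * b * c^2 * p)" using 2 nonneg by (intro mult_right_mono) auto
    also have "\<dots> \<le> 100 * b^2 * p^2 * c^2" using nonneg by (simp add: power2_eq_square mult_ac)
    finally show ?thesis .
  qed
  then show ?thesis by (simp add: defs)
qed (auto simp: power_0_left)

text \<open>\<open>controlled\<close> quantifies over all finite subsets of the target group; by
  surjectivity each comes from a set of nonzero reals of the same size.\<close>

lemma logsgn_preimage:
  assumes "finite B"
  obtains C where "finite C" "0 \<notin> C" "B = logsgn ` C" "card C = card B"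
proof -
  obtain f where f: "f z \<noteq> 0 \<and> logsgn (f z) = z" for z using logsgn_surj by metis
  have "logsgn ` f ` B = B" using f by (auto simp: image_image)
  moreover have "0 \<notin> f ` B" using f by (metis (no_types) imageE)
  ultimately show ?thesis using that[of "f ` B"] assms card_logsgn[of "f ` B"] by simp
qed

text \<open>By the incidence bound at most \<open>M / t^3\<close> ratios are represented
  \<open>t\<close> times; the layer-cake sum turns this into a third moment.\<close>

lemma mult_controlled:
  fixes S B P :: "real set"
  assumes fin: "finite S" "finite B" "finite P" and S: "S \<noteq> {}" "0 \<notin> S"
    and T: "T \<ge> 1" "\<And>s. s \<in> S \<Longrightarrow> T \<le> card {b\<in>B. s - b \<in> P}"
  shows "controlled (logsgn ` S) (300 * lg (card S) * real (card B)^2 * real (card P)^2 / real T^3)"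
  unfolding controlled_def
proof (intro allI impI)
  fix B' :: "(real \<times> bit) set" assume "finite B'"
  then obtain C where C: "finite C" "0 \<notin> C" "B' = logsgn ` C" "card C = card B'" by (rule logsgn_preimage)
  let ?r = "rep (logsgn ` S) (logsgn ` C)"
  define M where "M = 100 * real (card B)^2 * real (card P)^2 * real (card C)^2 / real T^3"
  have c1: "card S \<ge> 1" using fin S by (simp add: Suc_le_eq card_gt_0_iff)
  have "(\<Sum>z\<in>dset (logsgn ` S) (logsgn ` C). 1 * real (?r z)^3) \<le> real 3 * lg (card S) * M"
  proof (rule sum_power_le_levels)
    fix t assume t: "t \<in> {1..card S}"
    define Z where "Z = {z\<in>dset (logsgn ` S) (logsgn ` C). t \<le> ?r z}"
    have "finite Z" using fin C by (simp add: Z_def)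
    then obtain X where X: "finite X" "0 \<notin> X" "Z = logsgn ` X" "card X = card Z" by (rule logsgn_preimage)
    have "real (card X) * real t^3 * real T^3 \<le> 100 * real (card B)^2 * real (card P)^2 * real (card C)^2"
    proof (rule card_popular_ratios[OF fin C(1) X(1,2) T _ C(2)])
      fix x assume x: "x \<in> X"
      then have "logsgn x \<in> Z" using X by auto
      then have "t \<le> ?r (logsgn x)" by (simp add: Z_def)
      moreover have "x \<noteq> 0" using x X(2) by auto
      ultimately show "t \<le> card {c\<in>C. x * c \<in> S}" using rep_logsgn[of S C x] fin C S by simp
    qed
    then have "real (card X) * real t^3 \<le> M" using T by (simp add: M_def field_simps)
    then show "real t^3 * (\<Sum>z\<in>{z\<in>dset (logsgn ` S) (logsgn ` C). t \<le> ?r z}. 1) \<le> M"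
      unfolding Z_def[symmetric] X(4)[symmetric] by (simp add: mult.commute X(4))
  next
    fix z show "?r z \<le> card S" using rep_le1[of "logsgn ` S" "logsgn ` C" z] fin C card_logsgn[OF S(2)] by simp
  qed (use fin C c1 in auto)
  then show "energy 3 (logsgn ` S) B' \<le> 300 * lg (card S) * real (card B)^2 * real (card P)^2 / real T^3 * real (card B')^2"
    unfolding C(3) C(4)[folded C(3)] energy_def M_def using card_logsgn[OF C(2)] by simp
qed

text \<open>The least constant that controls \<open>S\<close>, as a functional because the
  decomposition compares nested sets. Excluding the empty \<open>B\<close> avoids a division by
  zero.\<close>

definition ctl :: "'a::ab_group_add set \<Rightarrow> real" where
  "ctl S = (SUP B\<in>{B. finite B \<and> B \<noteq> {}}. energy 3 S B / real (card B)^2)"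

lemma controlled_mono: "controlled A K \<Longrightarrow> K \<le> K' \<Longrightarrow> controlled A K'"
proof -
  assume a: "controlled A K" "K \<le> K'"
  have "energy 3 A B \<le> K' * real (card B)^2" if "finite B" for B
  proof -
    have "energy 3 A B \<le> K * real (card B)^2" using a that by (simp add: controlled_def)
    also have "\<dots> \<le> K' * real (card B)^2" using a by (intro mult_right_mono) auto
    finally show ?thesis .
  qed
  then show ?thesis by (simp add: controlled_def)
qed

text \<open>The trivial bound, which makes the supremum in \<open>ctl\<close> finite.\<close>

lemma energy_3_le:
  assumes "finite A" "finite B"
  shows "energy 3 A B \<le> real (card A)^2 * real (card B)^2"
proof -
  have "energy 3 A B = (\<Sum>x\<in>dset A B. real (rep A B x)^1 * (real (rep A B x) * real (rep A B x)))"
    by (simp add: energy_def power3_eq_cube mult.assoc)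
  also have "\<dots> \<le> (\<Sum>x\<in>dset A B. real (rep A B x)^1 * (real (card A) * real (card B)))"
    using rep_le1[OF assms] rep_le2[OF assms] by (intro sum_mono mult_left_mono mult_mono) auto
  also have "\<dots> = energy 1 A B * (real (card A) * real (card B))"
    by (simp add: energy_def flip: sum_distrib_right)
  finally show ?thesis by (simp only: energy_1[OF assms]) (simp add: power2_eq_square mult_ac)
qed

lemma bdd_above_ctl:
  assumes "finite S"
  shows "bdd_above ((\<lambda>B. energy 3 S B / real (card B)^2) ` {B. finite B \<and> B \<noteq> {}})"
proof (rule bdd_aboveI2)
  fix B :: "'a set" assume "B \<in> {B. finite B \<and> B \<noteq> {}}"
  then have "finite B" "card B > 0" by (auto simp: card_gt_0_iff)
  then show "energy 3 S B / real (card B)^2 \<le> real (card S)^2"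
    using energy_3_le[OF assms, of B] by (simp add: divide_le_eq)
qed

lemma energy_div_le_ctl:
  assumes "finite S" "finite B" "B \<noteq> {}"
  shows "energy 3 S B / real (card B)^2 \<le> ctl S"
  unfolding ctl_def using assms by (intro cSUP_upper2[OF bdd_above_ctl]) auto

lemma controlled_ctl: "finite S \<Longrightarrow> controlled S (ctl S)"
  unfolding controlled_def
proof (intro allI impI)
  fix B :: "'a set" assume S: "finite S" and B: "finite B"
  show "energy 3 S B \<le> ctl S * real (card B)^2"
  proof (cases "B = {}")
    case True then show ?thesis by (simp add: energy_def dset_def)
  next
    case False
    then have "card B > 0" using B by (simp add: card_gt_0_iff)
    then show ?thesis using energy_div_le_ctl[OF S B False] by (simp add: divide_le_eq)
  qed
qed

lemma ctl_mono:
  assumes "finite S'" "S \<subseteq> S'" shows "ctl S \<le> ctl S'"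
  unfolding ctl_def[of S]
proof (rule cSUP_least)
  fix B :: "'a set" assume "B \<in> {B. finite B \<and> B \<noteq> {}}"
  then have B: "finite B" "B \<noteq> {}" by auto
  have "energy 3 S B / real (card B)^2 \<le> energy 3 S' B / real (card B)^2"
    using energy_mono[OF assms(1) B(1) assms(2), of B 3] by (intro divide_right_mono) auto
  also have "\<dots> \<le> ctl S'" by (rule energy_div_le_ctl[OF assms(1) B])
  finally show "energy 3 S B / real (card B)^2 \<le> ctl S'" .
qed auto

lemma ctl_ge_1:
  fixes S :: "'a::ab_group_add set"
  assumes "finite S" "S \<noteq> {}" shows "ctl S \<ge> 1"
proof -
  obtain s where s: "s \<in> S" using assms by auto
  then have "s \<in> dset S {0}" unfolding dset_def by (intro image_eqI[of _ _ "(s, 0)"]) auto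
  then have "rep S {0} s \<ge> 1" using assms by (intro rep_pos) auto
  then have "1 \<le> (\<Sum>x\<in>{s}. real (rep S {0} x)^3)" by simp
  also have "\<dots> \<le> energy 3 S {0}" using assms by (intro sum_rep_power_le) auto
  also have "\<dots> = energy 3 S {0} / real (card {0::'a})^2" by simp
  also have "\<dots> \<le> ctl S" using assms by (intro energy_div_le_ctl) auto
  finally show ?thesis .
qed

section \<open>Extracting a multiplicatively controlled piece\<close>

lemma sum_card_popular:
  assumes "finite S" "finite B" "P \<subseteq> dset S B"
  shows "(\<Sum>s\<in>S. card {b\<in>B. s - b \<in> P}) = (\<Sum>x\<in>P. rep S B x)"
proof -
  have "real (\<Sum>s\<in>S. card {b\<in>B. s - b \<in> P}) = (\<Sum>s\<in>S. \<Sum>b\<in>B. of_bool (s - b \<in> P))"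
    using assms by (simp add: of_bool_def flip: sum.inter_filter)
  also have "\<dots> = (\<Sum>x\<in>dset S B. real (rep S B x) * of_bool (x \<in> P))"
    using assms by (intro sum_differences)
  also have "\<dots> = (\<Sum>x\<in>P. real (rep S B x))"
    using assms by (intro sum.mono_neutral_cong_right) auto
  finally show ?thesis by (simp only: of_nat_eq_iff flip: of_nat_sum)
qed

text \<open>Weigh each \<open>s\<close> by its number of popular differences \<open>s - b\<close>;
  the total weight is at least \<open>t |P|\<close>. The weights can be as large as
  \<open>card B\<close> with \<open>B\<close> arbitrary, so the pigeonhole principle must lose a
  logarithm of \<open>card S\<close> only.\<close>

lemma popular_subset:
  assumes S: "finite S" "S \<noteq> {}" and B: "finite B" and P: "P = {x\<in>dset S B. rep S B x \<ge> t}" "P \<noteq> {}" and t: "t \<ge> 1"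
  obtains S' T where "S' \<subseteq> S" "S' \<noteq> {}" "T \<ge> 1" "\<And>s. s \<in> S' \<Longrightarrow> T \<le> card {b\<in>B. s - b \<in> P}"
    "real t * real (card P) \<le> lg (card S) * (real T * real (card S'))"
proof -
  define w where "w s = card {b\<in>B. s - b \<in> P}" for s
  have finP: "finite P" using S B P by simp
  obtain s0 where s0: "s0 \<in> S" "real (sum w S) \<le> lg (card S) * (w s0 * card {y\<in>S. w y \<ge> w s0})"
    by (rule sum_pigeonhole_card[OF S])
  have "t * card P = (\<Sum>x\<in>P. t)" by simp
  also have "\<dots> \<le> (\<Sum>x\<in>P. rep S B x)" by (intro sum_mono) (simp add: P)
  also have "\<dots> = sum w S" unfolding w_def using S B P by (intro sum_card_popular[symmetric]) auto
  finally have 1: "t * card P \<le> sum w S" .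
  then have "real t * real (card P) \<le> real (sum w S)" by (simp only: of_nat_mult[symmetric] of_nat_le_iff)
  with s0 have 2: "real t * real (card P) \<le> lg (card S) * (real (w s0) * real (card {y\<in>S. w y \<ge> w s0}))" by simp
  have "real t * real (card P) > 0" using t P finP by (simp add: card_gt_0_iff)
  with 2 have "w s0 \<noteq> 0" by (intro notI) simp
  then show ?thesis
    by (intro that[of "{y\<in>S. w y \<ge> w s0}" "w s0"]) (use s0(1) 2 in \<open>auto simp: w_def\<close>)
qed

text \<open>For a nearly extremal \<open>B\<close> and a level \<open>t\<close> of
  \<open>rep S B\<close> with popular set \<open>P\<close>, \<open>ctl S * |B|^2\<close> is at most
  about \<open>t^3 |P|\<close>, and \<open>t |P|\<close> at most about \<open>T |S'|\<close>.
  Multiplying \<open>ctl S\<close> by the constant \<open>|B|^2 |P|^2 / T^3\<close> of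
  \<open>mult_controlled\<close> gives at most about \<open>(t |P|)^3 / T^3\<close>, so
  \<open>B\<close>, \<open>P\<close> and \<open>T\<close> all disappear.\<close>

lemma ex_mult_controlled_subset:
  fixes S :: "real set"
  assumes S: "finite S" "S \<noteq> {}" "0 \<notin> S"
  shows "\<exists>S'\<subseteq>S. S' \<noteq> {} \<and>
    controlled (logsgn ` S') (1800 * lg (card S)^5 * real (card S')^3 / ctl S)"
proof -
  define L where "L = lg (card S)"
  have n1: "card S \<ge> 1" using S by (simp add: Suc_le_eq card_gt_0_iff)
  have L1: "L \<ge> 1" unfolding L_def using n1 by (rule lg_ge_1)
  have \<kappa>: "ctl S \<ge> 1" using S by (intro ctl_ge_1)
  \<comment> \<open>The supremum need not be attained, but some \<open>B\<close> exceeds half of it;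
    this is the 2 in \<open>6 = 2 * 3\<close> below.\<close>
  then have "ctl S / 2 < ctl S" by simp
  then have "\<exists>B\<in>{B. finite B \<and> B \<noteq> {}}. ctl S / 2 < energy 3 S B / real (card B)^2"
    unfolding ctl_def[of S] by (subst (asm) less_cSUP_iff[OF _ bdd_above_ctl[OF S(1)]]) auto
  then obtain B where B: "finite B" "B \<noteq> {}" "ctl S / 2 < energy 3 S B / real (card B)^2" by auto
  have b0: "real (card B) > 0" using B by (simp add: card_gt_0_iff)
  obtain t where t: "t \<in> {1..card S}" 
    "(\<Sum>x\<in>dset S B. real (rep S B x)^3) \<le> real 3 * lg (card S) * (real t^3 * card {x\<in>dset S B. rep S B x \<ge> t})"
    by (rule sum_power_pigeonhole_card[of "dset S B" 3 "card S" "rep S B"]) (use S B n1 rep_le1 in auto)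
  define P where "P = {x\<in>dset S B. rep S B x \<ge> t}"
  have finP: "finite P" using S B by (simp add: P_def)
  have "ctl S * real (card B)^2 < 2 * energy 3 S B" using B(3) b0 by (simp add: field_simps)
  also have "\<dots> \<le> 6 * L * (real t^3 * card P)" using t(2) by (simp add: energy_def P_def L_def)
  finally have \<kappa>P: "ctl S * real (card B)^2 < 6 * L * (real t^3 * card P)" .
  have "P \<noteq> {}"
  proof
    assume "P = {}"
    then have "ctl S * real (card B)^2 < 0" using \<kappa>P by simp
    moreover have "ctl S * real (card B)^2 \<ge> 0" using \<kappa> by simp
    ultimately show False by linarith
  qed
  have t1: "t \<ge> 1" using t by simp
  obtain S' T where S': "S' \<subseteq> S" "S' \<noteq> {}" "T \<ge> 1" "\<And>s. s \<in> S' \<Longrightarrow> T \<le> card {b\<in>B. s - b \<in> P}"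
    and T: "real t * real (card P) \<le> lg (card S) * (real T * real (card S'))"
    by (rule popular_subset[OF S(1,2) B(1) P_def \<open>P \<noteq> {}\<close> t1]) (rule that)
  note T = T[folded L_def]
  have finS': "finite S'" using S' S finite_subset by blast
  have ctr: "controlled (logsgn ` S') (300 * lg (card S') * real (card B)^2 * real (card P)^2 / real T^3)"
    using S' S finS' B finP by (intro mult_controlled) auto
  define b p \<tau> s u where "b = real (card B)" "p = real (card P)" "\<tau> = real T" "s = real (card S')" "u = real t"
  note defs = this
  have pos: "b > 0" "p > 0" "\<tau> > 0" "s \<ge> 0" "u > 0"
    using b0 \<open>P \<noteq> {}\<close> finP S'(3) t by (auto simp: defs card_gt_0_iff)
  have "(b^2 * p^2 / \<tau>^3) * ctl S = p^2 * (ctl S * b^2) / \<tau>^3" by simp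
  also have "\<dots> \<le> p^2 * (6 * L * (u^3 * p)) / \<tau>^3"
    using \<kappa>P pos by (intro divide_right_mono mult_left_mono) (auto simp: defs)
  also have "\<dots> = 6 * L * (u * p)^3 / \<tau>^3" by (simp add: power_mult_distrib power2_eq_square power3_eq_cube mult_ac)
  also have "\<dots> \<le> 6 * L * (L * (\<tau> * s))^3 / \<tau>^3"
    using T pos L1 by (intro divide_right_mono mult_left_mono power_mono) (auto simp: defs)
  also have "\<dots> = 6 * L^4 * s^3" using pos by (simp add: power_mult_distrib power_numeral_reduce)
  finally have 1: "b^2 * p^2 / \<tau>^3 \<le> 6 * L^4 * s^3 / ctl S" using \<kappa> by (simp add: pos_le_divide_eq)
  have "lg (card S') \<le> L" unfolding L_def using S' S by (intro lg_mono card_mono) auto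
  then have "300 * lg (card S') * (b^2 * p^2 / \<tau>^3) \<le> 300 * L * (6 * L^4 * s^3 / ctl S)"
    using 1 L1 pos by (intro mult_mono) (auto intro!: lg_nonneg)
  \<comment> \<open>One logarithm comes from \<open>mult_controlled\<close>, one from the level
    \<open>t\<close>, three from the cube of \<open>popular_subset\<close>.\<close>
  also have "\<dots> = 1800 * L^5 * s^3 / ctl S" by (simp add: power_numeral_reduce)
  finally have "300 * lg (card S') * b^2 * p^2 / \<tau>^3 \<le> 1800 * L^5 * s^3 / ctl S" by simp
  then show ?thesis using S' controlled_mono[OF ctr] by (intro exI[of _ S']) (auto simp: defs L_def)
qed

section \<open>Additive structure forces small multiplicative energy\<close>

text \<open>Parallel lines are disjoint, so each slope counts a point of \<open>B \<times> B\<close>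
  at most once.\<close>

lemma sum_hits_le:
  fixes \<Lambda> Y B :: "real set"
  assumes "finite \<Lambda>" "finite Y" "finite B"
  shows "(\<Sum>l\<in>\<Lambda> \<times> Y. card (hits B B l)) \<le> card \<Lambda> * card B^2"
proof -
  have "(\<Sum>y\<in>Y. card (hits B B (v, y))) \<le> card B^2" for v
  proof -
    have "(\<Sum>y\<in>Y. card (hits B B (v, y))) = card (SIGMA y:Y. hits B B (v, y))"
      using assms by (intro card_SigmaI[symmetric]) auto
    also have "\<dots> \<le> card (B \<times> B)"
      by (rule card_inj_on_le[of "\<lambda>(y, x). (x, v * x + y)"]) (use assms in \<open>auto intro!: inj_onI simp: hits_def\<close>)
    finally show ?thesis by (simp add: card_cartesian_product power2_eq_square)
  qed
  then have "(\<Sum>v\<in>\<Lambda>. \<Sum>y\<in>Y. card (hits B B (v, y))) \<le> (\<Sum>v\<in>\<Lambda>. card B^2)" by (intro sum_mono)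
  then show ?thesis by (simp add: sum.cartesian_product)
qed

text \<open>Szemeredi-Trotter for the lines with at least \<open>k\<close> points is the weak-type
  bound. In its trivial alternative \<open>k < 4\<close>, so \<open>k^3\<close> is at most 64 and
  the first moment suffices.\<close>

lemma sum_hits_cubed_le:
  fixes \<Lambda> Y B :: "real set"
  assumes fin: "finite \<Lambda>" "finite Y" "finite B" and \<Lambda>: "0 \<notin> \<Lambda>" and B: "B \<noteq> {}"
  shows "(\<Sum>l\<in>\<Lambda> \<times> Y. real (card (hits B B l))^3)
    \<le> 3 * lg (card B) * (100 * real (card B)^4 + 64 * real (card \<Lambda>) * real (card B)^2)"
proof -
  let ?h = "\<lambda>l. card (hits B B l)"
  define M where "M = 100 * real (card B)^4 + 64 * real (card \<Lambda>) * real (card B)^2"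
  have "(\<Sum>l\<in>\<Lambda> \<times> Y. 1 * real (?h l)^3) \<le> real 3 * lg (card B) * M"
  proof (rule sum_power_le_levels)
    fix k assume k: "k \<in> {1..card B}"
    define L where "L = {l\<in>\<Lambda> \<times> Y. k \<le> ?h l}"
    have L: "finite L" "\<And>l. l \<in> L \<Longrightarrow> fst l \<noteq> 0" using fin \<Lambda> by (auto simp: L_def)
    define I where "I = real (\<Sum>l\<in>L. card (hits B B l))"
    have "card L * k = (\<Sum>l\<in>L. k)" by simp
    also have "\<dots> \<le> (\<Sum>l\<in>L. ?h l)" by (intro sum_mono) (auto simp: L_def)
    finally have Ik: "real (card L) * real k \<le> I" unfolding I_def by (metis of_nat_le_iff of_nat_mult)
    have "real k^3 * real (card L) \<le> M"
    proof (cases "card L = 0")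
      case True then show ?thesis by (simp add: M_def)
    next
      case False
      have "I^3 \<le> 100 * real (card B)^2 * real (card B)^2 * real (card L)^2 \<or> I < 4 * real (card L)"
        unfolding I_def by (rule grid_incidences[OF fin(3,3) L])
      then show ?thesis
      proof
        assume a: "I^3 \<le> 100 * real (card B)^2 * real (card B)^2 * real (card L)^2"
        have "(real k^3 * real (card L)) * real (card L)^2 = (real (card L) * real k)^3"
          by (simp add: power_mult_distrib power2_eq_square power3_eq_cube)
        also have "\<dots> \<le> I^3" using Ik by (intro power_mono) auto
        also have "\<dots> \<le> (100 * real (card B)^4) * real (card L)^2" using a by (simp add: power_numeral_reduce)
        finally have "real k^3 * real (card L) \<le> 100 * real (card B)^4" using False by (simp add: mult_le_cancel_right)
        also have "\<dots> \<le> M" by (simp add: M_def)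
        finally show ?thesis .
      next
        assume "I < 4 * real (card L)"
        then have "real (card L) * real k < real (card L) * 4" using Ik by simp
        then have "real k < 4" by (rule mult_left_less_imp_less) simp
        then have k4: "real k \<le> 4" by simp
        have "card L = (\<Sum>l\<in>L. 1)" by simp
        also have "\<dots> \<le> (\<Sum>l\<in>L. ?h l)" using k by (intro sum_mono) (auto simp: L_def)
        also have "\<dots> \<le> (\<Sum>l\<in>\<Lambda> \<times> Y. ?h l)" using fin by (intro sum_mono2) (auto simp: L_def)
        also have "\<dots> \<le> card \<Lambda> * card B^2" by (rule sum_hits_le[OF fin])
        finally have "real (card L) \<le> real (card \<Lambda>) * real (card B)^2" by (metis of_nat_le_iff of_nat_mult of_nat_power)
        then have "real k^3 * real (card L) \<le> 4^3 * (real (card \<Lambda>) * real (card B)^2)"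
          using k4 by (intro mult_mono power_mono) auto
        also have "\<dots> \<le> M" by (simp add: M_def)
        finally show ?thesis .
      qed
    qed
    then show "real k^3 * (\<Sum>l\<in>{l\<in>\<Lambda> \<times> Y. k \<le> ?h l}. 1) \<le> M" by (simp add: L_def)
  next
    fix l show "?h l \<le> card B" unfolding hits_def using fin by (intro card_mono) auto
  qed (use fin B in \<open>auto simp: Suc_le_eq card_gt_0_iff\<close>)
  then show ?thesis by (simp add: M_def)
qed

text \<open>If \<open>s\<close> and \<open>v s\<close> lie in \<open>S'\<close>, write
  \<open>s = b' + d'\<close> and \<open>v s = b + d\<close>. Then
  \<open>y = b - v b' = v d' - d\<close>, so the line of slope \<open>v\<close> and intercept
  \<open>y\<close> contains \<open>(b', b)\<close>, and the one of intercept \<open>- y\<close>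
  contains \<open>(d', d)\<close>. Representations thus become coincidences between hits in two
  grids.\<close>

lemma card_common_hits_ge:
  fixes S D S' Y :: "real set"
  assumes fin: "finite S" "finite D" "finite S'" "finite Y"
    and T: "\<And>s. s \<in> S' \<Longrightarrow> T \<le> card {d\<in>D. s - d \<in> S}"
    and \<tau>: "\<tau> \<le> card {s\<in>S'. v * s \<in> S'}"
    and Y: "\<And>b b'. b \<in> S \<Longrightarrow> b' \<in> S \<Longrightarrow> b - v * b' \<in> Y"
  shows "\<tau> * T^2 \<le> (\<Sum>y\<in>Y. card (hits S S (v, y)) * card (hits D D (v, - y)))"
proof -
  let ?R = "{s\<in>S'. v * s \<in> S'}"
  let ?W = "SIGMA s:?R. {d\<in>D. v * s - d \<in> S} \<times> {d\<in>D. s - d \<in> S}"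
  have "\<tau> * T^2 \<le> card ?R * T^2" using \<tau> by simp
  also have "\<dots> = (\<Sum>s\<in>?R. T * T)" by (simp add: power2_eq_square)
  also have "\<dots> \<le> (\<Sum>s\<in>?R. card {d\<in>D. v * s - d \<in> S} * card {d\<in>D. s - d \<in> S})"
    using T by (intro sum_mono mult_mono) auto
  also have "\<dots> = card ?W"
    using fin by (subst card_SigmaI) (auto simp: card_cartesian_product)
  also have "\<dots> \<le> card (SIGMA y:Y. hits S S (v, y) \<times> hits D D (v, - y))"
  \<comment> \<open>Injective because \<open>s = b' + d'\<close> and \<open>d = v d' - y\<close> can
    be recovered.\<close>
  proof (rule card_inj_on_le[where f = "\<lambda>(s, d, d'). (v * d' - d, s - d', d')"])
    show "(\<lambda>(s, d, d'). (v * d' - d, s - d', d')) ` ?W \<subseteq> (SIGMA y:Y. hits S S (v, y) \<times> hits D D (v, - y))"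
    proof (rule image_subsetI)
      fix z assume z: "z \<in> ?W"
      obtain s d d' where z': "z = (s, d, d')" by (cases z)
      have *: "d \<in> D" "d' \<in> D" "v * s - d \<in> S" "s - d' \<in> S" using z by (auto simp: z')
      have e: "v * s - d - v * (s - d') = v * d' - d" by (simp add: algebra_simps)
      have "v * d' - d \<in> Y" using Y[OF *(3,4)] unfolding e .
      moreover have "v * (s - d') + (v * d' - d) = v * s - d" by (simp add: algebra_simps)
      then have "s - d' \<in> hits S S (v, v * d' - d)"
        using *(3,4) by (simp only: hits_def mem_Collect_eq fst_conv snd_conv simp_thms)
      moreover have "d' \<in> hits D D (v, - (v * d' - d))" using * by (simp add: hits_def)
      ultimately show "(\<lambda>(s, d, d'). (v * d' - d, s - d', d')) z \<in> (SIGMA y:Y. hits S S (v, y) \<times> hits D D (v, - y))"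
        by (simp add: z')
    qed
    show "inj_on (\<lambda>(s, d, d'). (v * d' - d, s - d', d')) ?W" by (auto intro!: inj_onI)
    show "finite (SIGMA y:Y. hits S S (v, y) \<times> hits D D (v, - y))" using fin by auto
  qed
  also have "\<dots> = (\<Sum>y\<in>Y. card (hits S S (v, y)) * card (hits D D (v, - y)))"
    using fin by (subst card_SigmaI) (auto simp: card_cartesian_product)
  finally show ?thesis .
qed

text \<open>Here \<open>l\<close>, \<open>n\<close>, \<open>p\<close>, \<open>s\<close> are the
  sizes of the set of ratios, of \<open>S\<close>, \<open>D\<close> and \<open>S'\<close>; the
  \<open>F\<close> and \<open>G\<close> are moments of the hits in the two grids and
  \<open>W\<close> is their correlation. If \<open>l <= p^2\<close>, then \<open>n^4\<close> and
  \<open>p^4\<close> dominate the third moments, and \<open>W6\<close> or \<open>W4\<close> is used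
  according to whether \<open>n <= p\<close>. If \<open>l > p^2\<close>, the parallel-line term
  \<open>l p^2\<close> dominates \<open>G3\<close>, and the missing powers come from the double
  counts \<open>ls\<close> and \<open>sT\<close>.\<close>

lemma ratio_count_arith:
  fixes l \<tau> T L n p s W F1 F3 G1 G3 :: real
  assumes pos: "l > 0" "\<tau> > 0" "T > 0" "n > 0" "p > 0" "s \<ge> 0" "L \<ge> 1"
    and F0: "F1 \<ge> 0" "F3 \<ge> 0" "G1 \<ge> 0" "G3 \<ge> 0"
    and W: "l * (\<tau> * T^2) \<le> W" and W6: "W^6 \<le> G3^2 * F3 * F1^3" and W4: "W^4 \<le> F1 * F3 * G1 * G3"
    and F1: "F1 \<le> l * n^2" and F3: "F3 \<le> 3 * L * (100 * n^4 + 64 * l * n^2)"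
    and G1: "G1 \<le> l * p^2" and G3: "G3 \<le> 6 * L * (100 * p^4 + 64 * l * p^2)"
    and l: "l \<le> n^2" and ls: "l * \<tau> \<le> s^2" and sT: "s * T \<le> n * p"
  shows "l^3 * \<tau>^6 * T^12 \<le> 10^9 * L^3 * p^8 * n^10"
proof -
  have "l * n^2 \<le> n^2 * n^2" using l by (intro mult_right_mono) auto
  then have "3 * L * (100 * n^4 + 64 * l * n^2) \<le> 3 * L * (164 * n^4)"
    using pos by (intro mult_left_mono) (auto simp flip: power_add)
  with F3 have F3': "F3 \<le> 492 * L * n^4" by simp
  have W0: "0 \<le> l * (\<tau> * T^2)" using pos by simp
  have X4: "l^4 * \<tau>^4 * T^8 \<le> (l * n^2) * (492 * L * n^4) * (l * p^2) * G3"
  proof -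
    have "l^4 * \<tau>^4 * T^8 = (l * (\<tau> * T^2))^4" by (simp add: power_mult_distrib flip: power_mult)
    also have "\<dots> \<le> W^4" using W W0 by (intro power_mono) auto
    also have "\<dots> \<le> F1 * F3 * G1 * G3" by (rule W4)
    also have "\<dots> \<le> (l * n^2) * (492 * L * n^4) * (l * p^2) * G3"
      by (rule mult_right_mono[OF mult_mono[OF mult_mono[OF F1 F3'] G1]]) (use F0 pos in auto)
    finally show ?thesis .
  qed
  have L3: "L * L^2 = L^3" by (simp add: power2_eq_square power3_eq_cube)
  have LL: "L^2 \<le> L^3" using pos by (intro power_increasing) auto
  show ?thesis
  proof (cases "l \<le> p^2")
    case True
    then have "l * p^2 \<le> p^2 * p^2" by (intro mult_right_mono) auto
    then have "6 * L * (100 * p^4 + 64 * l * p^2) \<le> 6 * L * (164 * p^4)"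
      using pos by (intro mult_left_mono) (auto simp flip: power_add)
    with G3 have G3': "G3 \<le> 984 * L * p^4" by simp
    show ?thesis
    proof (cases "n \<le> p")
      case True
      have "(l^3 * \<tau>^6 * T^12) * l^3 = (l * (\<tau> * T^2))^6" by (simp add: power_mult_distrib mult_ac flip: power_mult power_add)
      also have "\<dots> \<le> W^6" using W W0 by (intro power_mono) auto
      also have "\<dots> \<le> G3^2 * F3 * F1^3" by (rule W6)
      also have "\<dots> \<le> (984 * L * p^4)^2 * (492 * L * n^4) * (l * n^2)^3"
        by (rule mult_mono[OF mult_mono[OF power_mono[OF G3'] F3'] power_mono[OF F1]]) (use F0 pos in auto)
      also have "\<dots> = (476381952 * L^3 * p^8 * n^10) * l^3"
        by (simp add: power_mult_distrib mult_ac L3 flip: power_mult power_add)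
      finally have "l^3 * \<tau>^6 * T^12 \<le> 476381952 * L^3 * p^8 * n^10" using pos by (simp add: mult_le_cancel_right)
      also have "\<dots> \<le> 10^9 * L^3 * p^8 * n^10" using pos by (intro mult_right_mono) auto
      finally show ?thesis .
    next
      case False
      have "(l^2 * \<tau>^4 * T^8) * l^2 = l^4 * \<tau>^4 * T^8" by (simp add: mult_ac flip: power_add)
      also note X4
      also have "(l * n^2) * (492 * L * n^4) * (l * p^2) * G3 \<le> (l * n^2) * (492 * L * n^4) * (l * p^2) * (984 * L * p^4)"
        using G3' pos by (intro mult_left_mono) auto
      also have "\<dots> = (484128 * L^2 * n^6 * p^6) * l^2"
        by (simp add: power2_eq_square mult_ac power_numeral_reduce)
      finally have 1: "l^2 * \<tau>^4 * T^8 \<le> 484128 * L^2 * n^6 * p^6" using pos by (simp add: mult_le_cancel_right)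
      \<comment> \<open>Up to constants the cube of the previous bound is the square of the claim
        times \<open>p^2 / n^2\<close>, which is below 1 here.\<close>
      have "(l^3 * \<tau>^6 * T^12)^2 = (l^2 * \<tau>^4 * T^8)^3" by (simp add: power_mult_distrib flip: power_mult)
      also have "\<dots> \<le> (484128 * L^2 * n^6 * p^6)^3" using 1 pos by (intro power_mono) auto
      also have "\<dots> = 484128^3 * L^6 * n^18 * p^16 * p^2"
        by (simp add: power_mult_distrib mult_ac flip: power_mult power_add)
      also have "\<dots> \<le> (10^9)^2 * L^6 * n^18 * p^16 * n^2"
        using False pos by (intro mult_mono power_mono) auto
      also have "\<dots> = (10^9 * L^3 * p^8 * n^10)^2"
        by (simp add: power_mult_distrib mult_ac flip: power_mult power_add)
      finally show ?thesis by (rule power2_le_imp_le) (use pos in auto)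
    qed
  next
    case False
    then have "p^2 * p^2 \<le> l * p^2" by (intro mult_right_mono) auto
    then have "6 * L * (100 * p^4 + 64 * l * p^2) \<le> 6 * L * (164 * (l * p^2))"
      using pos by (intro mult_left_mono) (auto simp flip: power_add)
    with G3 have G3': "G3 \<le> 984 * L * l * p^2" by simp
    have "(l * \<tau>^4 * T^8) * l^3 = l^4 * \<tau>^4 * T^8" by (simp add: mult_ac power_numeral_reduce)
    also note X4
    also have "(l * n^2) * (492 * L * n^4) * (l * p^2) * G3 \<le> (l * n^2) * (492 * L * n^4) * (l * p^2) * (984 * L * l * p^2)"
      using G3' pos by (intro mult_left_mono) auto
    also have "\<dots> = (484128 * L^2 * n^6 * p^4) * l^3"
      by (simp add: power2_eq_square power3_eq_cube mult_ac power_numeral_reduce)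
    finally have 1: "l * \<tau>^4 * T^8 \<le> 484128 * L^2 * n^6 * p^4" using pos by (simp add: mult_le_cancel_right)
    have "l^3 * \<tau>^6 * T^12 = (l * \<tau>^4 * T^8) * ((l * \<tau>)^2 * T^4)"
      by (simp add: power_mult_distrib mult_ac power_numeral_reduce)
    also have "\<dots> \<le> (484128 * L^2 * n^6 * p^4) * ((s^2)^2 * T^4)"
      by (rule mult_mono[OF 1 mult_right_mono[OF power_mono[OF ls]]]) (use pos in auto)
    also have "(s^2)^2 * T^4 = (s * T)^4" by (simp add: power_mult_distrib flip: power_mult)
    also have "(484128 * L^2 * n^6 * p^4) * (s * T)^4 \<le> (484128 * L^2 * n^6 * p^4) * (n * p)^4"
      using sT pos by (intro mult_left_mono power_mono) auto
    also have "\<dots> = 484128 * L^2 * p^8 * n^10"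
      by (simp add: power_mult_distrib mult_ac flip: power_add)
    also have "\<dots> \<le> 10^9 * L^3 * p^8 * n^10" using LL pos by (intro mult_mono) auto
    finally show ?thesis .
  qed
qed


text \<open>\<open>D\<close> is the level set of \<open>rep S S\<close> that carries the third
  moment, \<open>S'\<close> the elements with at least \<open>T\<close> representations
  \<open>b + d\<close>, and \<open>\<Lambda>\<close> the ratios carrying the energy of
  \<open>S'\<close>. Correlating the hits in \<open>S \<times> S\<close> and
  \<open>D \<times> D\<close> bounds \<open>|\<Lambda>|^3 \<tau>^6 T^12\<close>.\<close>

lemma ex_small_mult_energy_subset:
  fixes S :: "real set"
  assumes S: "finite S" "S \<noteq> {}" "0 \<notin> S"
  shows "\<exists>S'\<subseteq>S. S' \<noteq> {} \<and>
    (energy 2 (logsgn ` S') (logsgn ` S'))^3 * (energy 3 S S)^4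
      \<le> 10^12 * lg (card S)^22 * real (card S)^10 * real (card S')^12"
proof -
  define L where "L = lg (card S)"
  have n1: "card S \<ge> 1" using S by (simp add: Suc_le_eq card_gt_0_iff)
  have L1: "L \<ge> 1" unfolding L_def using n1 by (rule lg_ge_1)
  obtain \<Delta> where \<Delta>: "\<Delta> \<in> {1..card S}"
    "(\<Sum>x\<in>dset S S. real (rep S S x)^3) \<le> real 3 * lg (card S) * (real \<Delta>^3 * card {x\<in>dset S S. rep S S x \<ge> \<Delta>})"
    by (rule sum_power_pigeonhole_card[of "dset S S" 3 "card S" "rep S S"]) (use S n1 rep_le1 in auto)
  define D where "D = {x\<in>dset S S. rep S S x \<ge> \<Delta>}"
  have finD: "finite D" using S by (simp add: D_def)
  have E3: "energy 3 S S \<le> 3 * L * (real \<Delta>^3 * real (card D))" using \<Delta>(2) by (simp add: energy_def D_def L_def)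
  have E3pos: "energy 3 S S \<ge> 0" by (rule energy_nonneg)
  show ?thesis
  proof (cases "D = {}")
    case True
    then have "energy 3 S S = 0" using E3 E3pos by simp
    then show ?thesis using S(2) by (intro exI[of _ S]) (simp add: lg_nonneg)
  next
    case D_ne: False
    have \<Delta>1: "\<Delta> \<ge> 1" using \<Delta> by simp
    obtain S' T where S': "S' \<subseteq> S" "S' \<noteq> {}" "T \<ge> 1" "\<And>s. s \<in> S' \<Longrightarrow> T \<le> card {b\<in>S. s - b \<in> D}"
      and T: "real \<Delta> * real (card D) \<le> lg (card S) * (real T * real (card S'))"
      by (rule popular_subset[OF S(1,2) S(1) D_def D_ne \<Delta>1]) (rule that)
    note T = T[folded L_def]
    have finS': "finite S'" and S'0: "0 \<notin> S'" using S' S finite_subset by auto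
    have s1: "card S' \<ge> 1" using finS' S' by (simp add: Suc_le_eq card_gt_0_iff)
    have sn: "card S' \<le> card S" using S' S by (intro card_mono)
    have TD: "T \<le> card {d\<in>D. s - d \<in> S}" if "s \<in> S'" for s
    proof -
      have "card {b\<in>S. s - b \<in> D} = card {d\<in>D. s - d \<in> S}"
        by (rule bij_betw_same_card[of "\<lambda>b. s - b"], rule bij_betw_byWitness[where f' = "\<lambda>b. s - b"]) auto
      then show ?thesis using S'(4)[OF that] by simp
    qed
    have "card S' * T = (\<Sum>s\<in>S'. T)" by simp
    also have "\<dots> \<le> (\<Sum>s\<in>S'. card {d\<in>D. s - d \<in> S})" by (intro sum_mono TD)
    also have "\<dots> = card (SIGMA s:S'. {d\<in>D. s - d \<in> S})" using finS' finD by (intro card_SigmaI[symmetric]) auto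
    also have "\<dots> \<le> card (S \<times> D)"
      by (rule card_inj_on_le[of "\<lambda>(s, d). (s - d, d)"]) (use S finD in \<open>auto intro!: inj_onI\<close>)
    finally have sT: "card S' * T \<le> card S * card D" by (simp add: card_cartesian_product)
    have "D \<subseteq> dset S S" by (auto simp: D_def)
    then have "card D \<le> card (dset S S)" using S by (intro card_mono) auto
    also have "\<dots> \<le> card (S \<times> S)" unfolding dset_def using S by (intro card_image_le) auto
    finally have pn: "card D \<le> card S^2" by (simp add: card_cartesian_product power2_eq_square)
    let ?\<phi> = "logsgn ` S'"
    let ?r = "rep ?\<phi> ?\<phi>"
    define E where "E = energy 2 ?\<phi> ?\<phi>"
    have c\<phi>: "card ?\<phi> = card S'" using S'0 by (rule card_logsgn)
    obtain \<tau> where \<tau>: "\<tau> \<in> {1..card S'}"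
      "(\<Sum>z\<in>dset ?\<phi> ?\<phi>. real (?r z)^2) \<le> real 2 * lg (card S') * (real \<tau>^2 * card {z\<in>dset ?\<phi> ?\<phi>. ?r z \<ge> \<tau>})"
      by (rule sum_power_pigeonhole_card[of "dset ?\<phi> ?\<phi>" 2 "card S'" ?r])
        (use finS' s1 rep_le1[of ?\<phi> ?\<phi>] c\<phi> in auto)
    define Z where "Z = {z\<in>dset ?\<phi> ?\<phi>. ?r z \<ge> \<tau>}"
    have "finite Z" using finS' by (simp add: Z_def)
    then obtain \<Lambda> where \<Lambda>: "finite \<Lambda>" "0 \<notin> \<Lambda>" "Z = logsgn ` \<Lambda>" "card \<Lambda> = card Z" by (rule logsgn_preimage)
    have E\<Lambda>: "E \<le> 2 * lg (card S') * (real \<tau>^2 * real (card \<Lambda>))"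
      using \<tau>(2) by (simp add: E_def energy_def Z_def \<Lambda>(4))
    have lgs: "lg (card S') \<le> L" unfolding L_def using sn by (rule lg_mono)
    have ratio: "\<tau> \<le> card {s\<in>S'. v * s \<in> S'}" if "v \<in> \<Lambda>" for v
    proof -
      have "logsgn v \<in> Z" using that \<Lambda> by auto
      moreover have "v \<noteq> 0" using that \<Lambda>(2) by auto
      ultimately show ?thesis using rep_logsgn[of S' S' v] finS' S'0 by (simp add: Z_def)
    qed
    have ls: "real \<tau> * real (card \<Lambda>) \<le> real (card S')^2"
      using card_superlevel[of ?\<phi> ?\<phi> \<tau> 1] energy_1[of ?\<phi> ?\<phi>] finS' c\<phi>
      by (simp add: \<Lambda>(4) Z_def power2_eq_square)
    have ln: "real (card \<Lambda>) \<le> real (card S)^2"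
    proof -
      have "1 * real (card \<Lambda>) \<le> real \<tau> * real (card \<Lambda>)" using \<tau> by (intro mult_right_mono) auto
      also have "\<dots> \<le> real (card S')^2" by (rule ls)
      also have "\<dots> \<le> real (card S)^2" using sn by (intro power_mono) auto
      finally show ?thesis by simp
    qed
    \<comment> \<open>All intercepts that can occur, for all slopes together; the moment bounds do
      not depend on its size.\<close>
    define Y where "Y = (\<lambda>(v, b, b'). b - v * b') ` (\<Lambda> \<times> S \<times> S)"
    have finY: "finite Y" using \<Lambda> S by (simp add: Y_def)
    have Y: "b - v * b' \<in> Y" if "v \<in> \<Lambda>" "b \<in> S" "b' \<in> S" for v b b'
      unfolding Y_def using that by (intro image_eqI[of _ _ "(v, b, b')"]) auto
    define f where "f l = real (card (hits S S l))" for l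
    define g where "g l = real (card (hits D D (fst l, - snd l)))" for l
    define W where "W = (\<Sum>l\<in>\<Lambda> \<times> Y. f l * g l)"
    define F1 where "F1 = (\<Sum>l\<in>\<Lambda> \<times> Y. f l)"
    define F3 where "F3 = (\<Sum>l\<in>\<Lambda> \<times> Y. (f l)^3)"
    define G1 where "G1 = (\<Sum>l\<in>\<Lambda> \<times> Y. g l)"
    define G3 where "G3 = (\<Sum>l\<in>\<Lambda> \<times> Y. (g l)^3)"
    have nonneg: "f l \<ge> 0" "g l \<ge> 0" for l by (auto simp: f_def g_def)
    have FG0: "F1 \<ge> 0" "F3 \<ge> 0" "G1 \<ge> 0" "G3 \<ge> 0"
      using nonneg by (auto simp: F1_def F3_def G1_def G3_def intro!: sum_nonneg)
    \<comment> \<open>The second grid meets the lines with opposite intercepts; reflecting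
      \<open>Y\<close> brings its moments into the general form.\<close>
    have refl: "(\<Sum>l\<in>\<Lambda> \<times> Y. F (hits D D (fst l, - snd l))) = (\<Sum>l\<in>\<Lambda> \<times> uminus ` Y. F (hits D D l))"
      for F :: "real set \<Rightarrow> real"
      by (rule sum.reindex_bij_witness[of _ "\<lambda>l. (fst l, - snd l)" "\<lambda>l. (fst l, - snd l)"]) auto
    have "F1 \<le> real (card \<Lambda> * card S^2)"
      unfolding F1_def f_def using sum_hits_le[OF \<Lambda>(1) finY S(1)] by (simp only: of_nat_sum[symmetric] of_nat_le_iff)
    then have F1: "F1 \<le> real (card \<Lambda>) * real (card S)^2" by simp
    have F3: "F3 \<le> 3 * L * (100 * real (card S)^4 + 64 * real (card \<Lambda>) * real (card S)^2)"
      unfolding F3_def f_def L_def using \<Lambda> finY S by (intro sum_hits_cubed_le) auto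
    have "G1 = real (\<Sum>l\<in>\<Lambda> \<times> uminus ` Y. card (hits D D l))"
      unfolding G1_def g_def using refl[of "\<lambda>X. real (card X)"] by simp
    also have "\<dots> \<le> real (card \<Lambda> * card D^2)"
      using sum_hits_le[OF \<Lambda>(1) _ finD, of "uminus ` Y"] finY by (simp only: of_nat_le_iff finite_imageI)
    finally have G1: "G1 \<le> real (card \<Lambda>) * real (card D)^2" by simp
    have "G3 = (\<Sum>l\<in>\<Lambda> \<times> uminus ` Y. real (card (hits D D l))^3)"
      unfolding G3_def g_def by (rule refl[of "\<lambda>X. real (card X)^3"])
    also have "\<dots> \<le> 3 * lg (card D) * (100 * real (card D)^4 + 64 * real (card \<Lambda>) * real (card D)^2)"
      using \<Lambda> finY finD D_ne by (intro sum_hits_cubed_le) auto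
    \<comment> \<open>\<open>D\<close> may have up to \<open>card S^2\<close> elements, hence twice
      the logarithm.\<close>
    also have "\<dots> \<le> 3 * (2 * L) * (100 * real (card D)^4 + 64 * real (card \<Lambda>) * real (card D)^2)"
      using lg_le_2[OF pn] unfolding L_def by (intro mult_right_mono mult_left_mono) auto
    finally have G3: "G3 \<le> 6 * L * (100 * real (card D)^4 + 64 * real (card \<Lambda>) * real (card D)^2)" by simp
    have W6: "W^6 \<le> G3^2 * F3 * F1^3"
      unfolding W_def G3_def F3_def F1_def using nonneg by (intro sum_mult_le_asymmetric)
    have W4: "W^4 \<le> F1 * F3 * G1 * G3"
    proof -
      have "W^4 = (W^2)^2" by simp
      also have "\<dots> \<le> ((\<Sum>l\<in>\<Lambda> \<times> Y. (f l)^2) * (\<Sum>l\<in>\<Lambda> \<times> Y. (g l)^2))^2"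
        unfolding W_def by (intro power_mono Cauchy_Schwarz_ineq_sum) auto
      also have "\<dots> = (\<Sum>l\<in>\<Lambda> \<times> Y. (f l)^2)^2 * (\<Sum>l\<in>\<Lambda> \<times> Y. (g l)^2)^2" by (simp add: power_mult_distrib)
      also have "\<dots> \<le> (F1 * F3) * (G1 * G3)"
        unfolding F1_def F3_def G1_def G3_def using nonneg
        by (intro mult_mono sum_sq_le_first_third) (auto intro!: mult_nonneg_nonneg sum_nonneg)
      finally show ?thesis by (simp add: mult.assoc)
    qed
    have W: "real (card \<Lambda>) * (real \<tau> * real T^2) \<le> W"
    proof -
      have "real (card \<Lambda>) * (real \<tau> * real T^2) = (\<Sum>v\<in>\<Lambda>. real (\<tau> * T^2))" by simp
      also have "\<dots> \<le> (\<Sum>v\<in>\<Lambda>. real (\<Sum>y\<in>Y. card (hits S S (v, y)) * card (hits D D (v, - y))))"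
        using card_common_hits_ge[OF S(1) finD finS' finY TD ratio Y] by (intro sum_mono) (simp only: of_nat_le_iff)
      also have "\<dots> = W" unfolding W_def f_def g_def by (simp add: sum.cartesian_product case_prod_beta)
      finally show ?thesis .
    qed
    define l n p s u t d where "l = real (card \<Lambda>)" "n = real (card S)" "p = real (card D)" "s = real (card S')"
      "u = real T" "t = real \<tau>" "d = real \<Delta>"
    note defs = this
    have pos: "n > 0" "p > 0" "s > 0" "u > 0" "t > 0" "d > 0" "l \<ge> 0"
      using S(1,2) S'(2,3) finS' \<tau>(1) \<Delta>1 D_ne finD by (auto simp: defs card_gt_0_iff)
    have E0: "E \<ge> 0" by (simp add: E_def energy_nonneg)
    have main: "l^3 * t^6 * u^12 \<le> 10^9 * L^3 * p^8 * n^10"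
    proof (cases "l = 0")
      case True then show ?thesis using pos L1 by (simp add: power_0_left)
    next
      case False
      have a1: "l * (t * u^2) \<le> W" "F1 \<le> l * n^2" "F3 \<le> 3 * L * (100 * n^4 + 64 * l * n^2)"
        "G1 \<le> l * p^2" "G3 \<le> 6 * L * (100 * p^4 + 64 * l * p^2)" "l \<le> n^2" "l * t \<le> s^2"
        using W F1 F3 G1 G3 ln ls by (simp_all add: defs mult_ac)
      have a2: "s * u \<le> n * p" using sT by (simp only: defs flip: of_nat_mult)
      show ?thesis
        by (rule ratio_count_arith[of l t u n p s L F1 F3 G1 G3 W]) (use a1 a2 pos L1 False FG0 W6 W4 in auto)
    qed
    have E': "E \<le> 2 * L * (t^2 * l)"
    proof -
      have "E \<le> 2 * lg (card S') * (t^2 * l)" using E\<Lambda> by (simp add: defs)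
      also have "\<dots> \<le> 2 * L * (t^2 * l)" using lgs pos by (intro mult_right_mono) auto
      finally show ?thesis .
    qed
    have T': "d * p \<le> L * (u * s)" using T by (simp add: defs)
    \<comment> \<open>The factor \<open>p^8\<close> completes \<open>(d^3 p)^4\<close> to
      \<open>(d p)^12\<close>, which popularity bounds by \<open>(L u s)^12\<close>. It cancels
      against the \<open>p^8\<close> in \<open>main\<close>.\<close>
    have "(E^3 * energy 3 S S^4) * p^8 \<le> ((2 * L * (t^2 * l))^3 * (3 * L * (d^3 * p))^4) * p^8"
      using E' E0 E3 E3pos pos L1 by (intro mult_right_mono mult_mono power_mono) (auto simp: defs)
    also have "\<dots> = 648 * L^7 * (t^6 * l^3) * (d * p)^12"
      by (simp add: power_mult_distrib mult_ac flip: power_mult power_add)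
    also have "\<dots> \<le> 648 * L^7 * (t^6 * l^3) * (L * (u * s))^12"
      using T' pos L1 by (intro mult_left_mono power_mono) auto
    also have "\<dots> = 648 * L^19 * s^12 * (l^3 * t^6 * u^12)"
      by (simp add: power_mult_distrib mult_ac flip: power_mult power_add)
    also have "\<dots> \<le> 648 * L^19 * s^12 * (10^9 * L^3 * p^8 * n^10)"
      using main L1 pos by (intro mult_left_mono) auto
    also have "\<dots> = (648 * 10^9 * L^22 * n^10 * s^12) * p^8"
      by (simp add: mult_ac flip: power_add)
    finally have "E^3 * energy 3 S S^4 \<le> 648 * 10^9 * L^22 * n^10 * s^12"
      using pos by (simp only: mult_le_cancel_right_pos zero_less_power)
    also have "\<dots> \<le> 10^12 * L^22 * n^10 * s^12" using pos L1 by (intro mult_right_mono) auto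
    finally show ?thesis using S' by (intro exI[of _ S']) (auto simp: E_def defs L_def)
  qed
qed

section \<open>Decomposition\<close>

text \<open>Read \<open>R Y a\<close> as a norm bound, with \<open>add\<close> as triangle
  inequality. The greedy removal becomes a minimal choice: the smallest remainder \<open>S\<close>
  with at least half of the elements whose complement obeys the bound with \<open>g S\<close>. As
  \<open>g\<close> grows when sets shrink, the bounds for pieces removed earlier remain
  valid.\<close>

lemma decomposition:
  fixes A :: "'a set" and R :: "'a set \<Rightarrow> real \<Rightarrow> bool" and g :: "'a set \<Rightarrow> real"
  assumes A: "finite A" "A \<noteq> {}" and R0: "R {} 0"
    and add: "\<And>Y Y' a b. Y \<subseteq> A \<Longrightarrow> Y' \<subseteq> A \<Longrightarrow> a \<ge> 0 \<Longrightarrow> b \<ge> 0 \<Longrightarrow>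
      R Y a \<Longrightarrow> R Y' b \<Longrightarrow> R (Y \<union> Y') (a + b)"
    and mono: "\<And>Y a b. 0 \<le> a \<Longrightarrow> a \<le> b \<Longrightarrow> R Y a \<Longrightarrow> R Y b"
    and piece: "\<And>S. S \<subseteq> A \<Longrightarrow> S \<noteq> {} \<Longrightarrow> \<exists>S'\<subseteq>S. S' \<noteq> {} \<and> R S' (real (card S') * g S)"
    and anti: "\<And>S S'. S \<subseteq> S' \<Longrightarrow> S' \<subseteq> A \<Longrightarrow> S \<noteq> {} \<Longrightarrow> g S' \<le> g S"
    and g0: "\<And>S. S \<subseteq> A \<Longrightarrow> g S \<ge> 0"
  obtains X Y where "X \<subseteq> A" "Y \<subseteq> A" "X \<union> Y = A" "card A \<le> 2 * card X" "card A \<le> 2 * card Y"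
    "R Y (real (card Y) * g X)"
proof -
  define good where "good S \<longleftrightarrow> S \<subseteq> A \<and> card A \<le> 2 * card S \<and> R (A - S) (real (card (A - S)) * g S)" for S
  have "good A" using R0 by (simp add: good_def)
  define S where "S = arg_min card good"
  have S: "good S" and S_min: "\<And>S'. good S' \<Longrightarrow> card S \<le> card S'"
    using arg_min_nat_lemma[of good A card] \<open>good A\<close> by (auto simp: S_def)
  have SA: "S \<subseteq> A" "card A \<le> 2 * card S" and RS: "R (A - S) (real (card (A - S)) * g S)"
    using S by (auto simp: good_def)
  have finS: "finite S" using SA A finite_subset by blast
  have "card A > 0" using A by (simp add: card_gt_0_iff)
  then have "S \<noteq> {}" using SA by auto
  then obtain S' where S': "S' \<subseteq> S" "S' \<noteq> {}" "R S' (real (card S') * g S)" using piece[OF SA(1)] by blast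
  define S2 where "S2 = S - S'"
  have eq: "A - S2 = (A - S) \<union> S'" using S' SA by (auto simp: S2_def)
  have finS': "finite S'" using S' finS finite_subset by blast
  have "card (A - S2) = card (A - S) + card S'"
    unfolding eq using A S' finS' by (intro card_Un_disjoint) auto
  then have c: "real (card (A - S2)) * g S = real (card (A - S)) * g S + real (card S') * g S"
    by (simp add: distrib_right)
  have R2: "R (A - S2) (real (card (A - S2)) * g S)"
    unfolding c unfolding eq using RS S' SA g0[OF SA(1)] by (intro add) auto
  have less: "card S2 < card S"
    unfolding S2_def using S' finS by (intro psubset_card_mono) auto
  \<comment> \<open>Removing one more piece preserves the relation, so by minimality the size
    condition must fail and the complement of \<open>S2\<close> exceeds half. The part returned as
    \<open>X\<close> is still \<open>S\<close>, so \<open>S'\<close> lies in both parts.\<close>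
  have "\<not> card A \<le> 2 * card S2"
  proof
    assume a: "card A \<le> 2 * card S2"
    then have "S2 \<noteq> {}" using \<open>card A > 0\<close> by auto
    then have "g S \<le> g S2" using SA by (intro anti) (auto simp: S2_def)
    then have "R (A - S2) (real (card (A - S2)) * g S2)"
      using R2 g0[OF SA(1)] by (intro mono[OF _ _ R2] mult_left_mono) auto
    then have "good S2" using a SA by (auto simp: good_def S2_def)
    from S_min[OF this] less show False by simp
  qed
  moreover have "card (A - S2) + card S2 = card A"
    using A SA by (metis Diff_subset S2_def card_Diff_subset card_mono finite_subset le_add_diff_inverse2 subset_trans)
  ultimately have "card A \<le> 2 * card (A - S2)" by linarith
  moreover have "S \<union> (A - S2) = A" using SA by (auto simp: S2_def)
  ultimately show ?thesis using that[of S "A - S2"] SA R2 by auto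
qed

section \<open>Triangle inequalities for unions\<close>

lemma rep_Un_le:
  assumes "finite A" "finite A'" "finite B"
  shows "rep (A \<union> A') B x \<le> rep A B x + rep A' B x"
proof -
  have "{(a, b). a \<in> A \<union> A' \<and> b \<in> B \<and> a - b = x}
      = {(a, b). a \<in> A \<and> b \<in> B \<and> a - b = x} \<union> {(a, b). a \<in> A' \<and> b \<in> B \<and> a - b = x}" by auto
  then show ?thesis unfolding rep_def by (simp only: card_Un_le)
qed

lemma rep_Un_right_le:
  assumes "finite A" "finite B" "finite B'"
  shows "rep A (B \<union> B') x \<le> rep A B x + rep A B' x"
proof -
  have "{(a, b). a \<in> A \<and> b \<in> B \<union> B' \<and> a - b = x}
      = {(a, b). a \<in> A \<and> b \<in> B \<and> a - b = x} \<union> {(a, b). a \<in> A \<and> b \<in> B' \<and> a - b = x}" by auto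
  then show ?thesis unfolding rep_def by (simp only: card_Un_le)
qed

text \<open>Minkowski's inequality in l^3, with Hoelder for the two mixed terms of the cube.\<close>

lemma controlled_Un:
  fixes A A' :: "'a::ab_group_add set"
  assumes fin: "finite A" "finite A'" and a: "a \<ge> 0" "controlled A (a^3)" and b: "b \<ge> 0" "controlled A' (b^3)"
  shows "controlled (A \<union> A') ((a + b)^3)"
  unfolding controlled_def
proof (intro allI impI)
  fix B :: "'a set" assume B: "finite B"
  define U where "U = dset (A \<union> A') B"
  define f where "f x = real (rep A B x)" for x
  define g where "g x = real (rep A' B x)" for x
  define c where "c = real (card B)^2"
  have c0: "c \<ge> 0" by (simp add: c_def)
  have finU: "finite U" using fin B by (simp add: U_def)
  have nonneg: "f x \<ge> 0" "g x \<ge> 0" for x by (auto simp: f_def g_def)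
  have F: "(\<Sum>x\<in>U. (f x)^3) \<le> a^3 * c"
    using sum_rep_power_le[OF fin(1) B finU, of 3] a B unfolding f_def c_def controlled_def by force
  have G: "(\<Sum>x\<in>U. (g x)^3) \<le> b^3 * c"
    using sum_rep_power_le[OF fin(2) B finU, of 3] b B unfolding g_def c_def controlled_def by force
  have mixed: "(\<Sum>x\<in>U. (p x)^2 * q x) \<le> u^2 * v * c"
    if "\<And>x. p x \<ge> 0" "\<And>x. q x \<ge> 0" "u \<ge> 0" "v \<ge> 0" "(\<Sum>x\<in>U. (p x)^3) \<le> u^3 * c" "(\<Sum>x\<in>U. (q x)^3) \<le> v^3 * c"
    for p q :: "'a \<Rightarrow> real" and u v
  proof -
    have "(\<Sum>x\<in>U. (p x)^2 * q x)^3 \<le> (\<Sum>x\<in>U. (p x)^3)^2 * (\<Sum>x\<in>U. (q x)^3)"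
      using that by (intro sum_sq2_le_cubes) auto
    also have "\<dots> \<le> (u^3 * c)^2 * (v^3 * c)"
      using that c0 by (intro mult_mono power_mono) (auto intro!: sum_nonneg)
    also have "\<dots> = (u^2 * v * c)^3" by (simp add: power_mult_distrib power2_eq_square power3_eq_cube)
    finally show ?thesis by (rule power_le_imp_le_base[of _ 2, simplified]) (use that c0 in auto)
  qed
  have "energy 3 (A \<union> A') B \<le> (\<Sum>x\<in>U. (f x + g x)^3)"
    unfolding energy_def U_def[symmetric]
  proof (intro sum_mono power_mono)
    fix x show "real (rep (A \<union> A') B x) \<le> f x + g x"
      using rep_Un_le[OF fin B, of x] by (simp add: f_def g_def)
  qed auto
  also have "\<dots> = (\<Sum>x\<in>U. (f x)^3) + 3 * (\<Sum>x\<in>U. (f x)^2 * g x) + 3 * (\<Sum>x\<in>U. (g x)^2 * f x) + (\<Sum>x\<in>U. (g x)^3)"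
    by (simp add: sum_distrib_left flip: sum.distrib)
      (intro sum.cong refl, simp add: power2_eq_square power3_eq_cube algebra_simps)
  also have "\<dots> \<le> a^3 * c + 3 * (a^2 * b * c) + 3 * (b^2 * a * c) + b^3 * c"
    using F G mixed[of f g a b] mixed[of g f b a] a b nonneg by (intro add_mono mult_left_mono) auto
  also have "\<dots> = (a + b)^3 * c" by (simp add: power2_eq_square power3_eq_cube algebra_simps)
  finally show "energy 3 (A \<union> A') B \<le> (a + b)^3 * real (card B)^2" by (simp add: c_def)
qed

text \<open>\<open>a - b = a' - b'\<close> is the same as \<open>a - a' = b - b'\<close>, a
  correlation of two self-representation functions.\<close>

lemma energy_2_cross_le:
  assumes fin: "finite A" "finite B"
  shows "(energy 2 A B)^2 \<le> energy 2 A A * energy 2 B B"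
proof -
  have "energy 2 A B = (\<Sum>x\<in>dset B B. real (rep B B x) * real (rep A A x))"
    using sum_rep_differences[OF fin(1,2,2)] sum_differences[OF fin(2,2), of "\<lambda>x. real (rep A A x)"]
    by (simp add: energy_def power2_eq_square)
  also have "\<dots>^2 \<le> (\<Sum>x\<in>dset B B. real (rep B B x)^2) * (\<Sum>x\<in>dset B B. real (rep A A x)^2)"
    by (rule Cauchy_Schwarz_ineq_sum)
  also have "\<dots> \<le> energy 2 B B * energy 2 A A"
    unfolding energy_def[of 2 B B] using fin
    by (intro mult_left_mono sum_rep_power_le) (auto intro!: sum_nonneg)
  finally show ?thesis by (simp add: mult.commute)
qed

text \<open>The representation function of the union is at most a sum of four, with l^2 norms at
  most \<open>a^2\<close>, \<open>a b\<close>, \<open>b a\<close> and \<open>b^2\<close>, together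
  \<open>(a + b)^2\<close>.\<close>

lemma energy_2_Un_le:
  assumes fin: "finite A" "finite B" and a: "a \<ge> 0" "energy 2 A A \<le> a^4" and b: "b \<ge> 0" "energy 2 B B \<le> b^4"
  shows "energy 2 (A \<union> B) (A \<union> B) \<le> (a + b)^4"
proof -
  define U where "U = dset (A \<union> B) (A \<union> B)"
  have finU: "finite U" using fin by (simp add: U_def)
  have bound: "L2_set (\<lambda>x. real (rep P Q x)) U \<le> u * v"
    if "finite P" "finite Q" "u \<ge> 0" "v \<ge> 0" "energy 2 P P \<le> u^4" "energy 2 Q Q \<le> v^4" for P Q u v
  proof -
    have "(energy 2 P Q)^2 \<le> energy 2 P P * energy 2 Q Q" using that by (intro energy_2_cross_le)
    also have "\<dots> \<le> u^4 * v^4" using that by (intro mult_mono) (auto simp: energy_nonneg)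
    also have "\<dots> = ((u * v)^2)^2" by (simp add: power_mult_distrib flip: power_mult)
    finally have "energy 2 P Q \<le> (u * v)^2" by (rule power2_le_imp_le) simp
    moreover have "(\<Sum>x\<in>U. real (rep P Q x)^2) \<le> energy 2 P Q" using that finU by (intro sum_rep_power_le) auto
    ultimately show ?thesis unfolding L2_set_def using that by (intro real_le_lsqrt) auto
  qed
  have "sqrt (energy 2 (A \<union> B) (A \<union> B)) = L2_set (\<lambda>x. real (rep (A \<union> B) (A \<union> B) x)) U"
    by (simp add: energy_def L2_set_def U_def)
  also have "\<dots> \<le> L2_set (\<lambda>x. (real (rep A A x) + real (rep A B x)) + (real (rep B A x) + real (rep B B x))) U"
  proof (intro L2_set_mono)
    fix x
    have "rep (A \<union> B) (A \<union> B) x \<le> rep A (A \<union> B) x + rep B (A \<union> B) x" using fin by (intro rep_Un_le) auto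
    also have "\<dots> \<le> (rep A A x + rep A B x) + (rep B A x + rep B B x)"
      using fin by (intro add_mono rep_Un_right_le)
    finally show "real (rep (A \<union> B) (A \<union> B) x) \<le> (real (rep A A x) + real (rep A B x)) + (real (rep B A x) + real (rep B B x))"
      by linarith
  qed auto
  also have "\<dots> \<le> (L2_set (\<lambda>x. real (rep A A x)) U + L2_set (\<lambda>x. real (rep A B x)) U)
      + (L2_set (\<lambda>x. real (rep B A x)) U + L2_set (\<lambda>x. real (rep B B x)) U)"
    by (intro order_trans[OF L2_set_triangle_ineq] add_mono L2_set_triangle_ineq)
  also have "\<dots> \<le> (a * a + a * b) + (b * a + b * b)"
    using fin a b by (intro add_mono bound) auto
  also have "\<dots> = (a + b)^2" by (simp add: power2_eq_square algebra_simps)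
  finally have "energy 2 (A \<union> B) (A \<union> B) \<le> ((a + b)^2)^2" by (rule sqrt_le_D)
  then show ?thesis by (simp flip: power_mult)
qed

lemma first_decomposition:
  fixes A :: "real set"
  assumes A: "finite A" "A \<noteq> {}" "0 \<notin> A"
  obtains X Z where "X \<subseteq> A" "Z \<subseteq> A" "X \<union> Z = A" "card A \<le> 2 * card X" "card A \<le> 2 * card Z"
    "(energy 2 (logsgn ` Z) (logsgn ` Z))^3 * (energy 3 X X)^4 \<le> 10^12 * lg (card A)^22 * real (card A)^22"
proof -
  define N where "N = real (card A)"
  define L where "L = lg (card A)"
  \<comment> \<open>Division by zero gives \<open>h {} = 0\<close>, so \<open>h\<close> is antitone
    on nonempty sets only.\<close>
  define h where "h S = 10^12 * L^22 * N^10 / (energy 3 S S)^4" for S :: "real set"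
  \<comment> \<open>The norm is the fourth root of the energy. It is written through the cube
    because the pieces come with a bound on the cube, and \<open>12 = 3 * 4\<close> is their power
    of \<open>card S'\<close>.\<close>
  define R where "R Y a \<longleftrightarrow> (energy 2 (logsgn ` Y) (logsgn ` Y))^3 \<le> a^12" for Y :: "real set" and a :: real
  have L0: "L \<ge> 0" by (simp add: L_def lg_nonneg)
  have N0: "N \<ge> 0" by (simp add: N_def)
  have h0: "h S \<ge> 0" for S using L0 N0 by (simp add: h_def)
  have R_iff: "R Y a \<longleftrightarrow> energy 2 (logsgn ` Y) (logsgn ` Y) \<le> a^4" if "a \<ge> 0" for Y a
  proof -
    have eq: "a^12 = (a^4)^3" by (simp flip: power_mult)
    show ?thesis unfolding R_def eq by (rule power_mono_iff) (use that in \<open>auto simp: energy_nonneg\<close>)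
  qed
  have pos: "energy 3 S S > 0" if S_ne: "S \<subseteq> A" "S \<noteq> {}" for S
  proof -
    have S: "finite S" using S_ne A finite_subset by blast
    obtain s where "s \<in> S" using S_ne by auto
    then have "0 \<in> dset S S" unfolding dset_def by (intro image_eqI[of _ _ "(s, s)"]) auto
    then have "rep S S 0 \<ge> 1" using S by (intro rep_pos) auto
    then have "0 < (\<Sum>x\<in>{0}. real (rep S S x)^3)" by simp
    also have "\<dots> \<le> energy 3 S S" using S by (intro sum_rep_power_le) auto
    finally show ?thesis .
  qed
  have fin: "finite S" if "S \<subseteq> A" for S using that A finite_subset by blast
  obtain X Z where XZ: "X \<subseteq> A" "Z \<subseteq> A" "X \<union> Z = A" "card A \<le> 2 * card X" "card A \<le> 2 * card Z"
    and RZ: "R Z (real (card Z) * root 12 (h X))"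
  proof (rule decomposition[of A R "\<lambda>S. root 12 (h S)"])
    show "R {} 0" by (simp add: R_def energy_def dset_def)
    show "R (Y \<union> Y') (a + b)" if "Y \<subseteq> A" "Y' \<subseteq> A" "a \<ge> 0" "b \<ge> 0" "R Y a" "R Y' b" for Y Y' a b
      using that fin unfolding R_iff[OF that(3)] R_iff[OF that(4)] R_iff[OF add_nonneg_nonneg[OF that(3,4)]] image_Un
      by (intro energy_2_Un_le) auto
    show "R Y b" if "0 \<le> a" "a \<le> b" "R Y a" for Y a b
    proof -
      have "a^12 \<le> b^12" using that by (intro power_mono) auto
      with that show ?thesis unfolding R_def by linarith
    qed
    show "\<exists>S'\<subseteq>S. S' \<noteq> {} \<and> R S' (real (card S') * root 12 (h S))" if S: "S \<subseteq> A" "S \<noteq> {}" for S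
    proof -
      have "0 \<notin> S" using S A by auto
      from ex_small_mult_energy_subset[OF fin[OF S(1)] S(2) this] obtain S' where S': "S' \<subseteq> S" "S' \<noteq> {}"
        and E: "(energy 2 (logsgn ` S') (logsgn ` S'))^3 * (energy 3 S S)^4 \<le> 10^12 * lg (card S)^22 * real (card S)^10 * real (card S')^12"
        by blast
      have cS: "card S \<le> card A" using S A by (intro card_mono)
      have "(energy 2 (logsgn ` S') (logsgn ` S'))^3 * (energy 3 S S)^4 \<le> 10^12 * L^22 * N^10 * real (card S')^12"
        using cS lg_mono[OF cS] unfolding L_def N_def
        by (intro order_trans[OF E] mult_right_mono mult_mono power_mono) (auto simp: lg_nonneg)
      then have "(energy 2 (logsgn ` S') (logsgn ` S'))^3 \<le> 10^12 * L^22 * N^10 * real (card S')^12 / (energy 3 S S)^4"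
        using pos[OF S] by (simp add: pos_le_divide_eq)
      also have "\<dots> = real (card S')^12 * h S" by (simp add: h_def)
      also have "\<dots> = (real (card S') * root 12 (h S))^12" using h0 by (simp add: power_mult_distrib)
      finally show ?thesis using S' unfolding R_def by blast
    qed
    show "root 12 (h S') \<le> root 12 (h S)" if "S \<subseteq> S'" "S' \<subseteq> A" "S \<noteq> {}" for S S'
    proof -
      have "energy 3 S S \<le> energy 3 S' S'" using that fin by (intro energy_mono) auto
      moreover have "energy 3 S S > 0" using that by (intro pos) auto
      ultimately have "h S' \<le> h S" unfolding h_def using L0 N0
        by (intro divide_left_mono power_mono mult_pos_pos) auto
      then show ?thesis by simp
    qed
    show "root 12 (h S) \<ge> 0" for S using h0 by simp
  qed (use A in auto)
  have "X \<noteq> {}" using XZ(4) A by (auto simp: card_gt_0_iff)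
  have "(energy 2 (logsgn ` Z) (logsgn ` Z))^3 \<le> (real (card Z) * root 12 (h X))^12" using RZ by (simp add: R_def)
  also have "\<dots> = real (card Z)^12 * h X" using h0 by (simp add: power_mult_distrib)
  also have "\<dots> \<le> N^12 * h X"
    using h0 XZ A unfolding N_def by (intro mult_right_mono power_mono) (auto intro!: card_mono)
  finally have "(energy 2 (logsgn ` Z) (logsgn ` Z))^3 * (energy 3 X X)^4 \<le> N^12 * h X * (energy 3 X X)^4"
    by (intro mult_right_mono) auto
  also have "\<dots> = 10^12 * L^22 * N^22" using pos[OF XZ(1) \<open>X \<noteq> {}\<close>] by (simp add: h_def flip: power_add)
  finally show ?thesis using that XZ unfolding L_def N_def by blast
qed

lemma second_decomposition:
  fixes A :: "real set"
  assumes A: "finite A" "A \<noteq> {}" "0 \<notin> A"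
  obtains X Y where "X \<subseteq> A" "Y \<subseteq> A" "X \<union> Y = A" "card A \<le> 2 * card X" "card A \<le> 2 * card Y"
    "controlled (logsgn ` Y) (1800 * lg (card A)^5 * real (card A)^3 / ctl X)"
proof -
  define N where "N = real (card A)"
  define L where "L = lg (card A)"
  define h where "h S = 1800 * L^5 / ctl S" for S :: "real set"
  \<comment> \<open>The norm is the cube root of the control constant, which matches
    \<open>card S'^3\<close> in the bound for pieces.\<close>
  define R where "R Y a \<longleftrightarrow> controlled (logsgn ` Y) (a^3)" for Y :: "real set" and a :: real
  have L0: "L \<ge> 0" by (simp add: L_def lg_nonneg)
  have fin: "finite S" if "S \<subseteq> A" for S using that A finite_subset by blast
  have ctl1: "ctl S \<ge> 1" if "S \<subseteq> A" "S \<noteq> {}" for S using fin that by (intro ctl_ge_1)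
  have ctl0: "ctl S \<ge> 0" if "S \<subseteq> A" for S
    using controlled_nonneg[OF controlled_ctl[OF fin[OF that]]] .
  have h0: "h S \<ge> 0" if "S \<subseteq> A" for S using L0 ctl0[OF that] by (simp add: h_def)
  obtain X Y where XY: "X \<subseteq> A" "Y \<subseteq> A" "X \<union> Y = A" "card A \<le> 2 * card X" "card A \<le> 2 * card Y"
    and RY: "R Y (real (card Y) * root 3 (h X))"
  proof (rule decomposition[of A R "\<lambda>S. root 3 (h S)"])
    show "R {} 0" by (simp add: R_def controlled_def energy_def dset_def)
    show "R (Y \<union> Y') (a + b)" if "Y \<subseteq> A" "Y' \<subseteq> A" "a \<ge> 0" "b \<ge> 0" "R Y a" "R Y' b" for Y Y' a b
      using that fin unfolding R_def image_Un by (intro controlled_Un) auto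
    show "R Y b" if "0 \<le> a" "a \<le> b" "R Y a" for Y a b
      using that unfolding R_def by (auto intro: controlled_mono power_mono)
    show "\<exists>S'\<subseteq>S. S' \<noteq> {} \<and> R S' (real (card S') * root 3 (h S))" if S: "S \<subseteq> A" "S \<noteq> {}" for S
    proof -
      have "0 \<notin> S" using S A by auto
      from ex_mult_controlled_subset[OF fin[OF S(1)] S(2) this] obtain S' where S': "S' \<subseteq> S" "S' \<noteq> {}"
        and K: "controlled (logsgn ` S') (1800 * lg (card S)^5 * real (card S')^3 / ctl S)"
        by blast
      have cS: "card S \<le> card A" using S A by (intro card_mono)
      have "1800 * lg (card S)^5 * real (card S')^3 / ctl S \<le> 1800 * L^5 * real (card S')^3 / ctl S"
        using lg_mono[OF cS] ctl0[OF S(1)] unfolding L_def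
        by (intro divide_right_mono mult_right_mono mult_left_mono power_mono) (auto simp: lg_nonneg)
      also have "\<dots> = (real (card S') * root 3 (h S))^3" using h0[OF S(1)] by (simp add: power_mult_distrib h_def)
      finally show ?thesis using S' controlled_mono[OF K] unfolding R_def by blast
    qed
    show "root 3 (h S') \<le> root 3 (h S)" if "S \<subseteq> S'" "S' \<subseteq> A" "S \<noteq> {}" for S S'
    proof -
      have "ctl S \<le> ctl S'" using that fin by (intro ctl_mono) auto
      moreover have "ctl S \<ge> 1" using that by (intro ctl1) auto
      ultimately have "h S' \<le> h S" unfolding h_def using L0 by (intro divide_left_mono mult_pos_pos) auto
      then show ?thesis by simp
    qed
    show "root 3 (h S) \<ge> 0" if "S \<subseteq> A" for S using h0[OF that] by simp
  qed (use A in auto)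
  have "(real (card Y) * root 3 (h X))^3 = real (card Y)^3 * h X" using h0[OF XY(1)] by (simp add: power_mult_distrib)
  also have "\<dots> \<le> N^3 * h X"
    using h0[OF XY(1)] XY A unfolding N_def by (intro mult_right_mono power_mono) (auto intro!: card_mono)
  also have "\<dots> = 1800 * L^5 * N^3 / ctl X" by (simp add: h_def)
  finally have "controlled (logsgn ` Y) (1800 * L^5 * N^3 / ctl X)"
    using RY controlled_mono unfolding R_def by blast
  then show ?thesis using that XY unfolding L_def N_def by blast
qed

section \<open>The theorem\<close>

text \<open>The powers 7, 1, 21 and 14 of the four bounds make \<open>e\<close>, \<open>K\<close>
  and \<open>K'\<close> disappear; they also produce
  \<open>7 * 30 + 30 + 14 * 5 + 21 * 22 = 772\<close> logarithms.\<close>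

lemma exponent_arith:
  fixes eX eY eZ e K K' N L c1 c2 c3 :: real
  assumes nonneg: "eX \<ge> 0" "eY \<ge> 0" "eZ \<ge> 0" "e \<ge> 0" "K \<ge> 0" "K' \<ge> 0" "N \<ge> 0" "L \<ge> 0" "c1 \<ge> 0" "c2 \<ge> 0" "c3 \<ge> 0"
    and X: "eX^26 \<le> c1 * L^30 * K^2 * N^26 * e^12"
    and Y: "eY^26 \<le> c1 * L^30 * K'^14 * N^50"
    and Z: "eZ^3 * e^4 \<le> c2 * L^22 * N^22"
    and K: "K * K' \<le> c3 * L^5 * N^3"
  shows "eX^182 * eY^26 * eZ^63 \<le> (c1^8 * c2^21 * c3^14) * N^736 * L^772"
proof -
  have "eX^182 * eY^26 * eZ^63 = (eX^26)^7 * eY^26 * eZ^63" by (simp flip: power_mult)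
  also have "\<dots> \<le> (c1 * L^30 * K^2 * N^26 * e^12)^7 * (c1 * L^30 * K'^14 * N^50) * eZ^63"
    using X Y nonneg by (intro mult_right_mono mult_mono power_mono) auto
  also have "\<dots> = c1^8 * L^240 * N^232 * (K * K')^14 * (eZ^3 * e^4)^21"
    by (simp add: power_mult_distrib mult_ac flip: power_mult power_add) (simp add: power_numeral_reduce mult_ac)
  also have "\<dots> \<le> c1^8 * L^240 * N^232 * (c3 * L^5 * N^3)^14 * (c2 * L^22 * N^22)^21"
    by (rule mult_mono[OF mult_left_mono[OF power_mono[OF K]] power_mono[OF Z]]) (use nonneg in auto)
  also have "\<dots> = (c1^8 * c2^21 * c3^14) * N^736 * L^772"
    by (simp add: power_mult_distrib mult_ac flip: power_mult power_add)
  finally show ?thesis .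
qed

theorem mainTheorem12:
  shows "\<exists>C c :: real. C > 0 \<and> c > 0 \<and>
    (\<forall>A :: real set. finite A \<longrightarrow> 0 \<notin> A \<longrightarrow>
      (\<exists>X Y Z. X \<subseteq> A \<and> Y \<subseteq> A \<and> Z \<subseteq> A \<and> X \<union> Y \<union> Z = A \<and>
         real (card X) \<ge> real (card A) / 4 \<and> real (card Y) \<ge> real (card A) / 4 \<and>
         real (card Z) \<ge> real (card A) / 2 \<and>
         real (add_energy X) ^ 182 * real (mult_energy Y) ^ 26 * real (mult_energy Z) ^ 63
           \<le> C * real (card A) ^ 736 * (ln (2 + real (card A))) powr c))"
proof -
  define c1 c2 c3 where "c1 = (2 :: real)^70" "c2 = (10 :: real)^12" "c3 = (1800 :: real)"
  note cdefs = this
  define C where "C = c1^8 * c2^21 * c3^14 * 2^772"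
  have cpos: "c1 > 0" "c2 > 0" "c3 > 0" by (auto simp: cdefs)
  then have "C > 0" by (simp add: C_def)
  have "\<exists>X Y Z. X \<subseteq> A \<and> Y \<subseteq> A \<and> Z \<subseteq> A \<and> X \<union> Y \<union> Z = A \<and>
         real (card X) \<ge> real (card A) / 4 \<and> real (card Y) \<ge> real (card A) / 4 \<and>
         real (card Z) \<ge> real (card A) / 2 \<and>
         real (add_energy X) ^ 182 * real (mult_energy Y) ^ 26 * real (mult_energy Z) ^ 63
           \<le> C * real (card A) ^ 736 * (ln (2 + real (card A))) powr 772"
    if A: "finite A" "0 \<notin> A" for A :: "real set"
  proof (cases "A = {}")
    case True
    moreover have "real (add_energy {}) = 0" using add_energy_eq[of "{}"] by (simp add: energy_def dset_def)
    ultimately show ?thesis by (intro exI[of _ "{}"]) simp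
  next
    case False
    obtain A1 Z where A1: "A1 \<subseteq> A" "Z \<subseteq> A" "A1 \<union> Z = A" "card A \<le> 2 * card A1" "card A \<le> 2 * card Z"
      and Z: "(energy 2 (logsgn ` Z) (logsgn ` Z))^3 * (energy 3 A1 A1)^4 \<le> 10^12 * lg (card A)^22 * real (card A)^22"
      by (rule first_decomposition[OF A(1) False A(2)])
    have finA1: "finite A1" "finite Z" using A1 A finite_subset by auto
    have "card A > 0" using A False by (simp add: card_gt_0_iff)
    then have "A1 \<noteq> {}" "0 \<notin> A1" using A1 A by auto
    then obtain X Y where XY: "X \<subseteq> A1" "Y \<subseteq> A1" "X \<union> Y = A1" "card A1 \<le> 2 * card X" "card A1 \<le> 2 * card Y"
      and Y: "controlled (logsgn ` Y) (1800 * lg (card A1)^5 * real (card A1)^3 / ctl X)"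
      using second_decomposition[OF finA1(1)] by metis
    have finXY: "finite X" "finite Y" using XY finA1 finite_subset by auto
    have ne: "X \<noteq> {}" "Y \<noteq> {}" using XY \<open>A1 \<noteq> {}\<close> finA1 by auto
    have not0: "0 \<notin> Y" "0 \<notin> Z" using XY A1 A by auto
    define N where "N = real (card A)"
    define L where "L = lg (card A)"
    define e where "e = energy 3 A1 A1"
    define K where "K = ctl X"
    define K' where "K' = 1800 * lg (card A1)^5 * real (card A1)^3 / ctl X"
    define eX where "eX = energy 2 X X"
    define eY where "eY = energy 2 (logsgn ` Y) (logsgn ` Y)"
    define eZ where "eZ = energy 2 (logsgn ` Z) (logsgn ` Z)"
    have K1: "K \<ge> 1" unfolding K_def using finXY ne by (intro ctl_ge_1)
    have K'0: "K' \<ge> 0" using K1 by (simp add: K'_def K_def lg_nonneg)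
    have N0: "N \<ge> 0" by (simp add: N_def)
    have L0: "L \<ge> 0" by (simp add: L_def lg_nonneg)
    have e0: "e \<ge> 0" and E0: "eX \<ge> 0" "eY \<ge> 0" "eZ \<ge> 0" by (auto simp: e_def eX_def eY_def eZ_def energy_nonneg)
    have cA: "card A1 \<le> card A" "card X \<le> card A" "card Y \<le> card A"
      using A A1 XY by (auto intro!: card_mono)
    have eX: "eX^26 \<le> c1 * L^30 * K^2 * N^26 * e^12"
    proof -
      have "eX^26 \<le> c1 * lg (card X)^30 * K^2 * real (card X)^26 * (energy 3 X X)^12"
        unfolding eX_def K_def cdefs by (rule energy_le_control[OF finXY(1) ne(1) controlled_ctl[OF finXY(1)]])
      \<comment> \<open>The third moment of \<open>X\<close> is enlarged to that of
        \<open>A1\<close>, the one that \<open>Z\<close> compensates.\<close>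
      also have "\<dots> \<le> c1 * L^30 * K^2 * N^26 * e^12"
        using cA lg_mono[OF cA(2)] XY finA1 cpos K1 unfolding L_def N_def e_def
        by (intro mult_mono power_mono energy_mono) (auto simp: lg_nonneg energy_nonneg)
      finally show ?thesis .
    qed
    have eY: "eY^26 \<le> c1 * L^30 * K'^14 * N^50"
    proof -
      have cY: "card (logsgn ` Y) = card Y" using not0 by (intro card_logsgn)
      \<comment> \<open>Control of \<open>Y\<close> is used twice: in the energy bound, and here on
        \<open>Y\<close> itself for the third moment. Hence \<open>14 = 2 + 12\<close>.\<close>
      have "energy 3 (logsgn ` Y) (logsgn ` Y) \<le> K' * real (card Y)^2"
        using Y finXY unfolding controlled_def K'_def by (metis cY finite_imageI)
      also have "\<dots> \<le> K' * N^2" using cA K'0 by (intro mult_left_mono power_mono) (auto simp: N_def)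
      finally have E3: "energy 3 (logsgn ` Y) (logsgn ` Y) \<le> K' * N^2" .
      have "eY^26 \<le> c1 * lg (card Y)^30 * K'^2 * real (card Y)^26 * (energy 3 (logsgn ` Y) (logsgn ` Y))^12"
        using energy_le_control[OF _ _ Y[folded K'_def]] finXY ne unfolding eY_def cdefs cY by auto
      also have "\<dots> \<le> c1 * L^30 * K'^2 * N^26 * (K' * N^2)^12"
        using cA lg_mono[OF cA(3)] cpos E3 K'0 unfolding L_def N_def
        by (intro mult_mono power_mono) (auto simp: lg_nonneg energy_nonneg)
      also have "\<dots> = c1 * L^30 * K'^14 * N^50" by (simp add: power_mult_distrib mult_ac flip: power_mult power_add)
      finally show ?thesis .
    qed
    have KK': "K * K' \<le> c3 * L^5 * N^3"
    proof -
      have "K * K' = c3 * lg (card A1)^5 * real (card A1)^3" using K1 by (simp add: K_def K'_def cdefs)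
      also have "\<dots> \<le> c3 * L^5 * N^3" using cA lg_mono[OF cA(1)] cpos unfolding L_def N_def
        by (intro mult_mono power_mono) (auto simp: lg_nonneg)
      finally show ?thesis .
    qed
    have eZ: "eZ^3 * e^4 \<le> c2 * L^22 * N^22" using Z by (simp only: eZ_def e_def cdefs L_def N_def)
    have "eX^182 * eY^26 * eZ^63 \<le> (c1^8 * c2^21 * c3^14) * N^736 * L^772"
      using eX eY eZ KK' E0 e0 K1 K'0 N0 L0 cpos by (intro exponent_arith) auto
    also have "\<dots> \<le> (c1^8 * c2^21 * c3^14) * N^736 * (2 * ln (2 + N))^772"
    proof (intro mult_left_mono power_mono)
      \<comment> \<open>\<open>N >= 1\<close> gives \<open>ln (2 + N) >= ln 3 >= 1\<close>, which
        absorbs the summand 1 of \<open>lg\<close>; the factor 2 accounts for \<open>2^772\<close>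
        in \<open>C\<close>.\<close>
      have N1: "N \<ge> 1" using \<open>card A > 0\<close> by (simp add: N_def)
      have "exp 1 \<le> (3::real)" by (rule exp_le)
      then have "1 \<le> ln (3::real)" by (subst ln_ge_iff) auto
      also have "\<dots> \<le> ln (2 + N)" using N1 by simp
      finally have "1 \<le> ln (2 + N)" .
      moreover have "ln N \<le> ln (2 + N)" using N1 by simp
      ultimately show "L \<le> 2 * ln (2 + N)" by (simp add: L_def lg_def N_def)
    qed (use cpos N0 L0 in auto)
    also have "\<dots> = C * N^736 * ln (2 + N)^772" by (simp only: C_def power_mult_distrib mult_ac)
    also have "ln (2 + N)^772 = ln (2 + N) powr 772"
      using N0 by (subst powr_realpow[symmetric]) auto
    finally have "real (add_energy X) ^ 182 * real (mult_energy Y) ^ 26 * real (mult_energy Z) ^ 63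
        \<le> C * real (card A) ^ 736 * (ln (2 + real (card A))) powr 772"
      by (simp only: add_energy_eq[OF finXY(1)] mult_energy_eq[OF finXY(2) not0(1)] mult_energy_eq[OF finA1(2) not0(2)]
          eX_def eY_def eZ_def N_def)
    moreover have "real (card X) \<ge> real (card A) / 4" "real (card Y) \<ge> real (card A) / 4" "real (card Z) \<ge> real (card A) / 2"
      using A1 XY by linarith+
    moreover have "X \<subseteq> A" "Y \<subseteq> A" "Z \<subseteq> A" "X \<union> Y \<union> Z = A" using A1 XY by auto
    ultimately show ?thesis by blast
  qed
  then show ?thesis using \<open>C > 0\<close> by (intro exI[of _ C] exI[of _ 772]) auto
qed

end
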